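(* Let $I\subseteq\mathbb{R}$ be an open interval (possibly unbounded). Let $a,b,c\in D'(I)$ be complex-valued and $\mathcal{L}u=(a\,u')'+b\,u'+c\,u$. Suppose that $p={\rm Re}\,a\in L^1_{\rm loc}(I)$ and ${\rm Im}\,b\in L^1_{\rm loc}(I)$. (i) The operator $-\mathcal{L}$ is accretive if and only if $p\ge0$ a.e., $\frac{({\rm Im}\,b)^2}{p}\in L^1_{\rm loc}(I)$, and the following quadratic form inequality holds: $$\int_I p\,(h')^2\,dx-\left\langle{\rm Re}\,c-\tfrac12({\rm Re}\,b)',\,h^2\right\rangle-\int_I\frac{({\rm Im}\,b)^2}{4p}\,h^2\,dx\ge0$$ for all real-valued $h\in C_0^\infty(I)$. (ii) Suppose $p\ge 0$ a.e. and $\frac{({\rm Im}\,b)^2}{p}\in L^1_{\rm loc}(I)$. If there exists a (real-valued) function $f\in L^1_{\rm loc}(I)$ such that $\frac{f^2}{p}\in L^1_{\rm loc}(I)$ and $$\mathrm{Re}\,c-\tfrac12({\rm Re}\,b)'+\frac{({\rm Im}\,b)^2}{4p}\le f'-\frac{f^2}{p}\quad\text{in } D'(I),\qquad( * )$$ then the operator $-\mathcal{L}$ is accretive. Conversely, if $-\mathcal{L}$ is accretive, and $m\le p(x)\le M$ a.e. for some constants $M,m>0$, then there exists a (real-valued) function $f\in L^2_{\rm loc}(I)$ such that $( * )$ holds.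
   Context: $D'(I)$ denotes the distributions on $I$. The form of $\mathcal{L}$ is $\langle\mathcal{L}u,v\rangle=-\langle a u',v'\rangle+\langle bu',v\rangle+\langle cu,v\rangle$ for $u,v\in C_0^\infty(I)$ complex-valued, where $\langle a u',v'\rangle=a(u'\,\overline{v'})$, $\langle bu',v\rangle=b(u'\overline v)$, $\langle cu,v\rangle=c(u\overline v)$ (each distribution being applied to the test function in parentheses). The operator $-\mathcal{L}$ is accretive if ${\rm Re}\,\langle-\mathcal{L}u,u\rangle\ge0$ for all complex-valued $u\in C_0^\infty(I)$. The convention $\frac00=0$ is used in the quotients (and a nonzero number divided by $0$ is infinite, so local integrability of $\frac{({\rm Im}\,b)^2}{p}$ forces ${\rm Im}\,b=0$ a.e. on $\{p=0\}$, and similarly for $f$). $\langle\sigma,h^2\rangle$ denotes the distribution $\sigma$ applied to $h^2$. An inequality $S\le T$ in $D'(I)$ means $(T-S)(\varphi)\ge0$ for every nonnegative $\varphi\in C_0^\infty(I)$. *)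

theory Defs
  imports "HOL-Analysis.Analysis"
begin

definition vderiv :: "(real \<Rightarrow> 'a::real_normed_vector) \<Rightarrow> real \<Rightarrow> 'a" where
  "vderiv f = (\<lambda>x. vector_derivative f (at x))"

text \<open>Elements of \<open>C\<^sub>0\<^sup>\<infinity>(I)\<close> are represented by their extensions by zero to the whole line.\<close>

definition test_functions :: "real set \<Rightarrow> (real \<Rightarrow> 'a::real_normed_vector) set" where
  "test_functions I =
    {\<phi>. (\<forall>k x. (vderiv ^^ k) \<phi> differentiable at x) \<and>
        compact (closure {x. \<phi> x \<noteq> 0}) \<and> closure {x. \<phi> x \<noteq> 0} \<subseteq> I}"

text \<open>
  Complex-valued distributions on \<open>I\<close>: complex-linear functionals on the complex-valued test
  functions, with continuity expressed by the usual seminorm estimates on each compact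
  \<open>K \<subseteq> I\<close>. The values of \<open>T\<close> outside \<open>test_functions I\<close> are irrelevant.
\<close>

definition distributions :: "real set \<Rightarrow> ((real \<Rightarrow> complex) \<Rightarrow> complex) set" where
  "distributions I =
    {T. (\<forall>\<phi>\<in>test_functions I. \<forall>\<psi>\<in>test_functions I. T (\<lambda>x. \<phi> x + \<psi> x) = T \<phi> + T \<psi>) \<and>
        (\<forall>z. \<forall>\<phi>\<in>test_functions I. T (\<lambda>x. z * \<phi> x) = z * T \<phi>) \<and>
        (\<forall>K. compact K \<and> K \<subseteq> I \<longrightarrow>
          (\<exists>C N. \<forall>\<phi>\<in>test_functions I. closure {x. \<phi> x \<noteq> 0} \<subseteq> K \<longrightarrow>
            norm (T \<phi>) \<le> C * (\<Sum>k\<le>N. SUP x. norm ((vderiv ^^ k) \<phi> x))))}"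

text \<open>
  The real and imaginary parts of a complex distribution \<open>T = Re T + \<i> Im T\<close> are real
  distributions, i.e. real functionals on the real-valued test functions.
\<close>

definition dist_Re :: "((real \<Rightarrow> complex) \<Rightarrow> complex) \<Rightarrow> (real \<Rightarrow> real) \<Rightarrow> real" where
  "dist_Re T \<phi> = Re (T (\<lambda>x. complex_of_real (\<phi> x)))"

definition dist_Im :: "((real \<Rightarrow> complex) \<Rightarrow> complex) \<Rightarrow> (real \<Rightarrow> real) \<Rightarrow> real" where
  "dist_Im T \<phi> = Im (T (\<lambda>x. complex_of_real (\<phi> x)))"

definition dist_deriv :: "((real \<Rightarrow> real) \<Rightarrow> real) \<Rightarrow> (real \<Rightarrow> real) \<Rightarrow> real" where
  "dist_deriv S \<phi> = - S (vderiv \<phi>)"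

definition dist_of_fun :: "real set \<Rightarrow> (real \<Rightarrow> real) \<Rightarrow> (real \<Rightarrow> real) \<Rightarrow> real" where
  "dist_of_fun I f \<phi> = (LINT x:I|lebesgue. f x * \<phi> x)"

definition dist_eq :: "real set \<Rightarrow> ((real \<Rightarrow> real) \<Rightarrow> real) \<Rightarrow> ((real \<Rightarrow> real) \<Rightarrow> real) \<Rightarrow> bool" where
  "dist_eq I S T \<longleftrightarrow> (\<forall>\<phi>\<in>test_functions I. S \<phi> = T \<phi>)"

definition dist_le :: "real set \<Rightarrow> ((real \<Rightarrow> real) \<Rightarrow> real) \<Rightarrow> ((real \<Rightarrow> real) \<Rightarrow> real) \<Rightarrow> bool" where
  "dist_le I S T \<longleftrightarrow> (\<forall>\<phi>\<in>test_functions I. (\<forall>x. 0 \<le> \<phi> x) \<longrightarrow> 0 \<le> T \<phi> - S \<phi>)"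

definition L1_loc :: "real set \<Rightarrow> (real \<Rightarrow> real) set" where
  "L1_loc I = {f. \<forall>K. compact K \<and> K \<subseteq> I \<longrightarrow> f absolutely_integrable_on K}"

definition L2_loc :: "real set \<Rightarrow> (real \<Rightarrow> real) set" where
  "L2_loc I = {f. \<forall>K. compact K \<and> K \<subseteq> I \<longrightarrow>
    f \<in> borel_measurable (lebesgue_on K) \<and> (\<lambda>x. (f x)\<^sup>2) absolutely_integrable_on K}"

text \<open>
  Local integrability of \<open>f\<^sup>2 / p\<close> under the conventions \<open>0 / 0 = 0\<close> and \<open>t / 0 = \<infinity>\<close> for
  \<open>t \<noteq> 0\<close>. Since HOL's real division has \<open>t / 0 = 0\<close> for every \<open>t\<close>, finiteness almost everywhere
  has to be demanded separately; almost everywhere the HOL quotient is then the intended one.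
\<close>

definition sq_quotient_L1_loc :: "real set \<Rightarrow> (real \<Rightarrow> real) \<Rightarrow> (real \<Rightarrow> real) \<Rightarrow> bool" where
  "sq_quotient_L1_loc I f p \<longleftrightarrow>
    (AE x\<in>I in lebesgue. p x = 0 \<longrightarrow> f x = 0) \<and> (\<lambda>x. (f x)\<^sup>2 / p x) \<in> L1_loc I"

text \<open>The sesquilinear form of \<open>L u = (a u')' + b u' + c u\<close>.\<close>

definition L_form ::
  "((real \<Rightarrow> complex) \<Rightarrow> complex) \<Rightarrow> ((real \<Rightarrow> complex) \<Rightarrow> complex) \<Rightarrow> ((real \<Rightarrow> complex) \<Rightarrow> complex) \<Rightarrow>
   (real \<Rightarrow> complex) \<Rightarrow> (real \<Rightarrow> complex) \<Rightarrow> complex" where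
  "L_form a b c u v =
    - a (\<lambda>x. vderiv u x * cnj (vderiv v x)) + b (\<lambda>x. vderiv u x * cnj (v x)) + c (\<lambda>x. u x * cnj (v x))"

definition neg_L_accretive ::
  "real set \<Rightarrow> ((real \<Rightarrow> complex) \<Rightarrow> complex) \<Rightarrow> ((real \<Rightarrow> complex) \<Rightarrow> complex) \<Rightarrow>
   ((real \<Rightarrow> complex) \<Rightarrow> complex) \<Rightarrow> bool" where
  "neg_L_accretive I a b c \<longleftrightarrow> (\<forall>u\<in>test_functions I. 0 \<le> Re (- L_form a b c u u))"

text \<open>
  The inequality \<open>Re c - (Re b)' / 2 + q\<^sup>2 / (4p) \<le> f' - f\<^sup>2 / p\<close> in \<open>D'(I)\<close>, where \<open>q\<close> is \<open>Im b\<close>.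
\<close>

definition riccati_ineq ::
  "real set \<Rightarrow> ((real \<Rightarrow> complex) \<Rightarrow> complex) \<Rightarrow> ((real \<Rightarrow> complex) \<Rightarrow> complex) \<Rightarrow>
   (real \<Rightarrow> real) \<Rightarrow> (real \<Rightarrow> real) \<Rightarrow> (real \<Rightarrow> real) \<Rightarrow> bool" where
  "riccati_ineq I b c p q f \<longleftrightarrow>
    dist_le I
      (\<lambda>\<phi>. dist_Re c \<phi> - 1/2 * dist_deriv (dist_Re b) \<phi> + dist_of_fun I (\<lambda>x. (q x)\<^sup>2 / (4 * p x)) \<phi>)
      (\<lambda>\<phi>. dist_deriv (dist_of_fun I f) \<phi> - dist_of_fun I (\<lambda>x. (f x)\<^sup>2 / p x) \<phi>)"

end

theory Submission
  imports Defs
begin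

text \<open>
  Write \<open>q = Im b\<close> and \<open>\<sigma> = Re c - (Re b)' / 2\<close>. For a complex test function \<open>u\<close>,
  \<open>Re \<langle>- L u, u\<rangle> = \<integral> p |u'|\<^sup>2 + \<integral> q Im (u' cnj u) - \<langle>\<sigma>, |u|\<^sup>2\<rangle>\<close>, and for \<open>u = h exp (i \<theta>)\<close> with \<open>\<theta>' = \<eta>\<close>
  this is \<open>\<integral> p h'\<^sup>2 + \<integral> (p \<eta>\<^sup>2 + q \<eta>) h\<^sup>2 - \<langle>\<sigma>, h\<^sup>2\<rangle>\<close>. Minimising over the phase replaces \<open>p \<eta>\<^sup>2 + q \<eta>\<close> by
  \<open>- q\<^sup>2 / (4 p)\<close>, and leaves the reduced form of the theorem, which only involves the real function \<open>h\<close>.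

  If \<open>- L\<close> is accretive, one may really insert all these phases: polynomial \<open>\<eta>\<close> give honest test
  functions, and limits reach every bounded measurable \<open>\<eta>\<close>. Large multiples of the indicator
  function of \<open>{p < 0}\<close> give \<open>p \<ge> 0\<close> (\<open>accretive_imp_p_nonneg\<close>); truncations of \<open>- q / (2 p)\<close> and monotone
  convergence give the integrability of \<open>q\<^sup>2 / p\<close> and the reduced inequality
  (\<open>accretive_imp_potential_bound\<close>). Conversely, the reduced inequality for \<open>h = |u|\<close> implies
  \<open>Re \<langle>- L u, u\<rangle> \<ge> 0\<close> by a pointwise completion of squares, provided that \<open>|u|\<close> is smooth. A smooth plane curve
  misses almost every point, so an arbitrarily small perturbation of \<open>u\<close> has no zeros on the
  support of \<open>u\<close> and has a smooth modulus (\<open>accretive_if_reduced_form\<close>).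

  A solution \<open>f\<close> of the Riccati inequality, tested with \<open>h\<^sup>2\<close>, gives the reduced inequality by another
  completion of squares (\<open>accretive_if_riccati\<close>).

  For the last statement put \<open>\<tau> = \<sigma> + q\<^sup>2 / (4 p)\<close>. The substitution \<open>\<phi> = h\<^sup>2\<close> turns the reduced inequality into
  \<open>\<langle>\<tau>, \<phi>\<rangle> \<le> \<integral> p \<phi>'\<^sup>2 / (4 \<phi>)\<close>: a linear functional is dominated by a convex, positively homogeneous one,
  which is the supremum over \<open>g\<close> of the functionals \<open>\<integral> p (g \<phi>' - g\<^sup>2 \<phi>)\<close>. The Riccati inequality, with
  \<open>f = - p g\<close>, says that one \<open>g\<close> works for all \<open>\<phi> \<ge> 0\<close>. This is a minimax statement. For finitely many \<open>\<phi>\<close> and up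
  to a small error, such a \<open>g\<close> is the logarithmic derivative of the root of a near-minimiser of the
  difference of the two sides over a convex set of test functions, and the inequalities are its first-order
  optimality conditions (\<open>approximate_supersolution\<close>). The conditions on \<open>g\<close> define closed convex
  sets, and those that come from squares of cutoff functions bound \<open>g\<close> locally in \<open>L\<^sup>2\<close>, so all conditions
  can be met together by weak compactness (\<open>square_integrable_finite_intersection\<close>,
  \<open>supersolution_exists\<close>). This is where \<open>0 < m \<le> p \<le> M\<close> enters: \<open>m\<close> yields the local bounds, and \<open>M\<close> makes
  the conditions meaningful for every locally square-integrable \<open>g\<close>.
\<close>

section \<open>Smooth functions on open subsets of the line\<close>

text \<open>
  Membership in \<open>test_functions\<close> is a statement about all iterated derivatives on the whole line.
  The constructions below (square roots, quotients, moduli) are smooth for different reasons on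
  different open sets, so differentiability up to order \<open>n\<close> is relativised to a set. Peeling
  derivatives off from the inside makes the product and the chain rule plain inductions on \<open>n\<close>.
\<close>

primrec diff_upto :: "nat \<Rightarrow> real set \<Rightarrow> (real \<Rightarrow> 'a::real_normed_vector) \<Rightarrow> bool" where
  "diff_upto 0 U f \<longleftrightarrow> True"
| "diff_upto (Suc n) U f \<longleftrightarrow> (\<forall>x\<in>U. f differentiable at x) \<and> diff_upto n U (vderiv f)"

definition smooth_on :: "real set \<Rightarrow> (real \<Rightarrow> 'a::real_normed_vector) \<Rightarrow> bool" where
  "smooth_on U f \<longleftrightarrow> (\<forall>n. diff_upto n U f)"

lemma vderiv_works:
  "f differentiable at x \<Longrightarrow> (f has_vector_derivative vderiv f x) (at x)"
  unfolding vderiv_def by (simp add: vector_derivative_works)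

lemma vderiv_eqI: "(f has_vector_derivative d) (at x) \<Longrightarrow> vderiv f x = d"
  unfolding vderiv_def by (rule vector_derivative_at)

lemma diff_upto_iff_funpow:
  "diff_upto n U f \<longleftrightarrow> (\<forall>k<n. \<forall>x\<in>U. (vderiv ^^ k) f differentiable at x)"
proof (induction n arbitrary: f)
  case (Suc n)
  show ?case
    by (auto simp: Suc All_less_Suc2 funpow_swap1)
qed simp

lemma smooth_on_iff_funpow:
  "smooth_on U f \<longleftrightarrow> (\<forall>k. \<forall>x\<in>U. (vderiv ^^ k) f differentiable at x)"
  unfolding smooth_on_def diff_upto_iff_funpow by blast

lemma diff_upto_Suc_imp: "diff_upto (Suc n) U f \<Longrightarrow> diff_upto n U f"
  by (simp add: diff_upto_iff_funpow)

lemma diff_upto_cong: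
  assumes "open U" "\<And>x. x \<in> U \<Longrightarrow> f x = g x" "diff_upto n U f"
  shows "diff_upto n U g"
  using assms(2,3)
proof (induction n arbitrary: f g)
  case (Suc n)
  have g: "(g has_vector_derivative vderiv f x) (at x)" if "x \<in> U" for x
    using has_vector_derivative_transform_within_open[OF vderiv_works assms(1) that] Suc.prems that
    by auto
  then have "vderiv f x = vderiv g x" if "x \<in> U" for x
    using vderiv_eqI that by metis
  then show ?case
    using Suc.IH[of "vderiv f" "vderiv g"] Suc.prems g by (auto intro: differentiableI_vector)
qed simp

lemma smooth_on_cong:
  assumes "open U" "\<And>x. x \<in> U \<Longrightarrow> f x = g x" "smooth_on U f"
  shows "smooth_on U g"
  using diff_upto_cong[OF assms(1), of f g] assms(2,3) unfolding smooth_on_def by blast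

text \<open>
  With \<open>smooth_on_cong\<close>, this is the gluing principle: smoothness may be checked on the pieces of
  an open cover, using a different formula on each piece.
\<close>

lemma smooth_on_Un: "smooth_on U f \<Longrightarrow> smooth_on V f \<Longrightarrow> smooth_on (U \<union> V) f"
  unfolding smooth_on_iff_funpow by blast

lemma smooth_on_subset: "smooth_on U f \<Longrightarrow> V \<subseteq> U \<Longrightarrow> smooth_on V f"
  unfolding smooth_on_iff_funpow by blast

lemma smooth_on_vderiv: "smooth_on U f \<Longrightarrow> smooth_on U (vderiv f)"
  unfolding smooth_on_def by (metis diff_upto.simps(2))

lemma smooth_on_has_vderiv:
  "smooth_on U f \<Longrightarrow> x \<in> U \<Longrightarrow> (f has_vector_derivative vderiv f x) (at x)"
  unfolding smooth_on_def by (metis diff_upto.simps(2) vderiv_works)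

lemma smooth_on_continuous: "smooth_on U f \<Longrightarrow> continuous_on U f"
  by (meson smooth_on_has_vderiv continuous_at_imp_continuous_on has_vector_derivative_continuous)

text \<open>
  The form in which all closure properties are proved: it suffices to know some derivative on \<open>U\<close>,
  without computing \<open>vderiv\<close>, and the induction hypothesis applies to it.
\<close>

lemma diff_upto_SucI:
  assumes "open U" "\<And>x. x \<in> U \<Longrightarrow> (f has_vector_derivative f' x) (at x)" "diff_upto n U f'"
  shows "diff_upto (Suc n) U f"
proof -
  have "diff_upto n U (vderiv f)"
    using diff_upto_cong[OF assms(1) _ assms(3)] assms(2) vderiv_eqI by metis
  then show ?thesis
    using assms(2) by (auto intro: differentiableI_vector)
qed

lemma diff_upto_bounded_linear:
  assumes "bounded_linear L" "open U" "diff_upto n U f"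
  shows "diff_upto n U (\<lambda>x. L (f x))"
  using assms(3)
proof (induction n arbitrary: f)
  case (Suc n)
  show ?case
  proof (rule diff_upto_SucI[OF assms(2)])
    show "((\<lambda>x. L (f x)) has_vector_derivative L (vderiv f x)) (at x)" if "x \<in> U" for x
      using bounded_linear.has_vector_derivative[OF assms(1) vderiv_works] Suc.prems that by simp
  qed (use Suc in auto)
qed simp

lemma diff_upto_add:
  assumes "open U" "diff_upto n U f" "diff_upto n U g"
  shows "diff_upto n U (\<lambda>x. f x + g x)"
  using assms(2,3)
proof (induction n arbitrary: f g)
  case (Suc n)
  show ?case
  proof (rule diff_upto_SucI[OF assms(1)])
    show "((\<lambda>x. f x + g x) has_vector_derivative vderiv f x + vderiv g x) (at x)" if "x \<in> U" for x
      using Suc.prems that by (auto intro!: has_vector_derivative_add vderiv_works)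
  qed (use Suc in auto)
qed simp

lemma diff_upto_bilinear:
  assumes "bounded_bilinear B" "open U" "diff_upto n U f" "diff_upto n U g"
  shows "diff_upto n U (\<lambda>x. B (f x) (g x))"
  using assms(3,4)
proof (induction n arbitrary: f g)
  case (Suc n)
  show ?case
  proof (rule diff_upto_SucI[OF assms(2)])
    show "((\<lambda>x. B (f x) (g x)) has_vector_derivative
        B (f x) (vderiv g x) + B (vderiv f x) (g x)) (at x)" if "x \<in> U" for x
      using bounded_bilinear.has_vector_derivative[OF assms(1) vderiv_works vderiv_works]
        Suc.prems that by auto
    show "diff_upto n U (\<lambda>x. B (f x) (vderiv g x) + B (vderiv f x) (g x))"
      using Suc.IH[of f "vderiv g"] Suc.IH[of "vderiv f" g] Suc.prems diff_upto_Suc_imp[of n U f] diff_upto_Suc_imp[of n U g]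
      by (auto intro!: diff_upto_add[OF assms(2)])
  qed
qed simp

lemma diff_upto_compose:
  fixes g :: "real \<Rightarrow> real"
  assumes "open U" "g ` U \<subseteq> V" "diff_upto n V f" "diff_upto n U g"
  shows "diff_upto n U (\<lambda>x. f (g x))"
  using assms(3,4)
proof (induction n arbitrary: f)
  case (Suc n)
  show ?case
  proof (rule diff_upto_SucI[OF assms(1)])
    show "((\<lambda>x. f (g x)) has_vector_derivative vderiv g x *\<^sub>R vderiv f (g x)) (at x)"
      if "x \<in> U" for x
    proof -
      have "g differentiable at x" "f differentiable at (g x)"
        using Suc.prems that assms(2) by auto
      then show ?thesis
        using vector_diff_chain_at[OF vderiv_works vderiv_works] by (simp add: o_def)
    qed
    show "diff_upto n U (\<lambda>x. vderiv g x *\<^sub>R vderiv f (g x))"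
      using diff_upto_bilinear[OF bounded_bilinear_scaleR assms(1), of n "vderiv g"] Suc
        diff_upto_Suc_imp[of n U g] by auto
  qed
qed simp

lemma smooth_on_const [simp]: "smooth_on U (\<lambda>x. c)"
proof -
  have "diff_upto n UNIV (\<lambda>x::real. c)" for n and c :: 'a
    by (induction n arbitrary: c) (auto intro!: diff_upto_SucI[where f' = "\<lambda>x. 0"] simp del: diff_upto.simps(2))
  then have "smooth_on UNIV (\<lambda>x::real. c)" by (simp add: smooth_on_def)
  then show ?thesis by (rule smooth_on_subset) simp
qed

lemma smooth_on_ident [simp]: "smooth_on U (\<lambda>x. x)"
proof -
  have "diff_upto n UNIV (\<lambda>x::real. x)" for n
  proof (cases n)
    case (Suc k)
    have "diff_upto k UNIV (\<lambda>x. 1::real)"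
      using smooth_on_const[of UNIV "1::real"] unfolding smooth_on_def by blast
    then show ?thesis
      unfolding Suc by (intro diff_upto_SucI[where f' = "\<lambda>x. 1"] open_UNIV) auto
  qed simp
  then have "smooth_on UNIV (\<lambda>x::real. x)" by (simp add: smooth_on_def)
  then show ?thesis by (rule smooth_on_subset) simp
qed

context
  fixes U :: "real set" assumes U: "open U"
begin

lemma smooth_on_add: "smooth_on U f \<Longrightarrow> smooth_on U g \<Longrightarrow> smooth_on U (\<lambda>x. f x + g x)"
  unfolding smooth_on_def using diff_upto_add[OF U] by blast

lemma smooth_on_linear: "bounded_linear L \<Longrightarrow> smooth_on U f \<Longrightarrow> smooth_on U (\<lambda>x. L (f x))"
  unfolding smooth_on_def using diff_upto_bounded_linear[OF _ U] by blast

lemma smooth_on_mult: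
  fixes f g :: "real \<Rightarrow> 'a::real_normed_algebra"
  shows "smooth_on U f \<Longrightarrow> smooth_on U g \<Longrightarrow> smooth_on U (\<lambda>x. f x * g x)"
  unfolding smooth_on_def using diff_upto_bilinear[OF bounded_bilinear_mult U] by blast

lemma smooth_on_minus: "smooth_on U f \<Longrightarrow> smooth_on U (\<lambda>x. - f x)"
  using smooth_on_linear[OF bounded_linear_minus[OF bounded_linear_ident]] by auto

lemma smooth_on_diff: "smooth_on U f \<Longrightarrow> smooth_on U g \<Longrightarrow> smooth_on U (\<lambda>x. f x - g x)"
  using smooth_on_add[of f "\<lambda>x. - g x"] smooth_on_minus[of g] by simp

lemma smooth_on_compose:
  "smooth_on V f \<Longrightarrow> smooth_on U g \<Longrightarrow> g ` U \<subseteq> V \<Longrightarrow> smooth_on U (\<lambda>x. f (g x))"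
  unfolding smooth_on_def using diff_upto_compose[OF U] by blast

lemma smooth_on_power2:
  fixes f :: "real \<Rightarrow> real"
  shows "smooth_on U f \<Longrightarrow> smooth_on U (\<lambda>x. (f x)\<^sup>2)"
  unfolding power2_eq_square by (rule smooth_on_mult)

end

lemma smooth_on_inverse: "smooth_on {x::real. x \<noteq> 0} inverse"
proof -
  have op: "open {x::real. x \<noteq> 0}"
    by (simp add: open_Collect_neq continuous_on_id)
  have "diff_upto n {x::real. x \<noteq> 0} inverse" for n
  proof (induction n)
    case (Suc n)
    show ?case
    proof (rule diff_upto_SucI[OF op])
      show "(inverse has_vector_derivative - (inverse x * inverse x)) (at x)" if "x \<in> {x. x \<noteq> 0}" for x :: real
        using that DERIV_inverse[of x UNIV]
        by (simp add: has_real_derivative_iff_has_vector_derivative numeral_2_eq_2)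
      show "diff_upto n {x::real. x \<noteq> 0} (\<lambda>x. - (inverse x * inverse x))"
        by (intro diff_upto_bounded_linear[OF bounded_linear_minus[OF bounded_linear_ident] op]
            diff_upto_bilinear[OF bounded_bilinear_mult op] Suc)
    qed
  qed simp
  then show ?thesis by (simp add: smooth_on_def)
qed

lemma smooth_on_divide:
  fixes f g :: "real \<Rightarrow> real"
  assumes "open U" "smooth_on U f" "smooth_on U g" "\<And>x. x \<in> U \<Longrightarrow> g x \<noteq> 0"
  shows "smooth_on U (\<lambda>x. f x / g x)"
  unfolding divide_inverse
  using assms by (intro smooth_on_mult smooth_on_compose[OF _ smooth_on_inverse]) auto

lemma smooth_on_sqrt: "smooth_on {x::real. 0 < x} sqrt"
proof -
  have op: "open {x::real. 0 < x}"
    by (simp add: open_Collect_less continuous_on_id)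
  have "diff_upto n {x::real. 0 < x} sqrt" for n
  proof (induction n)
    case (Suc n)
    show ?case
    proof (rule diff_upto_SucI[OF op])
      show "(sqrt has_vector_derivative (1/2) *\<^sub>R inverse (sqrt x)) (at x)" if "x \<in> {x. 0 < x}" for x :: real
        using that DERIV_real_sqrt[of x]
        by (simp add: has_real_derivative_iff_has_vector_derivative inverse_eq_divide mult.commute)
      have "diff_upto n {x::real. x \<noteq> 0} inverse"
        using smooth_on_inverse by (simp add: smooth_on_def)
      then show "diff_upto n {x::real. 0 < x} (\<lambda>x. (1/2) *\<^sub>R inverse (sqrt x))"
        by (intro diff_upto_bounded_linear[OF bounded_linear_scaleR_right op]
            diff_upto_compose[OF op _ _ Suc, of "{x. x \<noteq> 0}"]) auto
    qed
  qed simp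
  then show ?thesis by (simp add: smooth_on_def)
qed

lemma smooth_on_cis: "smooth_on UNIV cis"
proof -
  have "diff_upto n UNIV cis" for n
  proof (induction n)
    case (Suc n)
    show ?case
    proof (rule diff_upto_SucI[OF open_UNIV])
      show "(cis has_vector_derivative \<i> * cis x) (at x)" for x :: real
      proof -
        have "exp (y *\<^sub>R \<i>) = cis y" for y
          by (simp add: cis_conv_exp scaleR_conv_of_real mult.commute)
        then show ?thesis
          using exp_scaleR_has_vector_derivative_right[of \<i> x UNIV] by (simp add: mult.commute)
      qed
      show "diff_upto n UNIV (\<lambda>x. \<i> * cis x)"
        by (intro diff_upto_bounded_linear[OF bounded_linear_mult_right] Suc open_UNIV)
    qed
  qed simp
  then show ?thesis by (simp add: smooth_on_def)
qed

lemma smooth_on_polynomial: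
  assumes "real_polynomial_function p"
  shows "smooth_on UNIV p"
  using assms
proof (induction rule: real_polynomial_function.induct)
  case (linear f)
  then show ?case
    using smooth_on_linear[OF open_UNIV linear smooth_on_ident] by simp
qed (auto intro: smooth_on_add smooth_on_mult)

section \<open>A function that is flat at the origin\<close>

text \<open>
  The classical smooth function that vanishes to infinite order at the origin; compactly supported
  smooth functions are built from it.
\<close>

definition flat :: "real \<Rightarrow> real" where
  "flat x = (if 0 < x then exp (- inverse x) else 0)"

text \<open>
  Exponential decay beats every polynomial in \<open>1/y\<close>. All derivatives of \<open>flat\<close> have this shape,
  so the lemma covers their behaviour at the origin at once.
\<close>

lemma flat_family_at_zero:
  fixes P :: "real poly"
  shows "((\<lambda>y. if 0 < y then poly P (inverse y) * exp (- inverse y) else 0) \<longlongrightarrow> 0) (at 0)"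
proof -
  have 1: "((\<lambda>t. poly P t * exp (- t)) \<longlongrightarrow> 0) at_top"
  proof (induction P)
    case (pCons a P)
    have *: "((\<lambda>t::real. t ^ k * exp (- t)) \<longlongrightarrow> 0) at_top" for k
      using tendsto_power_div_exp_0[of k] by (simp add: exp_minus divide_inverse)
    have "((\<lambda>t. coeff (pCons a P) i * (t ^ i * exp (- t))) \<longlongrightarrow> coeff (pCons a P) i * 0) at_top" for i
      by (intro tendsto_mult * tendsto_const)
    then have "((\<lambda>t. \<Sum>i\<le>degree (pCons a P). coeff (pCons a P) i * (t ^ i * exp (- t))) \<longlongrightarrow>
       (\<Sum>i\<le>degree (pCons a P). coeff (pCons a P) i * 0)) at_top"
      by (intro tendsto_sum)
    then show ?case
      by (simp only: poly_altdef sum_distrib_right mult.assoc) simp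
  qed simp
  have "((\<lambda>y. poly P (inverse y) * exp (- inverse y)) \<longlongrightarrow> 0) (at_right 0)"
    using filterlim_compose[OF 1 filterlim_inverse_at_top_right] by simp
  then have r: "((\<lambda>y. if 0 < y then poly P (inverse y) * exp (- inverse y) else 0) \<longlongrightarrow> 0) (at_right 0)"
    by (rule Lim_transform_eventually) (auto simp: eventually_at_filter)
  have l: "((\<lambda>y. if 0 < y then poly P (inverse y) * exp (- inverse y) else 0) \<longlongrightarrow> 0) (at_left 0)"
    by (rule Lim_transform_eventually[OF tendsto_const]) (auto simp: eventually_at_filter)
  show ?thesis
    using r l by (simp add: filterlim_at_split)
qed

lemma smooth_on_flat: "smooth_on UNIV flat"
proof -
  \<comment> \<open>the functions \<open>P (1/y) exp (-1/y)\<close> form a family closed under differentiation\<close>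
  define F where "F P y = (if 0 < y then poly P (inverse y) * exp (- inverse y) else 0)"
    for P :: "real poly" and y :: real
  have deriv: "(F P has_vector_derivative F (monom 1 2 * (P - pderiv P)) x) (at x)" for P x
  proof (cases x "0::real" rule: linorder_cases)
    case less
    have "((\<lambda>x. 0::real) has_vector_derivative 0) (at x)" by simp
    then have "(F P has_vector_derivative 0) (at x)"
      by (rule has_vector_derivative_transform_within_open[of _ _ _ "{..<0}"])
         (use less in \<open>auto simp: F_def\<close>)
    then show ?thesis using less by (simp add: F_def)
  next
    case equal
    have "((\<lambda>y. F (monom 1 1 * P) y) \<longlongrightarrow> 0) (at 0)"
      unfolding F_def by (rule flat_family_at_zero)
    then have "((\<lambda>y. (F P y - F P 0) / (y - 0)) \<longlongrightarrow> 0) (at 0)"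
      by (rule Lim_transform_eventually)
         (auto simp: eventually_at_filter F_def poly_monom divide_inverse)
    then show ?thesis
      using equal by (simp add: has_field_derivative_iff F_def flip: has_real_derivative_iff_has_vector_derivative)
  next
    case greater
    have "((\<lambda>y. poly P (inverse y) * exp (- inverse y)) has_real_derivative
        poly (monom 1 2 * (P - pderiv P)) (inverse x) * exp (- inverse x)) (at x)"
      using greater
      by (auto intro!: derivative_eq_intros DERIV_chain'[OF _ poly_DERIV]
          simp: poly_monom power2_eq_square algebra_simps numeral_2_eq_2)
    then have "(F P has_vector_derivative
        poly (monom 1 2 * (P - pderiv P)) (inverse x) * exp (- inverse x)) (at x)"
      unfolding has_real_derivative_iff_has_vector_derivative
      by (rule has_vector_derivative_transform_within_open[of _ _ _ "{0<..}"])
         (use greater in \<open>auto simp: F_def\<close>)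
    then show ?thesis using greater by (simp add: F_def)
  qed
  have "diff_upto n UNIV (F P)" for n P
  proof (induction n arbitrary: P)
    case (Suc n)
    show ?case
      by (rule diff_upto_SucI[OF open_UNIV deriv Suc])
  qed simp
  then have "smooth_on UNIV (F 1)" by (simp add: smooth_on_def)
  moreover have "F 1 = flat"
    by (auto simp: F_def flat_def)
  ultimately show ?thesis by simp
qed

lemma flat_pos_iff: "0 < flat x \<longleftrightarrow> 0 < x" and flat_nonneg: "0 \<le> flat x" and flat_eq_0_iff: "flat x = 0 \<longleftrightarrow> x \<le> 0"
  by (auto simp: flat_def)

section \<open>Test functions\<close>

lemma test_fun_iff:
  "\<phi> \<in> test_functions I \<longleftrightarrow>
    smooth_on UNIV \<phi> \<and> compact (closure {x. \<phi> x \<noteq> 0}) \<and> closure {x. \<phi> x \<noteq> 0} \<subseteq> I"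
  unfolding test_functions_def smooth_on_iff_funpow by auto

lemma test_functionsI:
  assumes "smooth_on UNIV \<phi>" "compact K" "K \<subseteq> I" "\<And>x. x \<notin> K \<Longrightarrow> \<phi> x = 0"
  shows "\<phi> \<in> test_functions I"
proof -
  have "closure {x. \<phi> x \<noteq> 0} \<subseteq> K"
    using assms by (intro closure_minimal compact_imp_closed) auto
  then show ?thesis
    using assms unfolding test_fun_iff
    by (meson closed_closure compact_closure bounded_subset compact_imp_bounded closure_subset order_trans)
qed

lemma test_fun_smooth: "\<phi> \<in> test_functions I \<Longrightarrow> smooth_on UNIV \<phi>"
  by (simp add: test_fun_iff)

lemma vderiv_eq_0_off_support:
  assumes "closed K" "\<And>y. y \<notin> K \<Longrightarrow> \<phi> y = 0" "x \<notin> K"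
  shows "vderiv \<phi> x = 0"
proof (rule vderiv_eqI)
  have "((\<lambda>x. 0) has_vector_derivative 0) (at x)" by simp
  then show "(\<phi> has_vector_derivative 0) (at x)"
    by (rule has_vector_derivative_transform_within_open[where S = "- K"]) (use assms in auto)
qed

lemma test_fun_support:
  assumes "\<phi> \<in> test_functions I"
  obtains K where "compact K" "K \<subseteq> I" "\<And>x. x \<notin> K \<Longrightarrow> \<phi> x = 0" "\<And>x. x \<notin> K \<Longrightarrow> vderiv \<phi> x = 0"
proof
  let ?K = "closure {x. \<phi> x \<noteq> 0}"
  show "compact ?K" "?K \<subseteq> I" using assms by (auto simp: test_fun_iff)
  show *: "\<phi> x = 0" if "x \<notin> ?K" for x
    using that closure_subset[of "{x. \<phi> x \<noteq> 0}"] by blast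
  show "vderiv \<phi> x = 0" if "x \<notin> ?K" for x
    using vderiv_eq_0_off_support[OF closed_closure * that] .
qed

lemma test_fun_deriv:
  "\<phi> \<in> test_functions I \<Longrightarrow> (\<phi> has_vector_derivative vderiv \<phi> x) (at x)"
  using smooth_on_has_vderiv test_fun_smooth by blast

lemma test_fun_zero_off: "\<phi> \<in> test_functions I \<Longrightarrow> x \<notin> I \<Longrightarrow> \<phi> x = 0"
  by (auto elim: test_fun_support)

lemma test_fun_vderiv:
  assumes "\<phi> \<in> test_functions I" shows "vderiv \<phi> \<in> test_functions I"
proof -
  obtain K where "compact K" "K \<subseteq> I" "\<And>x. x \<notin> K \<Longrightarrow> vderiv \<phi> x = 0"
    using test_fun_support[OF assms] by metis
  then show ?thesis
    by (rule test_functionsI[OF smooth_on_vderiv[OF test_fun_smooth[OF assms]]])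
qed

lemma test_fun_continuous: "\<phi> \<in> test_functions I \<Longrightarrow> continuous_on UNIV \<phi>"
  using smooth_on_continuous test_fun_smooth by blast

lemma test_fun_bounded:
  assumes "\<phi> \<in> test_functions I"
  obtains B where "0 < B" "\<And>x. norm (\<phi> x) \<le> B"
proof -
  obtain K where K: "compact K" "\<And>x. x \<notin> K \<Longrightarrow> \<phi> x = 0"
    using test_fun_support[OF assms] by metis
  have "compact (\<phi> ` K)"
    using K test_fun_continuous[OF assms] by (meson compact_continuous_image continuous_on_subset subset_UNIV)
  then obtain B where "\<And>x. x \<in> K \<Longrightarrow> norm (\<phi> x) \<le> B"
    using compact_imp_bounded[of "\<phi> ` K"] by (auto simp: bounded_iff)
  then have "norm (\<phi> x) \<le> max B 1" for x
    using K(2)[of x] by (cases "x \<in> K") (auto simp: le_max_iff_disj)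
  then show ?thesis
    by (intro that[of "max B 1"]) auto
qed

lemma test_fun_zero: "(\<lambda>x. 0) \<in> test_functions I"
  by (rule test_functionsI[of _ "{}"]) auto

lemma test_fun_linear:
  assumes "bounded_linear L" "\<phi> \<in> test_functions I"
  shows "(\<lambda>x. L (\<phi> x)) \<in> test_functions I"
proof -
  obtain K where "compact K" "K \<subseteq> I" "\<And>x. x \<notin> K \<Longrightarrow> \<phi> x = 0"
    using test_fun_support[OF assms(2)] by metis
  moreover have "L 0 = 0"
    using assms(1) by (simp add: bounded_linear.linear linear_0)
  ultimately show ?thesis
    using smooth_on_linear[OF open_UNIV assms(1) test_fun_smooth[OF assms(2)]]
    by (intro test_functionsI[of _ K]) auto
qed

lemma test_fun_add:
  assumes "\<phi> \<in> test_functions I" "\<psi> \<in> test_functions I"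
  shows "(\<lambda>x. \<phi> x + \<psi> x) \<in> test_functions I"
proof -
  obtain K L where K: "compact K" "K \<subseteq> I" "\<And>x. x \<notin> K \<Longrightarrow> \<phi> x = 0"
      and L: "compact L" "L \<subseteq> I" "\<And>x. x \<notin> L \<Longrightarrow> \<psi> x = 0"
    using test_fun_support[OF assms(1)] test_fun_support[OF assms(2)] by metis
  show ?thesis
    by (rule test_functionsI[of _ "K \<union> L"])
       (use K L smooth_on_add[OF open_UNIV assms[THEN test_fun_smooth]] in auto)
qed

lemma test_fun_mult:
  fixes f \<phi> :: "real \<Rightarrow> 'a::real_normed_algebra"
  assumes "smooth_on UNIV f" "\<phi> \<in> test_functions I"
  shows "(\<lambda>x. f x * \<phi> x) \<in> test_functions I" "(\<lambda>x. \<phi> x * f x) \<in> test_functions I"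
proof -
  obtain K where "compact K" "K \<subseteq> I" "\<And>x. x \<notin> K \<Longrightarrow> \<phi> x = 0"
    using test_fun_support[OF assms(2)] by metis
  then show "(\<lambda>x. f x * \<phi> x) \<in> test_functions I" "(\<lambda>x. \<phi> x * f x) \<in> test_functions I"
    using smooth_on_mult[OF open_UNIV assms(1) test_fun_smooth[OF assms(2)]]
      smooth_on_mult[OF open_UNIV test_fun_smooth[OF assms(2)] assms(1)]
    by (auto intro!: test_functionsI[of _ K])
qed

lemma test_fun_cmult:
  fixes \<phi> :: "real \<Rightarrow> 'a::real_normed_algebra"
  shows "\<phi> \<in> test_functions I \<Longrightarrow> (\<lambda>x. c * \<phi> x) \<in> test_functions I"
  using test_fun_mult[of "\<lambda>x. c"] by auto

lemma test_fun_diff: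
  fixes \<phi> :: "real \<Rightarrow> 'a::real_normed_vector"
  assumes "\<phi> \<in> test_functions I" "\<psi> \<in> test_functions I"
  shows "(\<lambda>x. \<phi> x - \<psi> x) \<in> test_functions I"
  using test_fun_add[OF assms(1) test_fun_linear[OF bounded_linear_minus[OF bounded_linear_ident] assms(2)]]
  by simp

lemma test_fun_power2:
  fixes \<phi> :: "real \<Rightarrow> real"
  shows "\<phi> \<in> test_functions I \<Longrightarrow> (\<lambda>x. (\<phi> x)\<^sup>2) \<in> test_functions I"
  unfolding power2_eq_square by (simp add: test_fun_mult test_fun_smooth)

lemma test_fun_of_real:
  "\<phi> \<in> test_functions I \<Longrightarrow> (\<lambda>x. complex_of_real (\<phi> x)) \<in> test_functions I"
  by (rule test_fun_linear[OF bounded_linear_of_real])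

lemma test_fun_cnj: "\<phi> \<in> test_functions I \<Longrightarrow> (\<lambda>x. cnj (\<phi> x)) \<in> test_functions I"
  by (rule test_fun_linear[OF bounded_linear_cnj])

lemma test_fun_mult':
  fixes f g :: "real \<Rightarrow> 'a::real_normed_algebra"
  shows "f \<in> test_functions I \<Longrightarrow> g \<in> test_functions I \<Longrightarrow> (\<lambda>x. f x * g x) \<in> test_functions I"
  by (simp add: test_fun_mult test_fun_smooth)

text \<open>
  Since \<open>I\<close> is an interval, \<open>K\<close> may be replaced by its hull \<open>[\<alpha>, \<beta>]\<close>. The quotient \<open>A / (A + B)\<close> is
  a cutoff as soon as \<open>A\<close> lives in a slightly larger interval, \<open>B\<close> lives off \<open>[\<alpha>, \<beta>]\<close>, and
  the two never vanish together. The vanishing of the derivative on \<open>K\<close> removes the cross terms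
  whenever a function supported in \<open>K\<close> is perturbed by a multiple of the cutoff.
\<close>

lemma cutoff_function:
  assumes "open I" "is_interval I" "compact K" "K \<subseteq> I"
  obtains \<kappa> :: "real \<Rightarrow> real" where "\<kappa> \<in> test_functions I" "\<And>x. 0 \<le> \<kappa> x" "\<And>x. \<kappa> x \<le> 1"
    "\<And>x. x \<in> K \<Longrightarrow> \<kappa> x = 1" "\<And>x. x \<in> K \<Longrightarrow> vderiv \<kappa> x = 0"
proof (cases "K = {}")
  case True
  then show ?thesis using that[of "\<lambda>x. 0"] test_fun_zero by auto
next
  case False
  obtain \<alpha> where \<alpha>: "\<alpha> \<in> K" "\<forall>x\<in>K. \<alpha> \<le> x"
    using compact_attains_inf[OF assms(3) False] by blast
  obtain \<beta> where \<beta>: "\<beta> \<in> K" "\<forall>x\<in>K. x \<le> \<beta>"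
    using compact_attains_sup[OF assms(3) False] by blast
  have ab: "\<alpha> \<in> K" "\<beta> \<in> K" "K \<subseteq> {\<alpha>..\<beta>}"
    using \<alpha> \<beta> by auto
  have nbhd: "\<exists>e>0. \<forall>y. \<bar>y - x\<bar> \<le> e \<longrightarrow> y \<in> I" if xI: "x \<in> I" for x
  proof -
    obtain e where "0 < e" "cball x e \<subseteq> I"
      using iffD1[OF open_contains_cball assms(1)] xI by auto
    moreover have "y \<in> cball x e" if "\<bar>y - x\<bar> \<le> e" for y
      using that by (simp add: dist_real_def)
    ultimately show ?thesis by blast
  qed
  obtain e1 e2 where e: "0 < e1" "\<And>y. \<bar>y - \<alpha>\<bar> \<le> e1 \<Longrightarrow> y \<in> I" "0 < e2" "\<And>y. \<bar>y - \<beta>\<bar> \<le> e2 \<Longrightarrow> y \<in> I"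
    using nbhd[of \<alpha>] nbhd[of \<beta>] ab assms(4) by blast
  define \<alpha>' \<beta>' where "\<alpha>' = \<alpha> - e1" and "\<beta>' = \<beta> + e2"
  have "\<alpha>' \<in> I" "\<beta>' \<in> I" using e by (auto simp: \<alpha>'_def \<beta>'_def)
  then have sub: "{\<alpha>'..\<beta>'} \<subseteq> I"
    by (auto intro: mem_is_interval_1_I[OF assms(2), of \<alpha>' \<beta>'])
  define A where "A x = flat (x - \<alpha>') * flat (\<beta>' - x)" for x
  define B where "B x = flat (\<alpha> - x) + flat (x - \<beta>)" for x
  define \<kappa> where "\<kappa> x = A x / (A x + B x)" for x
  have A0: "0 \<le> A x" and B0: "0 \<le> B x" for x by (simp_all add: A_def B_def flat_nonneg)
  have pos: "0 < A x + B x" for x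
  proof (cases "x \<in> {\<alpha>'<..<\<beta>'}")
    case True
    then have "0 < A x" by (simp add: A_def flat_pos_iff)
    then show ?thesis using B0[of x] by simp
  next
    case False
    then have "x < \<alpha> \<or> \<beta> < x" using e by (auto simp: \<alpha>'_def \<beta>'_def)
    then have "0 < flat (\<alpha> - x) \<or> 0 < flat (x - \<beta>)" by (simp add: flat_pos_iff)
    then have "0 < B x" using flat_nonneg[of "\<alpha> - x"] flat_nonneg[of "x - \<beta>"] by (auto simp: B_def)
    then show ?thesis using A0[of x] by simp
  qed
  have "smooth_on UNIV (\<lambda>x. flat (x - c))" "smooth_on UNIV (\<lambda>x. flat (c - x))" for c
    by (rule smooth_on_compose[OF open_UNIV smooth_on_flat]; auto intro!: smooth_on_diff)+
  then have sm: "smooth_on UNIV A" "smooth_on UNIV B"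
    unfolding A_def[abs_def] B_def[abs_def] by (auto intro!: smooth_on_mult smooth_on_add)
  have "smooth_on UNIV \<kappa>"
    unfolding \<kappa>_def[abs_def]
    using sm pos by (intro smooth_on_divide smooth_on_add open_UNIV) (auto dest: less_imp_neq[symmetric])
  moreover have "\<kappa> x = 0" if "x \<notin> {\<alpha>'..\<beta>'}" for x
    using that by (auto simp: \<kappa>_def A_def flat_eq_0_iff)
  ultimately have test: "\<kappa> \<in> test_functions I"
    using sub by (intro test_functionsI[of _ "{\<alpha>'..\<beta>'}"]) auto
  have one: "\<kappa> x = 1" if "x \<in> K" for x
  proof -
    have "\<alpha> \<le> x" "x \<le> \<beta>" using that ab(3) by auto
    then have "B x = 0" by (simp add: B_def flat_eq_0_iff[THEN iffD2])
    then show ?thesis using pos[of x] by (simp add: \<kappa>_def)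
  qed
  have le: "\<kappa> x \<le> 1" for x
    using pos[of x] B0[of x] by (simp add: \<kappa>_def)
  \<comment> \<open>every point of \<open>K\<close> is a maximum of \<open>\<kappa>\<close>\<close>
  have "vderiv \<kappa> x = 0" if "x \<in> K" for x
  proof -
    have "(\<kappa> has_real_derivative vderiv \<kappa> x) (at x)"
      using test_fun_deriv[OF test] by (simp add: has_real_derivative_iff_has_vector_derivative)
    then show ?thesis
      by (rule DERIV_local_max[of _ _ _ 1]) (use one[OF that] le in auto)
  qed
  moreover have "0 \<le> \<kappa> x" for x
    using A0[of x] pos[of x] by (simp add: \<kappa>_def)
  ultimately show ?thesis
    using that test one le by blast
qed

text \<open>
  A square root is smooth where its argument is positive; elsewhere it has to be given by a
  formula of its own. This is how both moduli of complex functions and the substitution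
  \<open>h = sqrt (\<psi> + \<delta> \<kappa>\<^sup>2)\<close> are turned into test functions.
\<close>

lemma smooth_on_sqrt_glue:
  fixes g r :: "real \<Rightarrow> real"
  assumes "smooth_on UNIV g" "smooth_on UNIV r" "closed S"
    and "\<And>x. x \<in> S \<Longrightarrow> 0 < g x" "\<And>x. x \<notin> S \<Longrightarrow> sqrt (g x) = r x"
  shows "smooth_on UNIV (\<lambda>x. sqrt (g x))"
proof -
  have op: "open {x. 0 < g x}"
    by (intro open_Collect_less continuous_on_const smooth_on_continuous assms)
  have "smooth_on {x. 0 < g x} (\<lambda>x. sqrt (g x))"
    by (rule smooth_on_compose[OF op smooth_on_sqrt smooth_on_subset[OF assms(1)]]) auto
  moreover have "smooth_on (- S) (\<lambda>x. sqrt (g x))"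
    using assms(3,5) by (intro smooth_on_cong[OF _ _ smooth_on_subset[OF assms(2)], of "- S"]) auto
  ultimately have "smooth_on ({x. 0 < g x} \<union> - S) (\<lambda>x. sqrt (g x))"
    by (rule smooth_on_Un)
  moreover have "{x. 0 < g x} \<union> - S = UNIV"
    using assms by auto
  ultimately show ?thesis by simp
qed

section \<open>Locally integrable functions and distributions\<close>

lemma set_integral_eq_integral:
  assumes "\<And>x. x \<notin> I \<Longrightarrow> f x = (0::real)"
  shows "(LINT x:I|lebesgue. f x) = (LINT x|lebesgue. f x)"
  unfolding set_lebesgue_integral_def
  by (rule Bochner_Integration.integral_cong) (use assms in \<open>auto simp: indicator_def\<close>)

lemma continuous_borel_lebesgue:
  fixes f :: "real \<Rightarrow> 'a::{real_normed_vector}"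
  shows "continuous_on UNIV f \<Longrightarrow> f \<in> borel_measurable lebesgue"
  by (simp add: borel_measurable_continuous_onI measurable_completion)

lemma L1_loc_integrable_mult:
  fixes f g :: "real \<Rightarrow> real"
  assumes f: "f \<in> L1_loc I" and K: "compact K" "K \<subseteq> I"
    and g: "g \<in> borel_measurable lebesgue" "\<And>x. \<bar>g x\<bar> \<le> B" "\<And>x. x \<notin> K \<Longrightarrow> g x = 0"
  shows "integrable lebesgue (\<lambda>x. f x * g x)"
proof -
  have i: "integrable lebesgue (\<lambda>x. indicator K x * f x)"
    using f K by (simp add: L1_loc_def set_integrable_def)
  have eq: "f x * g x = (indicator K x * f x) * g x" for x
    using g(3) by (auto simp: indicator_def)
  have "integrable lebesgue (\<lambda>x. (indicator K x * f x) * g x)"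
  proof (rule Bochner_Integration.integrable_bound)
    show "integrable lebesgue (\<lambda>x. B * (indicator K x * f x))"
      using i by simp
    show "(\<lambda>x. indicator K x * f x * g x) \<in> borel_measurable lebesgue"
      by (rule borel_measurable_times[OF borel_measurable_integrable[OF i] g(1)])
    show "AE x in lebesgue. norm (indicator K x * f x * g x) \<le> norm (B * (indicator K x * f x))"
    proof (rule AE_I2)
      fix x
      have "\<bar>g x\<bar> \<le> \<bar>B\<bar>" using g(2)[of x] by linarith
      then show "norm (indicator K x * f x * g x) \<le> norm (B * (indicator K x * f x))"
        by (simp add: abs_mult mult.commute) (intro mult_right_mono; simp)
    qed
  qed
  then show ?thesis by (simp add: eq)
qed

lemma L1_loc_integrable_test:
  assumes "f \<in> L1_loc I" "\<phi> \<in> test_functions I"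
  shows "integrable lebesgue (\<lambda>x. f x * \<phi> x)"
proof -
  obtain K where "compact K" "K \<subseteq> I" "\<And>x. x \<notin> K \<Longrightarrow> \<phi> x = 0"
    using test_fun_support[OF assms(2)] by metis
  moreover obtain B where "\<And>x. norm (\<phi> x) \<le> B"
    using test_fun_bounded[OF assms(2)] by metis
  ultimately show ?thesis
    using assms(2)
    by (intro L1_loc_integrable_mult[OF assms(1), of K \<phi> B] continuous_borel_lebesgue test_fun_continuous[of \<phi> I]) auto
qed

text \<open>
  Local integrability gives measurability on each compact subset only; an exhaustion of \<open>I\<close>
  gives it on \<open>I\<close>, and the extension by zero is then measurable on the line.
\<close>

lemma L1_loc_measurable:
  assumes "open I" "f \<in> L1_loc I"
  shows "(\<lambda>x. indicator I x * f x) \<in> borel_measurable lebesgue"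
proof -
  obtain C :: "nat \<Rightarrow> real set" where C: "\<And>n. compact (C n)" "\<And>n. C n \<subseteq> I" "\<Union>(range C) = I"
      "\<And>K. compact K \<Longrightarrow> K \<subseteq> I \<Longrightarrow> \<exists>N. \<forall>n\<ge>N. K \<subseteq> C n"
    using open_Union_compact_subsets[OF assms(1)] by metis
  show ?thesis
  proof (rule borel_measurable_LIMSEQ_real)
    show "(\<lambda>x. indicator (C n) x * f x) \<in> borel_measurable lebesgue" for n
    proof -
      have "integrable lebesgue (\<lambda>x. indicator (C n) x * f x)"
        using assms(2) C(1,2)[of n] by (simp add: L1_loc_def set_integrable_def)
      then show ?thesis by (rule borel_measurable_integrable)
    qed
    show "(\<lambda>n. indicator (C n) x * f x) \<longlonglongrightarrow> indicator I x * f x" for x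
    proof (cases "x \<in> I")
      case True
      then obtain N where "\<forall>n\<ge>N. {x} \<subseteq> C n" using C(4)[of "{x}"] by auto
      then have "eventually (\<lambda>n. indicator (C n) x * f x = indicator I x * f x) sequentially"
        using True by (auto simp: eventually_sequentially indicator_def intro!: exI[of _ N])
      then show ?thesis by (rule tendsto_eventually)
    next
      case False
      then have "x \<notin> C n" for n using C(2) by blast
      then show ?thesis using False by simp
    qed
  qed
qed

lemma AE_exhaustI:
  fixes I :: "real set"
  assumes "open I" "\<And>K. compact K \<Longrightarrow> K \<subseteq> I \<Longrightarrow> AE x\<in>K in lebesgue. P x"
  shows "AE x\<in>I in lebesgue. P x"
proof -
  obtain C :: "nat \<Rightarrow> real set" where C: "\<And>n. compact (C n)" "\<And>n. C n \<subseteq> I" "\<Union>(range C) = I"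
    using open_Union_compact_subsets[OF assms(1)] by metis
  have "AE x in lebesgue. \<forall>n. x \<in> C n \<longrightarrow> P x"
    unfolding AE_all_countable using assms(2) C by blast
  then show ?thesis
    by (rule eventually_mono) (use C(3) in blast)
qed

lemma distributions_add:
  "T \<in> distributions I \<Longrightarrow> \<phi> \<in> test_functions I \<Longrightarrow> \<psi> \<in> test_functions I \<Longrightarrow>
    T (\<lambda>x. \<phi> x + \<psi> x) = T \<phi> + T \<psi>"
  and distributions_cmult:
  "T \<in> distributions I \<Longrightarrow> \<phi> \<in> test_functions I \<Longrightarrow> T (\<lambda>x. z * \<phi> x) = z * T \<phi>"
  unfolding distributions_def by auto

text \<open>
  The distribution \<open>Re c - (Re b)' / 2\<close>: integrating by parts against \<open>|u|\<^sup>2\<close> turns the real part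
  of the first-order term into a potential.
\<close>

definition zeroth_order :: "((real \<Rightarrow> complex) \<Rightarrow> complex) \<Rightarrow> ((real \<Rightarrow> complex) \<Rightarrow> complex) \<Rightarrow> (real \<Rightarrow> real) \<Rightarrow> real"
  where "zeroth_order b c \<phi> = dist_Re c \<phi> - 1/2 * dist_deriv (dist_Re b) \<phi>"

lemma dist_Re_add:
  "T \<in> distributions I \<Longrightarrow> \<phi> \<in> test_functions I \<Longrightarrow> \<psi> \<in> test_functions I \<Longrightarrow>
    dist_Re T (\<lambda>x. \<phi> x + \<psi> x) = dist_Re T \<phi> + dist_Re T \<psi>"
  unfolding dist_Re_def using distributions_add[of T I "\<lambda>x. complex_of_real (\<phi> x)" "\<lambda>x. complex_of_real (\<psi> x)"]
  by (simp add: test_fun_of_real)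

lemma dist_Re_cmult:
  "T \<in> distributions I \<Longrightarrow> \<phi> \<in> test_functions I \<Longrightarrow>
    dist_Re T (\<lambda>x. r * \<phi> x) = r * dist_Re T \<phi>"
  unfolding dist_Re_def using distributions_cmult[of T I "\<lambda>x. complex_of_real (\<phi> x)" "complex_of_real r"]
  by (simp add: test_fun_of_real)

lemma vderiv_add:
  assumes "\<phi> \<in> test_functions I" "\<psi> \<in> test_functions I"
  shows "vderiv (\<lambda>x. \<phi> x + \<psi> x) = (\<lambda>x. vderiv \<phi> x + vderiv \<psi> x)"
  using test_fun_deriv[OF assms(1)] test_fun_deriv[OF assms(2)]
  by (intro ext vderiv_eqI) (rule has_vector_derivative_add)

lemma vderiv_cmult:
  fixes \<phi> :: "real \<Rightarrow> 'a::real_normed_algebra"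
  assumes "\<phi> \<in> test_functions I"
  shows "vderiv (\<lambda>x. r * \<phi> x) = (\<lambda>x. r * vderiv \<phi> x)"
  using test_fun_deriv[OF assms]
  by (intro ext vderiv_eqI) (rule has_vector_derivative_mult_right)

lemma zeroth_order_add:
  assumes "b \<in> distributions I" "c \<in> distributions I" "\<phi> \<in> test_functions I" "\<psi> \<in> test_functions I"
  shows "zeroth_order b c (\<lambda>x. \<phi> x + \<psi> x) = zeroth_order b c \<phi> + zeroth_order b c \<psi>"
  unfolding zeroth_order_def dist_deriv_def
  using assms by (simp add: vderiv_add[OF assms(3,4)] dist_Re_add test_fun_vderiv field_simps)

lemma zeroth_order_cmult:
  assumes "b \<in> distributions I" "c \<in> distributions I" "\<phi> \<in> test_functions I"
  shows "zeroth_order b c (\<lambda>x. r * \<phi> x) = r * zeroth_order b c \<phi>"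
  unfolding zeroth_order_def dist_deriv_def
  using assms by (simp add: vderiv_cmult[OF assms(3)] dist_Re_cmult test_fun_vderiv field_simps)

section \<open>The real part of the form\<close>

lemma test_fun_Re: "u \<in> test_functions I \<Longrightarrow> (\<lambda>x. Re (u x)) \<in> test_functions I"
  and test_fun_Im: "u \<in> test_functions I \<Longrightarrow> (\<lambda>x. Im (u x)) \<in> test_functions I"
  by (auto intro: test_fun_linear bounded_linear_Re bounded_linear_Im)

lemma cmod_sq_eq: "(cmod z)\<^sup>2 = Re (z * cnj z)"
  by (simp add: cmod_power2) (simp add: power2_eq_square)

lemma test_fun_cmod_sq: "u \<in> test_functions I \<Longrightarrow> (\<lambda>x. (cmod (u x))\<^sup>2) \<in> test_functions I"
  unfolding cmod_sq_eq by (intro test_fun_Re test_fun_mult' test_fun_cnj)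

lemma vderiv_cmod_sq:
  assumes "u \<in> test_functions I"
  shows "vderiv (\<lambda>x. (cmod (u x))\<^sup>2) x = 2 * Re (vderiv u x * cnj (u x))"
proof (rule vderiv_eqI)
  have "((\<lambda>x. cnj (u x)) has_vector_derivative cnj (vderiv u x)) (at x)"
    by (rule bounded_linear.has_vector_derivative[OF bounded_linear_cnj test_fun_deriv[OF assms]])
  from bounded_linear.has_vector_derivative[OF bounded_linear_Re
      has_vector_derivative_mult[OF test_fun_deriv[OF assms, of x] this]]
  show "((\<lambda>x. (cmod (u x))\<^sup>2) has_vector_derivative 2 * Re (vderiv u x * cnj (u x))) (at x)"
    by (simp add: cmod_sq_eq mult.commute)
qed

lemma vderiv_power2:
  fixes h :: "real \<Rightarrow> real"
  assumes "h \<in> test_functions I"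
  shows "vderiv (\<lambda>x. (h x)\<^sup>2) x = 2 * h x * vderiv h x"
proof (rule vderiv_eqI)
  from has_vector_derivative_mult[OF test_fun_deriv[OF assms] test_fun_deriv[OF assms], of x]
  show "((\<lambda>x. (h x)\<^sup>2) has_vector_derivative 2 * h x * vderiv h x) (at x)"
    by (simp add: power2_eq_square algebra_simps)
qed

lemma distributions_sesquilinear:
  assumes T: "T \<in> distributions I"
    and t: "A \<in> test_functions I" "B \<in> test_functions I" "C \<in> test_functions I" "D \<in> test_functions I"
  shows "T (\<lambda>x. (A x + w * B x) * cnj (C x + w * D x)) =
    T (\<lambda>x. A x * cnj (C x)) + w * T (\<lambda>x. B x * cnj (C x)) +
    (cnj w * T (\<lambda>x. A x * cnj (D x)) + (w * cnj w) * T (\<lambda>x. B x * cnj (D x)))"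
proof -
  have m: "(\<lambda>x. f x * cnj (g x)) \<in> test_functions I" if "f \<in> test_functions I" "g \<in> test_functions I" for f g
    by (intro test_fun_mult' test_fun_cnj that)
  have "(\<lambda>x. (A x + w * B x) * cnj (C x + w * D x)) =
     (\<lambda>x. (A x * cnj (C x) + w * (B x * cnj (C x))) + (cnj w * (A x * cnj (D x)) + (w * cnj w) * (B x * cnj (D x))))"
    by (simp add: algebra_simps)
  then show ?thesis
    using t by (simp only: distributions_add[OF T] distributions_cmult[OF T] m
        test_fun_add test_fun_cmult)
qed

locale divergence_form =
  fixes I :: "real set"
    and a b c :: "(real \<Rightarrow> complex) \<Rightarrow> complex"
    and p q :: "real \<Rightarrow> real"
  assumes open_I: "open I" and interval_I: "is_interval I"
    and a: "a \<in> distributions I" and b: "b \<in> distributions I" and c: "c \<in> distributions I"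
    and p: "p \<in> L1_loc I" and a_eq: "dist_eq I (dist_Re a) (dist_of_fun I p)"
    and q: "q \<in> L1_loc I" and b_eq: "dist_eq I (dist_Im b) (dist_of_fun I q)"
begin

abbreviation "\<sigma> \<equiv> zeroth_order b c"

lemmas sigma_add = zeroth_order_add[OF b c]
lemmas sigma_cmult = zeroth_order_cmult[OF b c]

lemma dist_of_fun_eq: "\<phi> \<in> test_functions I \<Longrightarrow> dist_of_fun I f \<phi> = (LINT x|lebesgue. f x * \<phi> x)"
  unfolding dist_of_fun_def by (rule set_integral_eq_integral) (simp add: test_fun_zero_off)

text \<open>
  \<open>u' cnj u\<close> has real part \<open>(|u|\<^sup>2)' / 2\<close>, so \<open>Re b\<close> acts as a potential, and only \<open>Im b\<close> sees the
  rotation \<open>Im (u' cnj u)\<close> of the phase.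
\<close>

lemma Re_neg_form:
  assumes u: "u \<in> test_functions I"
  shows "Re (- L_form a b c u u) =
    (LINT x|lebesgue. p x * (cmod (vderiv u x))\<^sup>2) + (LINT x|lebesgue. q x * Im (vderiv u x * cnj (u x)))
    - \<sigma> (\<lambda>x. (cmod (u x))\<^sup>2)"
proof -
  define w where "w x = vderiv u x * cnj (u x)" for x
  have du: "vderiv u \<in> test_functions I" by (rule test_fun_vderiv[OF u])
  have w: "w \<in> test_functions I"
    unfolding w_def[abs_def] by (intro test_fun_mult' test_fun_cnj u du)
  have "Re (a (\<lambda>x. vderiv u x * cnj (vderiv u x))) = dist_Re a (\<lambda>x. (cmod (vderiv u x))\<^sup>2)"
    by (simp add: dist_Re_def complex_norm_square[symmetric])
  also have "\<dots> = (LINT x|lebesgue. p x * (cmod (vderiv u x))\<^sup>2)"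
    using a_eq test_fun_cmod_sq[OF du] by (simp add: dist_eq_def dist_of_fun_eq)
  finally have A: "Re (a (\<lambda>x. vderiv u x * cnj (vderiv u x))) = (LINT x|lebesgue. p x * (cmod (vderiv u x))\<^sup>2)" .
  have "b w = b (\<lambda>x. complex_of_real (Re (w x)) + \<i> * complex_of_real (Im (w x)))"
    by (simp add: complex_eq[symmetric])
  also have "\<dots> = b (\<lambda>x. complex_of_real (Re (w x))) + \<i> * b (\<lambda>x. complex_of_real (Im (w x)))"
    using w by (simp add: distributions_add[OF b] distributions_cmult[OF b] test_fun_of_real
      test_fun_Re test_fun_Im test_fun_cmult)
  finally have "Re (b w) = dist_Re b (\<lambda>x. Re (w x)) - dist_Im b (\<lambda>x. Im (w x))"
    by (simp add: dist_Re_def dist_Im_def)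
  moreover have "dist_Im b (\<lambda>x. Im (w x)) = (LINT x|lebesgue. q x * Im (w x))"
    using b_eq test_fun_Im[OF w] by (simp add: dist_eq_def dist_of_fun_eq)
  moreover have "dist_deriv (dist_Re b) (\<lambda>x. (cmod (u x))\<^sup>2) = - 2 * dist_Re b (\<lambda>x. Re (w x))"
    using dist_Re_cmult[OF b test_fun_Re[OF w], of 2]
    by (simp add: dist_deriv_def vderiv_cmod_sq[OF u, abs_def] w_def)
  moreover have "Re (c (\<lambda>x. u x * cnj (u x))) = dist_Re c (\<lambda>x. (cmod (u x))\<^sup>2)"
    by (simp add: dist_Re_def complex_norm_square[symmetric])
  ultimately show ?thesis
    using A by (simp add: L_form_def zeroth_order_def w_def[abs_def])
qed

lemma L_form_perturb:
  assumes u: "u \<in> test_functions I" and v: "v \<in> test_functions I"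
  shows "L_form a b c (\<lambda>x. u x + w * v x) (\<lambda>x. u x + w * v x) =
    L_form a b c u u + w * L_form a b c v u + cnj w * L_form a b c u v + (w * cnj w) * L_form a b c v v"
proof -
  have d: "vderiv (\<lambda>x. u x + w * v x) = (\<lambda>x. vderiv u x + w * vderiv v x)"
    using vderiv_add[OF u test_fun_cmult[OF v]] vderiv_cmult[OF v] by simp
  show ?thesis
    unfolding L_form_def d
    by (simp only: distributions_sesquilinear[OF a] distributions_sesquilinear[OF b]
        distributions_sesquilinear[OF c] u v test_fun_vderiv)
       (simp add: algebra_simps)
qed

text \<open>
  The quadratic form on real functions that remains after the phase of \<open>u\<close> has been chosen in the
  least favourable way.
\<close>

definition reduced_form :: "(real \<Rightarrow> real) \<Rightarrow> real" where
  "reduced_form h = (LINT x|lebesgue. p x * (vderiv h x)\<^sup>2) - \<sigma> (\<lambda>x. (h x)\<^sup>2)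
    - (LINT x|lebesgue. (q x)\<^sup>2 / (4 * p x) * (h x)\<^sup>2)"

lemma integrable_potential:
  assumes "sq_quotient_L1_loc I f p" "\<phi> \<in> test_functions I"
  shows "integrable lebesgue (\<lambda>x. (f x)\<^sup>2 / p x * \<phi> x)"
    "integrable lebesgue (\<lambda>x. (f x)\<^sup>2 / (4 * p x) * \<phi> x)"
proof -
  show "integrable lebesgue (\<lambda>x. (f x)\<^sup>2 / p x * \<phi> x)"
    using assms by (intro L1_loc_integrable_test) (auto simp: sq_quotient_L1_loc_def)
  from integrable_mult_right[OF this, of "1/4"]
  show "integrable lebesgue (\<lambda>x. (f x)\<^sup>2 / (4 * p x) * \<phi> x)"
    by simp
qed

section \<open>From the reduced form to accretivity\<close>

text \<open>
  Take \<open>h = |u|\<close>. Where \<open>p > 0\<close> and \<open>u\<close> does not vanish, \<open>p |u'|\<^sup>2 + q Im (u' cnj u)\<close> exceeds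
  \<open>p h'\<^sup>2 - q\<^sup>2 h\<^sup>2 / (4 p)\<close> by the perfect square \<open>(p Im (u' cnj u) / h + q h / 2)\<^sup>2 / p\<close>.
\<close>

lemma Re_neg_form_nonneg_if_modulus_smooth:
  assumes pos: "AE x\<in>I in lebesgue. 0 \<le> p x" and qp: "sq_quotient_L1_loc I q p"
    and red: "\<And>h. h \<in> test_functions I \<Longrightarrow> 0 \<le> reduced_form h"
    and u: "u \<in> test_functions I" and mod: "(\<lambda>x. cmod (u x)) \<in> test_functions I"
  shows "0 \<le> Re (- L_form a b c u u)"
proof -
  define h where "h = (\<lambda>x. cmod (u x))"
  have h: "h \<in> test_functions I" using mod by (simp add: h_def)
  have du: "vderiv u \<in> test_functions I" by (rule test_fun_vderiv[OF u])
  define w where "w x = vderiv u x * cnj (u x)" for x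
  have w: "w \<in> test_functions I"
    unfolding w_def[abs_def] by (intro test_fun_mult' test_fun_cnj u du)
  have hh': "h x * vderiv h x = Re (w x)" for x
    using vderiv_power2[OF h, of x] vderiv_cmod_sq[OF u, of x] by (simp add: h_def w_def)
  \<comment> \<open>a zero of the modulus is a minimum\<close>
  have h'0: "vderiv h x = 0" if "h x = 0" for x
  proof -
    have "(h has_real_derivative vderiv h x) (at x)"
      using test_fun_deriv[OF h] by (simp add: has_real_derivative_iff_has_vector_derivative)
    then show ?thesis
      by (rule DERIV_local_min[of _ _ _ 1]) (use that in \<open>auto simp: h_def\<close>)
  qed
  have point: "p x * (vderiv h x)\<^sup>2 - (q x)\<^sup>2 / (4 * p x) * (h x)\<^sup>2 \<le> p x * (cmod (vderiv u x))\<^sup>2 + q x * Im (w x)"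
    if px: "0 \<le> p x" "p x = 0 \<longrightarrow> q x = 0" for x
  proof (cases "p x = 0 \<or> h x = 0")
    case True
    then show ?thesis using px h'0[of x] by (auto simp: w_def h_def)
  next
    case False
    then have P: "0 < p x" and H: "0 < h x" using px by (auto simp: h_def)
    have "(cmod (w x))\<^sup>2 = (cmod (vderiv u x))\<^sup>2 * (h x)\<^sup>2"
      by (simp add: w_def h_def norm_mult power_mult_distrib)
    then have 1: "(cmod (vderiv u x))\<^sup>2 = ((Re (w x))\<^sup>2 + (Im (w x))\<^sup>2) / (h x)\<^sup>2"
      using H by (simp add: cmod_power2 field_simps)
    have 2: "(vderiv h x)\<^sup>2 = (Re (w x))\<^sup>2 / (h x)\<^sup>2"
      using H by (simp add: hh'[symmetric] power_mult_distrib)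
    have "p x * (cmod (vderiv u x))\<^sup>2 + q x * Im (w x) - (p x * (vderiv h x)\<^sup>2 - (q x)\<^sup>2 / (4 * p x) * (h x)\<^sup>2)
       = (p x * Im (w x) / h x + q x * h x / 2)\<^sup>2 / p x"
      unfolding 1 2 using P H by (simp add: field_simps power2_eq_square)
    also have "\<dots> \<ge> 0" using P by simp
    finally show ?thesis by simp
  qed
  have i1: "integrable lebesgue (\<lambda>x. p x * (vderiv h x)\<^sup>2)"
    by (intro L1_loc_integrable_test[OF p] test_fun_power2 test_fun_vderiv h)
  have i2: "integrable lebesgue (\<lambda>x. (q x)\<^sup>2 / (4 * p x) * (h x)\<^sup>2)"
    by (intro integrable_potential[OF qp] test_fun_power2 h)
  have i3: "integrable lebesgue (\<lambda>x. p x * (cmod (vderiv u x))\<^sup>2)"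
    by (intro L1_loc_integrable_test[OF p] test_fun_cmod_sq du)
  have i4: "integrable lebesgue (\<lambda>x. q x * Im (w x))"
    by (intro L1_loc_integrable_test[OF q] test_fun_Im w)
  have "(LINT x|lebesgue. p x * (vderiv h x)\<^sup>2 - (q x)\<^sup>2 / (4 * p x) * (h x)\<^sup>2)
      \<le> (LINT x|lebesgue. p x * (cmod (vderiv u x))\<^sup>2 + q x * Im (w x))"
  proof (rule integral_mono_AE)
    show "AE x in lebesgue. p x * (vderiv h x)\<^sup>2 - (q x)\<^sup>2 / (4 * p x) * (h x)\<^sup>2
        \<le> p x * (cmod (vderiv u x))\<^sup>2 + q x * Im (w x)"
    proof -
      have "AE x\<in>I in lebesgue. p x = 0 \<longrightarrow> q x = 0"
        using qp by (simp add: sq_quotient_L1_loc_def)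
      with pos show ?thesis
      proof eventually_elim
        case (elim x)
        show ?case
        proof (cases "x \<in> I")
          case True
          then show ?thesis using elim point by blast
        next
          case False
          then show ?thesis
            using test_fun_zero_off[OF h] test_fun_zero_off[OF du]
              test_fun_zero_off[OF test_fun_vderiv[OF h]] by (simp add: w_def)
        qed
      qed
    qed
  qed (use i1 i2 i3 i4 in auto)
  then show ?thesis
    using red[OF h] i1 i2 i3 i4 unfolding Re_neg_form[OF u]
    by (simp add: reduced_form_def h_def w_def)
qed

text \<open>
  The modulus of a test function need not be smooth at its zeros. But a smooth curve in the plane
  has a range of measure zero, so there are arbitrarily small \<open>z\<close> that \<open>u\<close> avoids. With a cutoff \<open>\<kappa>\<close>
  that is \<open>1\<close> on the support of \<open>u\<close>, the function \<open>u - z \<kappa>\<close> has no zero on that support, and off it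
  its modulus is \<open>|z| \<kappa>\<close>, which is smooth. The form at \<open>u - z \<kappa>\<close> is a polynomial in \<open>z\<close> and its
  conjugate, hence continuous at \<open>z = 0\<close>.
\<close>

theorem accretive_if_reduced_form:
  assumes pos: "AE x\<in>I in lebesgue. 0 \<le> p x" and qp: "sq_quotient_L1_loc I q p"
    and red: "\<And>h. h \<in> test_functions I \<Longrightarrow> 0 \<le> reduced_form h"
  shows "neg_L_accretive I a b c"
  unfolding neg_L_accretive_def
proof
  fix u :: "real \<Rightarrow> complex" assume u: "u \<in> test_functions I"
  obtain K where K: "compact K" "K \<subseteq> I" "\<And>x. x \<notin> K \<Longrightarrow> u x = 0"
    using test_fun_support[OF u] by metis
  obtain \<kappa> :: "real \<Rightarrow> real" where k: "\<kappa> \<in> test_functions I" "\<And>x. 0 \<le> \<kappa> x" "\<And>x. x \<in> K \<Longrightarrow> \<kappa> x = 1"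
    using cutoff_function[OF open_I interval_I K(1,2)] by metis
  define v where "v = (\<lambda>x. complex_of_real (\<kappa> x))"
  have v: "v \<in> test_functions I" unfolding v_def by (rule test_fun_of_real[OF k(1)])
  have neg: "negligible (range u)"
  proof (rule negligible_differentiable_image_lowdim)
    show "u differentiable_on UNIV"
      using test_fun_deriv[OF u]
      by (auto simp: differentiable_on_def intro: differentiableI_vector)
  qed simp
  have "\<exists>z. cmod z < inverse (Suc n) \<and> z \<notin> range u" for n
  proof (rule ccontr)
    assume "\<nexists>z. cmod z < inverse (Suc n) \<and> z \<notin> range u"
    then have "ball 0 (inverse (Suc n)) \<subseteq> range u" by auto
    then have "negligible (ball (0::complex) (inverse (Suc n)))"
      using neg negligible_subset by blast
    then show False
      using open_not_negligible[of "ball (0::complex) (inverse (Suc n))"] by simp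
  qed
  then obtain z where z: "\<And>n. cmod (z n) < inverse (Suc n)" "\<And>n. z n \<notin> range u"
    by metis
  have z0: "z \<longlonglongrightarrow> 0"
    using z(1) by (intro tendsto_norm_zero_cancel
        [OF real_tendsto_sandwich[OF _ _ tendsto_const LIMSEQ_inverse_real_of_nat]])
      (auto intro!: always_eventually less_imp_le)
  define Q where "Q w = Re (- L_form a b c (\<lambda>x. u x + w * v x) (\<lambda>x. u x + w * v x))" for w
  have "0 \<le> Q (- z n)" for n
    unfolding Q_def
  proof (rule Re_neg_form_nonneg_if_modulus_smooth[OF pos qp red])
    show t: "(\<lambda>x. u x + - z n * v x) \<in> test_functions I"
      by (intro test_fun_add u test_fun_cmult v)
    have "smooth_on UNIV (\<lambda>x. sqrt ((cmod (u x + - z n * v x))\<^sup>2))"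
    proof (rule smooth_on_sqrt_glue[of _ "\<lambda>x. cmod (z n) * \<kappa> x" K])
      show "smooth_on UNIV (\<lambda>x. (cmod (u x + - z n * v x))\<^sup>2)"
        using test_fun_smooth[OF test_fun_cmod_sq[OF t]] .
      show "smooth_on UNIV (\<lambda>x. cmod (z n) * \<kappa> x)"
        by (rule test_fun_smooth[OF test_fun_cmult[OF k(1)]])
      show "closed K" using K(1) by (rule compact_imp_closed)
      show "0 < (cmod (u x + - z n * v x))\<^sup>2" if "x \<in> K" for x
      proof -
        have "u x \<noteq> z n" using z(2)[of n] by (metis rangeI)
        then show ?thesis using k(3)[OF that] by (simp add: v_def)
      qed
      show "sqrt ((cmod (u x + - z n * v x))\<^sup>2) = cmod (z n) * \<kappa> x" if "x \<notin> K" for x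
        using K(3)[OF that] k(2)[of x] by (simp add: v_def norm_mult)
    qed
    moreover obtain L where "compact L" "L \<subseteq> I" "\<And>x. x \<notin> L \<Longrightarrow> u x + - z n * v x = 0"
      using test_fun_support[OF t] by metis
    ultimately show "(\<lambda>x. cmod (u x + - z n * v x)) \<in> test_functions I"
      by (intro test_functionsI[of _ L]) auto
  qed
  moreover have "(\<lambda>n. Q (- z n)) \<longlonglongrightarrow> Q 0"
  proof -
    have "(\<lambda>n. Re (- (L_form a b c u u + (- z n) * L_form a b c v u + cnj (- z n) * L_form a b c u v
          + ((- z n) * cnj (- z n)) * L_form a b c v v)))
       \<longlonglongrightarrow> Re (- (L_form a b c u u + (- 0) * L_form a b c v u + cnj (- 0) * L_form a b c u v
          + ((- 0) * cnj (- 0)) * L_form a b c v v))"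
      by (intro tendsto_intros z0)
    then show ?thesis
      unfolding Q_def L_form_perturb[OF u v] by simp
  qed
  ultimately have "0 \<le> Q 0"
    by (meson LIMSEQ_le_const)
  then show "0 \<le> Re (- L_form a b c u u)"
    by (simp add: Q_def)
qed

text \<open>
  Testing the Riccati inequality with \<open>h\<^sup>2\<close> bounds the potential by an integral that falls short of
  \<open>\<integral> p h'\<^sup>2\<close> by the integral of the perfect square \<open>(p h' + f h)\<^sup>2 / p\<close>.
\<close>

theorem accretive_if_riccati:
  assumes pos: "AE x\<in>I in lebesgue. 0 \<le> p x" and qp: "sq_quotient_L1_loc I q p"
    and f: "f \<in> L1_loc I" and fp: "sq_quotient_L1_loc I f p" and ric: "riccati_ineq I b c p q f"
  shows "neg_L_accretive I a b c"
proof (rule accretive_if_reduced_form[OF pos qp])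
  fix h :: "real \<Rightarrow> real" assume h: "h \<in> test_functions I"
  have h2: "(\<lambda>x. (h x)\<^sup>2) \<in> test_functions I" by (rule test_fun_power2[OF h])
  have "dist_Re c (\<lambda>x. (h x)\<^sup>2) - 1/2 * dist_deriv (dist_Re b) (\<lambda>x. (h x)\<^sup>2)
      + dist_of_fun I (\<lambda>x. (q x)\<^sup>2 / (4 * p x)) (\<lambda>x. (h x)\<^sup>2)
      \<le> dist_deriv (dist_of_fun I f) (\<lambda>x. (h x)\<^sup>2) - dist_of_fun I (\<lambda>x. (f x)\<^sup>2 / p x) (\<lambda>x. (h x)\<^sup>2)"
    using ric h2 unfolding riccati_ineq_def dist_le_def by auto
  moreover have "dist_deriv (dist_of_fun I f) (\<lambda>x. (h x)\<^sup>2) = - (LINT x|lebesgue. f x * (2 * h x * vderiv h x))"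
    using dist_of_fun_eq[OF test_fun_vderiv[OF h2]]
    by (simp add: dist_deriv_def vderiv_power2[OF h, abs_def])
  ultimately have *: "\<sigma> (\<lambda>x. (h x)\<^sup>2) + (LINT x|lebesgue. (q x)\<^sup>2 / (4 * p x) * (h x)\<^sup>2)
      \<le> - (LINT x|lebesgue. f x * (2 * h x * vderiv h x)) - (LINT x|lebesgue. (f x)\<^sup>2 / p x * (h x)\<^sup>2)"
    by (simp add: dist_of_fun_eq[OF h2] zeroth_order_def)
  have i1: "integrable lebesgue (\<lambda>x. p x * (vderiv h x)\<^sup>2)"
    by (intro L1_loc_integrable_test[OF p] test_fun_power2 test_fun_vderiv h)
  have i2: "integrable lebesgue (\<lambda>x. f x * (2 * h x * vderiv h x))"
    using L1_loc_integrable_test[OF f test_fun_vderiv[OF h2]]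
    by (simp add: vderiv_power2[OF h, abs_def])
  have i3: "integrable lebesgue (\<lambda>x. (f x)\<^sup>2 / p x * (h x)\<^sup>2)"
    by (rule integrable_potential[OF fp h2])
  have "0 \<le> (LINT x|lebesgue. p x * (vderiv h x)\<^sup>2 + f x * (2 * h x * vderiv h x) + (f x)\<^sup>2 / p x * (h x)\<^sup>2)"
  proof (rule integral_nonneg_AE)
    have "AE x\<in>I in lebesgue. p x = 0 \<longrightarrow> f x = 0"
      using fp by (simp add: sq_quotient_L1_loc_def)
    with pos show "AE x in lebesgue. 0 \<le> p x * (vderiv h x)\<^sup>2 + f x * (2 * h x * vderiv h x) + (f x)\<^sup>2 / p x * (h x)\<^sup>2"
    proof eventually_elim
      case (elim x)
      consider "x \<notin> I" | "x \<in> I" "p x = 0" | "0 < p x"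
        using elim by fastforce
      then show ?case
      proof cases
        case 1
        then show ?thesis
          using test_fun_zero_off[OF h] test_fun_zero_off[OF test_fun_vderiv[OF h]] by simp
      next
        case 2
        then show ?thesis using elim by simp
      next
        case 3
        then have "p x * (vderiv h x)\<^sup>2 + f x * (2 * h x * vderiv h x) + (f x)\<^sup>2 / p x * (h x)\<^sup>2
          = (p x * vderiv h x + f x * h x)\<^sup>2 / p x"
          by (simp add: field_simps power2_eq_square)
        also have "\<dots> \<ge> 0" using 3 by simp
        finally show ?thesis .
      qed
    qed
  qed
  then show "0 \<le> reduced_form h"
    using * i1 i2 i3 by (simp add: reduced_form_def)
qed

end

section \<open>Necessity: oscillating test functions\<close>

lemma quadratic_integral_limit:
  fixes P Q :: "real \<Rightarrow> real"
  assumes P: "integrable lebesgue P" "\<And>x. x \<notin> K \<Longrightarrow> P x = 0"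
    and Q: "integrable lebesgue Q" "\<And>x. x \<notin> K \<Longrightarrow> Q x = 0"
    and s: "\<And>n. s n \<in> borel_measurable lebesgue" "\<And>n x. x \<in> K \<Longrightarrow> \<bar>s n x\<bar> \<le> B"
    and t: "t \<in> borel_measurable lebesgue" "AE x in lebesgue. x \<in> K \<longrightarrow> (\<lambda>n. s n x) \<longlonglongrightarrow> t x"
    and C: "\<And>n. C \<le> (LINT x|lebesgue. P x * (s n x)\<^sup>2 + Q x * s n x)"
  shows "C \<le> (LINT x|lebesgue. P x * (t x)\<^sup>2 + Q x * t x)"
proof -
  have m: "P \<in> borel_measurable lebesgue" "Q \<in> borel_measurable lebesgue"
    using P Q by auto
  have "(\<lambda>n. LINT x|lebesgue. P x * (s n x)\<^sup>2 + Q x * s n x) \<longlonglongrightarrow> (LINT x|lebesgue. P x * (t x)\<^sup>2 + Q x * t x)"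
  proof (rule integral_dominated_convergence)
    show "(\<lambda>x. P x * (t x)\<^sup>2 + Q x * t x) \<in> borel_measurable lebesgue"
      by (intro borel_measurable_add borel_measurable_times borel_measurable_power m t)
    show "(\<lambda>x. P x * (s n x)\<^sup>2 + Q x * s n x) \<in> borel_measurable lebesgue" for n
      by (intro borel_measurable_add borel_measurable_times borel_measurable_power m s)
    show "integrable lebesgue (\<lambda>x. \<bar>P x\<bar> * B\<^sup>2 + \<bar>Q x\<bar> * B)"
      using P Q by auto
    show "AE x in lebesgue. (\<lambda>n. P x * (s n x)\<^sup>2 + Q x * s n x) \<longlonglongrightarrow> P x * (t x)\<^sup>2 + Q x * t x"
      using t(2)
    proof eventually_elim
      case (elim x)
      then show ?case
        by (cases "x \<in> K") (auto simp: P(2) Q(2) intro!: tendsto_intros)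
    qed
    show "AE x in lebesgue. norm (P x * (s n x)\<^sup>2 + Q x * s n x) \<le> \<bar>P x\<bar> * B\<^sup>2 + \<bar>Q x\<bar> * B" for n
    proof (rule AE_I2)
      fix x
      show "norm (P x * (s n x)\<^sup>2 + Q x * s n x) \<le> \<bar>P x\<bar> * B\<^sup>2 + \<bar>Q x\<bar> * B"
      proof (cases "x \<in> K")
        case True
        have "(s n x)\<^sup>2 \<le> B\<^sup>2"
          using s(2)[OF True, of n] by (metis abs_ge_zero power2_abs power_mono)
        then have "\<bar>P x * (s n x)\<^sup>2\<bar> \<le> \<bar>P x\<bar> * B\<^sup>2" "\<bar>Q x * s n x\<bar> \<le> \<bar>Q x\<bar> * B"
          using s(2)[OF True, of n] by (auto simp: abs_mult intro: mult_left_mono)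
        then show ?thesis by simp
      next
        case False
        then show ?thesis by (simp add: P(2) Q(2))
      qed
    qed
  qed
  then show ?thesis
    using C by (meson LIMSEQ_le_const)
qed

text \<open>
  Polynomials suffice as phase derivatives: by Weierstrass they approximate continuous functions
  uniformly on \<open>K\<close>, and continuous functions approximate measurable ones almost everywhere.
  Truncation to \<open>[-B, B]\<close> supplies the domination.
\<close>

lemma quadratic_integral_polynomials_to_measurable:
  fixes P Q :: "real \<Rightarrow> real"
  assumes P: "integrable lebesgue P" "\<And>x. x \<notin> K \<Longrightarrow> P x = 0"
    and Q: "integrable lebesgue Q" "\<And>x. x \<notin> K \<Longrightarrow> Q x = 0"
    and K: "compact K"
    and C: "\<And>\<eta>. real_polynomial_function \<eta> \<Longrightarrow> C \<le> (LINT x|lebesgue. P x * (\<eta> x)\<^sup>2 + Q x * \<eta> x)"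
    and t: "t \<in> borel_measurable lebesgue" "\<And>x. \<bar>t x\<bar> \<le> B"
  shows "C \<le> (LINT x|lebesgue. P x * (t x)\<^sup>2 + Q x * t x)"
proof -
  have cont: "C \<le> (LINT x|lebesgue. P x * (s x)\<^sup>2 + Q x * s x)"
    if s: "continuous_on UNIV s" "\<And>x. \<bar>s x\<bar> \<le> B" for s
  proof -
    have "\<exists>g. real_polynomial_function g \<and> (\<forall>x\<in>K. \<bar>s x - g x\<bar> < inverse (real (Suc n)))" for n
    proof -
      have "continuous_on K s" using s(1) continuous_on_subset by blast
      moreover have "0 < inverse (real (Suc n))" by simp
      ultimately obtain g where "real_polynomial_function g"
          "\<And>x. x \<in> K \<Longrightarrow> \<bar>s x - g x\<bar> < inverse (real (Suc n))"
        using Stone_Weierstrass_real_polynomial_function[OF K] by blast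
      then show ?thesis by blast
    qed
    then obtain g where g: "\<And>n. real_polynomial_function (g n)"
        "\<And>n x. x \<in> K \<Longrightarrow> \<bar>s x - g n x\<bar> < inverse (real (Suc n))"
      by metis
    show ?thesis
    proof (rule quadratic_integral_limit[OF P Q])
      show "g n \<in> borel_measurable lebesgue" for n
        by (intro continuous_borel_lebesgue smooth_on_continuous smooth_on_polynomial g)
      show "\<bar>g n x\<bar> \<le> B + 1" if "x \<in> K" for n x
      proof -
        have "inverse (real (Suc n)) \<le> 1" by (simp add: inverse_le_1_iff)
        then show ?thesis using g(2)[OF that, of n] s(2)[of x] by linarith
      qed
      show "s \<in> borel_measurable lebesgue"
        by (rule continuous_borel_lebesgue[OF s(1)])
      have "(\<lambda>n. g n x) \<longlonglongrightarrow> s x" if "x \<in> K" for x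
      proof -
        have "(\<lambda>n. g n x - s x) \<longlonglongrightarrow> 0"
        proof (rule Lim_null_comparison[OF _ LIMSEQ_inverse_real_of_nat])
          show "\<forall>\<^sub>F n in sequentially. norm (g n x - s x) \<le> inverse (real (Suc n))"
            using g(2)[OF that] by (intro always_eventually) (auto simp: abs_minus_commute less_imp_le)
        qed
        then show ?thesis by (simp add: LIM_zero_iff)
      qed
      then show "AE x in lebesgue. x \<in> K \<longrightarrow> (\<lambda>n. g n x) \<longlonglongrightarrow> s x" by auto
      show "C \<le> (LINT x|lebesgue. P x * (g n x)\<^sup>2 + Q x * g n x)" for n
        by (rule C[OF g(1)])
    qed
  qed
  have "t measurable_on UNIV"
    by (rule lebesgue_measurable_imp_measurable_on[OF t(1)]) simp
  then obtain N g where N: "negligible N" and g: "\<And>n. continuous_on UNIV (g n)"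
      "\<And>x. x \<notin> N \<Longrightarrow> (\<lambda>n. g n x) \<longlonglongrightarrow> t x"
    unfolding measurable_on_def by auto
  have B: "0 \<le> B" using t(2)[of 0] by linarith
  define s where "s n x = max (- B) (min B (g n x))" for n x
  have sc: "continuous_on UNIV (s n)" for n
    unfolding s_def[abs_def] by (intro continuous_intros g)
  have sb: "\<bar>s n x\<bar> \<le> B" for n x
    using B by (auto simp: s_def)
  show ?thesis
  proof (rule quadratic_integral_limit[OF P Q _ _ t(1)])
    show "s n \<in> borel_measurable lebesgue" for n
      by (rule continuous_borel_lebesgue[OF sc])
    show "\<bar>s n x\<bar> \<le> B" for n x by (rule sb)
    have "N \<in> null_sets lebesgue"
      using N by (simp add: negligible_iff_null_sets)
    then have "AE x in lebesgue. x \<notin> N" by (rule AE_not_in)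
    then show "AE x in lebesgue. x \<in> K \<longrightarrow> (\<lambda>n. s n x) \<longlonglongrightarrow> t x"
    proof eventually_elim
      case (elim x)
      have "(\<lambda>n. s n x) \<longlonglongrightarrow> max (- B) (min B (t x))"
        unfolding s_def by (intro tendsto_max tendsto_min tendsto_const g(2) elim)
      moreover have "max (- B) (min B (t x)) = t x"
        using t(2)[of x] by auto
      ultimately show ?case by simp
    qed
    show "C \<le> (LINT x|lebesgue. P x * (s n x)\<^sup>2 + Q x * s n x)" for n
      by (rule cont[OF sc sb])
  qed
qed

lemma real_polynomial_antiderivative:
  assumes "real_polynomial_function (\<eta> :: real \<Rightarrow> real)"
  obtains \<theta> where "smooth_on UNIV \<theta>" "\<And>x. (\<theta> has_vector_derivative \<eta> x) (at x)"
proof -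
  obtain k n where \<eta>: "\<eta> = (\<lambda>x. \<Sum>i\<le>n. k i * x ^ i)"
    using assms real_polynomial_function_iff_sum by blast
  define \<theta> where "\<theta> x = (\<Sum>i\<le>n. k i / (real i + 1) * x ^ Suc i)" for x :: real
  have d: "(\<theta> has_vector_derivative \<eta> x) (at x)" for x
  proof -
    have "((\<lambda>x. k i / (real i + 1) * x ^ Suc i) has_real_derivative k i * x ^ i) (at x)" for i
    proof -
      have "((\<lambda>x. x ^ Suc i) has_real_derivative (real i + 1) * x ^ i) (at x)"
        using DERIV_pow[of "Suc i" x UNIV] by (simp add: add.commute)
      from DERIV_cmult[OF this, of "k i / (real i + 1)"] show ?thesis
        by (simp add: add_eq_0_iff_both_eq_0)
    qed
    then show ?thesis
      unfolding \<theta>_def[abs_def] \<eta> has_real_derivative_iff_has_vector_derivative[symmetric]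
      by (intro DERIV_sum)
  qed
  have "diff_upto m UNIV \<theta>" for m
  proof (cases m)
    case (Suc m')
    show ?thesis
      unfolding Suc using smooth_on_polynomial[OF assms] d
      by (intro diff_upto_SucI[of UNIV \<theta> \<eta>]) (auto simp: smooth_on_def)
  qed simp
  then show ?thesis
    using that[OF _ d] by (simp add: smooth_on_def)
qed

context divergence_form
begin

text \<open>
  Testing with \<open>u = h exp (i \<theta>)\<close>, where \<open>\<theta>' = \<eta>\<close>, separates the phase from the modulus:
  \<open>|u'|\<^sup>2 = h'\<^sup>2 + h\<^sup>2 \<eta>\<^sup>2\<close> and \<open>Im (u' cnj u) = h\<^sup>2 \<eta>\<close>.
\<close>

lemma accretive_imp_polynomial_phase:
  assumes acc: "neg_L_accretive I a b c" and h: "h \<in> test_functions I"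
    and poly: "real_polynomial_function \<eta>"
  shows "\<sigma> (\<lambda>x. (h x)\<^sup>2) - (LINT x|lebesgue. p x * (vderiv h x)\<^sup>2)
     \<le> (LINT x|lebesgue. (p x * (h x)\<^sup>2) * (\<eta> x)\<^sup>2 + (q x * (h x)\<^sup>2) * \<eta> x)"
proof -
  obtain \<theta> where \<theta>: "smooth_on UNIV \<theta>" "\<And>x. (\<theta> has_vector_derivative \<eta> x) (at x)"
    using real_polynomial_antiderivative[OF poly] by blast
  define u where "u x = cis (\<theta> x) * complex_of_real (h x)" for x
  have "smooth_on UNIV (\<lambda>x. cis (\<theta> x))"
    by (rule smooth_on_compose[OF open_UNIV smooth_on_cis \<theta>(1)]) simp
  then have u: "u \<in> test_functions I"
    unfolding u_def[abs_def] by (rule test_fun_mult(1)) (rule test_fun_of_real[OF h])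
  have du: "vderiv u x = cis (\<theta> x) * Complex (vderiv h x) (\<eta> x * h x)" for x
  proof (rule vderiv_eqI)
    have c: "(cis has_vector_derivative \<i> * cis y) (at y)" for y
      using exp_scaleR_has_vector_derivative_right[of \<i> y UNIV]
      by (simp add: cis_conv_exp[abs_def] scaleR_conv_of_real mult.commute)
    have "((\<lambda>x. cis (\<theta> x)) has_vector_derivative \<eta> x *\<^sub>R (\<i> * cis (\<theta> x))) (at x)"
      using vector_diff_chain_at[OF \<theta>(2) c] by (simp add: o_def)
    from has_vector_derivative_mult[OF this
        bounded_linear.has_vector_derivative[OF bounded_linear_of_real test_fun_deriv[OF h]]]
    show "(u has_vector_derivative cis (\<theta> x) * Complex (vderiv h x) (\<eta> x * h x)) (at x)"
      by (simp add: u_def[abs_def] Complex_eq algebra_simps scaleR_conv_of_real)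
  qed
  have 1: "(cmod (u x))\<^sup>2 = (h x)\<^sup>2" for x
    by (simp add: u_def norm_mult)
  have 2: "(cmod (vderiv u x))\<^sup>2 = (vderiv h x)\<^sup>2 + (h x)\<^sup>2 * (\<eta> x)\<^sup>2" for x
    by (simp add: du norm_mult cmod_power2 power_mult_distrib mult.commute)
  have 3: "Im (vderiv u x * cnj (u x)) = (h x)\<^sup>2 * \<eta> x" for x
  proof -
    have "vderiv u x * cnj (u x) = (cis (\<theta> x) * cnj (cis (\<theta> x))) * (Complex (vderiv h x) (\<eta> x * h x) * of_real (h x))"
      by (simp add: du u_def)
    also have "cis (\<theta> x) * cnj (cis (\<theta> x)) = 1"
      by (simp add: complex_norm_square[symmetric])
    finally show ?thesis
      by (simp add: power2_eq_square)
  qed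
  have i1: "integrable lebesgue (\<lambda>x. p x * (vderiv h x)\<^sup>2)"
    by (intro L1_loc_integrable_test[OF p] test_fun_power2 test_fun_vderiv h)
  have sm: "smooth_on UNIV (\<lambda>x. (\<eta> x)\<^sup>2)" "smooth_on UNIV \<eta>"
    by (auto intro!: smooth_on_power2 smooth_on_polynomial poly)
  have "integrable lebesgue (\<lambda>x. p x * ((h x)\<^sup>2 * (\<eta> x)\<^sup>2))"
    by (intro L1_loc_integrable_test[OF p] test_fun_mult(2) sm test_fun_power2 h)
  then have i2: "integrable lebesgue (\<lambda>x. p x * (h x)\<^sup>2 * (\<eta> x)\<^sup>2)"
    by (simp add: mult.assoc)
  have "integrable lebesgue (\<lambda>x. q x * ((h x)\<^sup>2 * \<eta> x))"
    by (intro L1_loc_integrable_test[OF q] test_fun_mult(2) sm test_fun_power2 h)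
  then have i3: "integrable lebesgue (\<lambda>x. q x * (h x)\<^sup>2 * \<eta> x)"
    by (simp add: mult.assoc)
  have "0 \<le> Re (- L_form a b c u u)"
    using acc u by (simp add: neg_L_accretive_def)
  also have "\<dots> = (LINT x|lebesgue. p x * (vderiv h x)\<^sup>2 + p x * (h x)\<^sup>2 * (\<eta> x)\<^sup>2)
      + (LINT x|lebesgue. q x * (h x)\<^sup>2 * \<eta> x) - \<sigma> (\<lambda>x. (h x)\<^sup>2)"
    unfolding Re_neg_form[OF u] 1 2 3 by (simp add: algebra_simps)
  finally show ?thesis
    using i1 i2 i3 by simp
qed

lemma accretive_imp_bounded_phase:
  assumes acc: "neg_L_accretive I a b c" and h: "h \<in> test_functions I"
    and t: "t \<in> borel_measurable lebesgue" "\<And>x. \<bar>t x\<bar> \<le> B"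
  shows "\<sigma> (\<lambda>x. (h x)\<^sup>2) - (LINT x|lebesgue. p x * (vderiv h x)\<^sup>2)
     \<le> (LINT x|lebesgue. (p x * (h x)\<^sup>2) * (t x)\<^sup>2 + (q x * (h x)\<^sup>2) * t x)"
proof -
  have h2: "(\<lambda>x. (h x)\<^sup>2) \<in> test_functions I" by (rule test_fun_power2[OF h])
  obtain K where K: "compact K" "\<And>x. x \<notin> K \<Longrightarrow> h x = 0"
    using test_fun_support[OF h] by metis
  show ?thesis
    by (rule quadratic_integral_polynomials_to_measurable[OF _ _ _ _ K(1) _ t])
       (simp_all add: L1_loc_integrable_test[OF p h2] L1_loc_integrable_test[OF q h2] K(2)
          accretive_imp_polynomial_phase[OF acc h])
qed

text \<open>
  The phase derivative may be any multiple of the indicator function of \<open>{p \<kappa>\<^sup>2 < 0}\<close>. The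
  square of the factor multiplies the integral of \<open>p \<kappa>\<^sup>2\<close> over this set, which therefore cannot be negative.
\<close>

theorem accretive_imp_p_nonneg:
  assumes acc: "neg_L_accretive I a b c"
  shows "AE x\<in>I in lebesgue. 0 \<le> p x"
proof (rule AE_exhaustI[OF open_I])
  fix K assume K: "compact K" "K \<subseteq> I"
  obtain \<kappa> :: "real \<Rightarrow> real" where k: "\<kappa> \<in> test_functions I" "\<And>x. x \<in> K \<Longrightarrow> \<kappa> x = 1"
    using cutoff_function[OF open_I interval_I K] by metis
  have k2: "(\<lambda>x. (\<kappa> x)\<^sup>2) \<in> test_functions I" by (rule test_fun_power2[OF k(1)])
  define P where "P x = p x * (\<kappa> x)\<^sup>2" for x
  define Q where "Q x = q x * (\<kappa> x)\<^sup>2" for x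
  have P: "integrable lebesgue P" and Q: "integrable lebesgue Q"
    unfolding P_def[abs_def] Q_def[abs_def]
    by (rule L1_loc_integrable_test[OF p k2] L1_loc_integrable_test[OF q k2])+
  define N where "N = {x. P x < 0}"
  have N: "N \<in> sets lebesgue"
    using borel_measurable_integrable[OF P] by (simp add: N_def borel_measurable_iff_less)
  define E where "E = (LINT x|lebesgue. p x * (vderiv \<kappa> x)\<^sup>2) - \<sigma> (\<lambda>x. (\<kappa> x)\<^sup>2)"
  define A where "A = (LINT x|lebesgue. P x * indicator N x)"
  define D where "D = (LINT x|lebesgue. Q x * indicator N x)"
  have iP: "integrable lebesgue (\<lambda>x. P x * indicator N x)" and iQ: "integrable lebesgue (\<lambda>x. Q x * indicator N x)"
    using integrable_mult_indicator[OF N P] integrable_mult_indicator[OF N Q] by (simp_all add: mult.commute)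
  have quad: "- E \<le> t\<^sup>2 * A + t * D" for t
  proof -
    have "- E \<le> (LINT x|lebesgue. P x * (t * indicator N x)\<^sup>2 + Q x * (t * indicator N x))"
      using accretive_imp_bounded_phase[OF acc k(1), of "\<lambda>x. t * indicator N x" "\<bar>t\<bar>"] N
      by (simp add: E_def P_def Q_def indicator_def abs_mult)
    also have "\<dots> = (LINT x|lebesgue. t\<^sup>2 * (P x * indicator N x) + t * (Q x * indicator N x))"
      by (rule Bochner_Integration.integral_cong) (auto simp: indicator_def)
    also have "\<dots> = t\<^sup>2 * A + t * D"
      using iP iQ by (simp add: A_def D_def)
    finally show ?thesis .
  qed
  have "0 \<le> A"
  proof (rule ccontr)
    assume "\<not> 0 \<le> A"
    then have A: "A < 0" by simp
    \<comment> \<open>for this \<open>t\<close> the quadratic term outweighs both lower-order terms\<close>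
    define t where "t = 1 + (\<bar>E\<bar> + \<bar>D\<bar>) / (- A)"
    have t1: "1 \<le> t" using A by (simp add: t_def divide_nonneg_neg)
    have tA: "t * A = A - (\<bar>E\<bar> + \<bar>D\<bar>)" using A by (simp add: t_def field_simps)
    have "t\<^sup>2 * A + t * D = t * (A - (\<bar>E\<bar> + \<bar>D\<bar>) + D)"
      unfolding power2_eq_square mult.assoc tA by (simp add: algebra_simps)
    also have "\<dots> \<le> t * (A - \<bar>E\<bar>)"
      using t1 by (intro mult_left_mono) auto
    also have "\<dots> \<le> 1 * (A - \<bar>E\<bar>)"
      using t1 A by (intro mult_right_mono_neg) auto
    finally have "t\<^sup>2 * A + t * D \<le> A - \<bar>E\<bar>" by simp
    from order_trans[OF quad this] show False
      using A abs_ge_self[of E] by linarith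
  qed
  moreover have "0 \<le> (LINT x|lebesgue. - (P x * indicator N x))"
    by (rule integral_nonneg_AE) (auto simp: N_def indicator_def)
  ultimately have "(LINT x|lebesgue. - (P x * indicator N x)) = 0"
    by (simp add: A_def)
  then have "AE x in lebesgue. - (P x * indicator N x) = 0"
    by (subst (asm) integral_nonneg_eq_0_iff_AE) (use iP in \<open>auto simp: N_def indicator_def\<close>)
  then show "AE x\<in>K in lebesgue. 0 \<le> p x"
    by (rule eventually_mono) (use k(2) in \<open>auto simp: P_def N_def indicator_def split: if_splits\<close>)
qed

text \<open>
  Pointwise, \<open>p \<eta>\<^sup>2 + q \<eta>\<close> is least for \<open>\<eta> = - q / (2 p)\<close>, with the value \<open>- q\<^sup>2 / (4 p)\<close>. This \<open>\<eta>\<close> may be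
  unbounded, so \<open>t n\<close> regularises it: it vanishes where \<open>|q| > n\<close>, and elsewhere \<open>p\<close> is raised by \<open>1 / (n + 1)\<close>.
  The resulting lower bounds \<open>G n\<close> of \<open>q\<^sup>2 h\<^sup>2 / (4 p)\<close> increase with \<open>n\<close> and have uniformly bounded
  integrals. Monotone convergence then shows that their limit is finite almost everywhere, which
  excludes \<open>q \<noteq> 0 = p\<close>, and bounds its integral.
\<close>

lemma accretive_imp_potential_bound:
  assumes acc: "neg_L_accretive I a b c" and h: "h \<in> test_functions I"
  shows "AE x in lebesgue. h x \<noteq> 0 \<longrightarrow> p x = 0 \<longrightarrow> q x = 0"
    and "integrable lebesgue (\<lambda>x. (q x)\<^sup>2 / (4 * p x) * (h x)\<^sup>2)"
    and "0 \<le> reduced_form h"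
proof -
  have h2: "(\<lambda>x. (h x)\<^sup>2) \<in> test_functions I" by (rule test_fun_power2[OF h])
  have hI: "h x = 0" if "x \<notin> I" for x using test_fun_zero_off[OF h that] .
  define pI where "pI x = indicator I x * p x" for x
  define qI where "qI x = indicator I x * q x" for x
  define pp where "pp x = max (pI x) 0" for x
  have m: "pI \<in> borel_measurable lebesgue" "qI \<in> borel_measurable lebesgue"
    unfolding pI_def[abs_def] qI_def[abs_def] by (rule L1_loc_measurable[OF open_I] p q)+
  then have mpp: "pp \<in> borel_measurable lebesgue"
    unfolding pp_def[abs_def] by auto
  have mh: "h \<in> borel_measurable lebesgue"
    by (rule continuous_borel_lebesgue[OF test_fun_continuous[OF h]])
  have pp0: "0 \<le> pp x" for x by (simp add: pp_def)
  define t where "t n x = (if \<bar>qI x\<bar> \<le> real n then - (qI x / (2 * (pp x + inverse (real (Suc n))))) else 0)" for n x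
  define G where "G n x = (if \<bar>qI x\<bar> \<le> real n then (qI x)\<^sup>2 / (4 * (pp x + inverse (real (Suc n)))) * (h x)\<^sup>2 else 0)" for n x
  define E where "E = (LINT x|lebesgue. p x * (vderiv h x)\<^sup>2) - \<sigma> (\<lambda>x. (h x)\<^sup>2)"
  have ppn: "0 < pp x + inverse (real (Suc n))" for x n
    using pp0[of x] by (intro add_nonneg_pos) auto
  have mt: "t n \<in> borel_measurable lebesgue" and mG: "G n \<in> borel_measurable lebesgue" for n
    unfolding t_def[abs_def] G_def[abs_def] using m mpp mh by measurable
  have tb: "\<bar>t n x\<bar> \<le> real n * real (Suc n)" for n x
  proof (cases "\<bar>qI x\<bar> \<le> real n")
    case True
    have "\<bar>t n x\<bar> = \<bar>qI x\<bar> / (2 * (pp x + inverse (real (Suc n))))"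
      using True ppn[of x n] by (simp add: t_def abs_divide)
    also have "\<dots> \<le> real n / inverse (real (Suc n))"
      using True pp0[of x] by (intro frac_le) auto
    also have "\<dots> = real n * real (Suc n)" by (simp only: divide_inverse inverse_inverse_eq)
    finally show ?thesis .
  qed (simp add: t_def)
  have G0: "0 \<le> G n x" for n x
    using ppn[of x n] by (simp add: G_def less_imp_le)
  have Gle: "AE x in lebesgue. G n x \<le> - (p x * (h x)\<^sup>2 * (t n x)\<^sup>2 + q x * (h x)\<^sup>2 * t n x)" for n
    using accretive_imp_p_nonneg[OF acc]
  proof eventually_elim
    case (elim x)
    show ?case
    proof (cases "x \<in> I \<and> \<bar>qI x\<bar> \<le> real n")
      case True
      define d where "d = pp x + inverse (real (Suc n))"
      have d: "0 < d" using ppn by (simp add: d_def)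
      have eq: "qI x = q x" "pp x = p x" and pd: "0 \<le> p x" "p x \<le> d"
        using True elim by (auto simp: qI_def pp_def pI_def d_def)
      have tn: "t n x = - (q x / (2 * d))"
        using True by (simp add: t_def eq d_def)
      have "- (p x * (t n x)\<^sup>2 + q x * t n x) = (q x)\<^sup>2 / (2 * d) - p x * (q x)\<^sup>2 / (4 * d\<^sup>2)"
        unfolding tn using d by (simp add: power2_eq_square field_simps)
      also have "\<dots> \<ge> (q x)\<^sup>2 / (2 * d) - d * (q x)\<^sup>2 / (4 * d\<^sup>2)"
        using d pd by (intro diff_left_mono divide_right_mono mult_right_mono) auto
      also have "(q x)\<^sup>2 / (2 * d) - d * (q x)\<^sup>2 / (4 * d\<^sup>2) = (q x)\<^sup>2 / (4 * d)"
        using d by (simp add: field_simps power2_eq_square)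
      finally have "(q x)\<^sup>2 / (4 * d) * (h x)\<^sup>2 \<le> - (p x * (t n x)\<^sup>2 + q x * t n x) * (h x)\<^sup>2"
        by (rule mult_right_mono) simp
      then show ?thesis
        using True by (simp add: G_def eq d_def algebra_simps)
    next
      case False
      then show ?thesis using hI by (auto simp: G_def t_def)
    qed
  qed
  have iP: "integrable lebesgue (\<lambda>x. p x * (h x)\<^sup>2 * (t n x)\<^sup>2 + q x * (h x)\<^sup>2 * t n x)" for n
  proof -
    obtain L where L: "compact L" "L \<subseteq> I" "\<And>x. x \<notin> L \<Longrightarrow> h x = 0"
      by (rule test_fun_support[OF h]) (rule that)
    obtain B where B: "\<And>x. norm (h x) \<le> B" using test_fun_bounded[OF h] by metis
    have hB: "(h x)\<^sup>2 \<le> B\<^sup>2" for x using B[of x] by (metis abs_ge_zero power2_abs power_mono real_norm_def)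
    have tB: "(t n x)\<^sup>2 \<le> (real n * real (Suc n))\<^sup>2" for x
      using tb[of n x] by (metis abs_ge_zero power2_abs power_mono)
    note [simp del] = of_nat_Suc
    have "integrable lebesgue (\<lambda>x. p x * ((h x)\<^sup>2 * (t n x)\<^sup>2))"
      by (rule L1_loc_integrable_mult[OF p L(1,2), where B = "B\<^sup>2 * (real n * real (Suc n))\<^sup>2"])
         (use mh mt L(3) in \<open>auto simp: abs_mult intro!: mult_mono hB tB\<close>)
    moreover have "integrable lebesgue (\<lambda>x. q x * ((h x)\<^sup>2 * t n x))"
      by (rule L1_loc_integrable_mult[OF q L(1,2), where B = "B\<^sup>2 * (real n * real (Suc n))"])
         (use mh mt L(3) in \<open>auto simp: abs_mult intro!: mult_mono hB tb\<close>)
    ultimately show ?thesis by (simp add: mult.assoc)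
  qed
  have iG: "integrable lebesgue (G n)" for n
  proof (rule Bochner_Integration.integrable_bound[OF iP[of n] mG])
    show "AE x in lebesgue. norm (G n x) \<le> norm (p x * (h x)\<^sup>2 * (t n x)\<^sup>2 + q x * (h x)\<^sup>2 * t n x)"
      using Gle[of n]
    proof eventually_elim
      case (elim x)
      then show ?case using G0[of n x] unfolding real_norm_def by linarith
    qed
  qed
  have "(LINT x|lebesgue. G n x) \<le> (LINT x|lebesgue. - (p x * (h x)\<^sup>2 * (t n x)\<^sup>2 + q x * (h x)\<^sup>2 * t n x))" for n
    by (rule integral_mono_AE[OF iG Bochner_Integration.integrable_minus[OF iP] Gle])
  then have GE': "(LINT x|lebesgue. G n x) \<le> - (LINT x|lebesgue. p x * (h x)\<^sup>2 * (t n x)\<^sup>2 + q x * (h x)\<^sup>2 * t n x)" for n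
    unfolding Bochner_Integration.integral_minus .
  have GE: "(LINT x|lebesgue. G n x) \<le> E" for n
    using accretive_imp_bounded_phase[OF acc h mt tb, of n] GE'[of n] unfolding E_def by linarith
  have E0: "0 \<le> E"
  proof -
    have "0 \<le> (LINT x|lebesgue. G 0 x)" by (rule integral_nonneg_AE) (simp add: G0)
    then show ?thesis using GE[of 0] by linarith
  qed
  have inc: "incseq (\<lambda>n x. ennreal (G n x))"
  proof (intro monoI le_funI ennreal_leI)
    fix n n' :: nat and x assume le: "n \<le> n'"
    have "inverse (real (Suc n')) \<le> inverse (real (Suc n))" using le by (simp add: le_imp_inverse_le)
    then have "(qI x)\<^sup>2 / (4 * (pp x + inverse (real (Suc n)))) \<le> (qI x)\<^sup>2 / (4 * (pp x + inverse (real (Suc n'))))"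
      using ppn[of x n'] by (intro frac_le) auto
    then have mono: "(qI x)\<^sup>2 / (4 * (pp x + inverse (real (Suc n)))) * (h x)\<^sup>2
        \<le> (qI x)\<^sup>2 / (4 * (pp x + inverse (real (Suc n')))) * (h x)\<^sup>2"
      by (rule mult_right_mono) simp
    show "G n x \<le> G n' x"
    proof (cases "\<bar>qI x\<bar> \<le> real n")
      case True
      then have "\<bar>qI x\<bar> \<le> real n'" using le by linarith
      then show ?thesis using mono True unfolding G_def by (simp only: if_True)
    next
      case False
      then show ?thesis using G0[of n' x] by (simp add: G_def[of n])
    qed
  qed
  have supE: "(\<integral>\<^sup>+x. (SUP n. ennreal (G n x)) \<partial>lebesgue) \<le> ennreal E"
  proof -
    have "(\<integral>\<^sup>+x. (SUP n. ennreal (G n x)) \<partial>lebesgue) = (SUP n. \<integral>\<^sup>+x. ennreal (G n x) \<partial>lebesgue)"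
      using mG by (intro nn_integral_monotone_convergence_SUP inc) auto
    also have "\<dots> \<le> ennreal E"
      using GE by (intro SUP_least) (simp add: nn_integral_eq_integral[OF iG] G0 ennreal_leI)
    finally show ?thesis .
  qed
  have fin: "AE x in lebesgue. (SUP n. ennreal (G n x)) \<noteq> \<infinity>"
    using supE mG by (intro nn_integral_PInf_AE) (auto simp: top_unique)
  have nz: "q x = 0" if x: "(SUP n. ennreal (G n x)) \<noteq> \<infinity>" "h x \<noteq> 0" "p x = 0" for x
  proof (rule ccontr)
    assume qx: "q x \<noteq> 0"
    have "x \<in> I" using hI x(2) by blast
    then have eq: "qI x = q x" "pp x = 0" using x(3) by (auto simp: qI_def pp_def pI_def)
    obtain s where s: "(SUP n. ennreal (G n x)) = ennreal s" "0 \<le> s"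
      using x(1) by (cases "(SUP n. ennreal (G n x))") auto
    obtain k :: nat where k: "real k > \<bar>q x\<bar> + 4 * s / ((q x)\<^sup>2 * (h x)\<^sup>2)"
      using reals_Archimedean2 by blast
    have pos: "0 < (q x)\<^sup>2 * (h x)\<^sup>2" using qx x(2) by simp
    have "0 \<le> 4 * s / ((q x)\<^sup>2 * (h x)\<^sup>2)" using s(2) by simp
    then have kq: "\<bar>q x\<bar> \<le> real k" using k by linarith
    have "4 * s / ((q x)\<^sup>2 * (h x)\<^sup>2) < real (Suc k)"
      using k abs_ge_zero[of "q x"] by simp
    then have "s < (q x)\<^sup>2 * (h x)\<^sup>2 * real (Suc k) / 4"
      using pos by (simp add: field_simps)
    also have "\<dots> = G k x"
      using kq by (simp add: G_def eq field_simps)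
    finally have "ennreal s < ennreal (G k x)"
      using s(2) by (simp add: ennreal_less_iff)
    also have "\<dots> \<le> ennreal s"
      unfolding s(1)[symmetric] by (rule SUP_upper) simp
    finally show False by simp
  qed
  show 1: "AE x in lebesgue. h x \<noteq> 0 \<longrightarrow> p x = 0 \<longrightarrow> q x = 0"
    using fin by (rule eventually_mono) (use nz in blast)
  define V where "V x = (qI x)\<^sup>2 / (4 * pI x) * (h x)\<^sup>2" for x
  have Veq: "V x = (q x)\<^sup>2 / (4 * p x) * (h x)\<^sup>2" for x
    using hI by (cases "x \<in> I") (auto simp: V_def qI_def pI_def)
  have mV: "V \<in> borel_measurable lebesgue"
    unfolding V_def[abs_def] using m mh by measurable
  have VS: "AE x in lebesgue. 0 \<le> V x \<and> ennreal (V x) \<le> (SUP n. ennreal (G n x))"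
    using accretive_imp_p_nonneg[OF acc] 1
  proof eventually_elim
    case (elim x)
    show ?case
    proof (cases "h x = 0 \<or> q x = 0")
      case True
      then show ?thesis by (auto simp: Veq)
    next
      case False
      then have xI: "x \<in> I" using hI by blast
      then have px: "0 < p x" using elim False by auto
      have eq: "qI x = q x" "pp x = p x" using xI px by (auto simp: qI_def pp_def pI_def)
      have "(\<lambda>n. G n x) \<longlonglongrightarrow> V x"
      proof (rule Lim_transform_eventually)
        have "(\<lambda>n. (q x)\<^sup>2 / (4 * (p x + inverse (real (Suc n)))) * (h x)\<^sup>2) \<longlonglongrightarrow> (q x)\<^sup>2 / (4 * (p x + 0)) * (h x)\<^sup>2"
          using px by (intro tendsto_intros LIMSEQ_inverse_real_of_nat) auto
        then show "(\<lambda>n. (q x)\<^sup>2 / (4 * (p x + inverse (real (Suc n)))) * (h x)\<^sup>2) \<longlonglongrightarrow> V x"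
          by (simp add: Veq)
        obtain k :: nat where "\<bar>q x\<bar> \<le> real k" using real_arch_simple by blast
        then show "\<forall>\<^sub>F n in sequentially. (q x)\<^sup>2 / (4 * (p x + inverse (real (Suc n)))) * (h x)\<^sup>2 = G n x"
          by (intro eventually_sequentiallyI[of k]) (auto simp: G_def eq)
      qed
      then have "(\<lambda>n. ennreal (G n x)) \<longlonglongrightarrow> ennreal (V x)" by (rule tendsto_ennrealI)
      then have "ennreal (V x) \<le> (SUP n. ennreal (G n x))"
        by (rule LIMSEQ_le_const2) (intro exI allI impI SUP_upper UNIV_I)
      moreover have "0 \<le> V x" using px by (simp add: Veq)
      ultimately show ?thesis by simp
    qed
  qed
  have nnV: "(\<integral>\<^sup>+x. ennreal (V x) \<partial>lebesgue) \<le> ennreal E"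
  proof -
    have "(\<integral>\<^sup>+x. ennreal (V x) \<partial>lebesgue) \<le> (\<integral>\<^sup>+x. (SUP n. ennreal (G n x)) \<partial>lebesgue)"
      using VS by (intro nn_integral_mono_AE) (auto elim: eventually_mono)
    then show ?thesis using supE by (rule order_trans)
  qed
  have iV: "integrable lebesgue V"
  proof (rule integrableI_nonneg[OF mV])
    show "AE x in lebesgue. 0 \<le> V x" using VS by (auto elim: eventually_mono)
    show "(\<integral>\<^sup>+x. ennreal (V x) \<partial>lebesgue) < \<infinity>" using nnV by (simp add: le_less_trans)
  qed
  then show "integrable lebesgue (\<lambda>x. (q x)\<^sup>2 / (4 * p x) * (h x)\<^sup>2)"
    by (simp add: Veq[abs_def])
  have "ennreal (LINT x|lebesgue. V x) \<le> ennreal E"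
    using nnV VS by (subst nn_integral_eq_integral[symmetric, OF iV]) (auto elim: eventually_mono)
  then have "(LINT x|lebesgue. V x) \<le> E"
    using E0 by (simp add: ennreal_le_iff)
  then show "0 \<le> reduced_form h"
    by (simp add: reduced_form_def E_def Veq[abs_def])
qed

theorem accretive_imp_sq_quotient:
  assumes acc: "neg_L_accretive I a b c"
  shows "sq_quotient_L1_loc I q p"
  unfolding sq_quotient_L1_loc_def
proof
  show "AE x\<in>I in lebesgue. p x = 0 \<longrightarrow> q x = 0"
  proof (rule AE_exhaustI[OF open_I])
    fix K assume K: "compact K" "K \<subseteq> I"
    obtain \<kappa> :: "real \<Rightarrow> real" where k: "\<kappa> \<in> test_functions I" "\<And>x. x \<in> K \<Longrightarrow> \<kappa> x = 1"
      using cutoff_function[OF open_I interval_I K] by metis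
    show "AE x\<in>K in lebesgue. p x = 0 \<longrightarrow> q x = 0"
      using accretive_imp_potential_bound(1)[OF acc k(1)]
      by (rule eventually_mono) (use k(2) in auto)
  qed
  show "(\<lambda>x. (q x)\<^sup>2 / p x) \<in> L1_loc I"
    unfolding L1_loc_def set_integrable_def
  proof (intro CollectI allI impI)
    fix K assume K: "compact K \<and> K \<subseteq> I"
    then obtain \<kappa> :: "real \<Rightarrow> real" where k: "\<kappa> \<in> test_functions I" "\<And>x. x \<in> K \<Longrightarrow> \<kappa> x = 1"
      using cutoff_function[OF open_I interval_I] by metis
    have Km: "K \<in> sets lebesgue" using K by (simp add: lmeasurable_compact fmeasurableD)
    have "integrable lebesgue (\<lambda>x. 4 * (indicator K x *\<^sub>R ((q x)\<^sup>2 / (4 * p x) * (\<kappa> x)\<^sup>2)))"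
      by (intro integrable_mult_right integrable_mult_indicator Km accretive_imp_potential_bound(2)[OF acc k(1)])
    moreover have "4 * (indicator K x *\<^sub>R ((q x)\<^sup>2 / (4 * p x) * (\<kappa> x)\<^sup>2)) = indicator K x *\<^sub>R ((q x)\<^sup>2 / p x)" for x
      using k(2)[of x] by (auto simp: indicator_def)
    ultimately show "integrable lebesgue (\<lambda>x. indicator K x *\<^sub>R ((q x)\<^sup>2 / p x))"
      by (simp only:)
  qed
qed

end

section \<open>Weak compactness in \<open>L\<^sup>2\<close>\<close>

definition square_integrable :: "'a measure \<Rightarrow> ('a \<Rightarrow> real) \<Rightarrow> bool" where
  "square_integrable M f \<longleftrightarrow> f \<in> borel_measurable M \<and> integrable M (\<lambda>x. (f x)\<^sup>2)"

lemma square_integrable_bound: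
  assumes "square_integrable M g" "f \<in> borel_measurable M" "AE x in M. \<bar>f x\<bar> \<le> g x"
  shows "square_integrable M f"
proof -
  have "integrable M (\<lambda>x. (f x)\<^sup>2)"
  proof (rule Bochner_Integration.integrable_bound)
    show "integrable M (\<lambda>x. (g x)\<^sup>2)" using assms(1) by (simp add: square_integrable_def)
    show "(\<lambda>x. (f x)\<^sup>2) \<in> borel_measurable M" using assms(2) by simp
    show "AE x in M. norm ((f x)\<^sup>2) \<le> norm ((g x)\<^sup>2)"
      using assms(3)
    proof eventually_elim
      case (elim x)
      then have "\<bar>f x\<bar>\<^sup>2 \<le> (g x)\<^sup>2" by (intro power_mono) auto
      then show ?case by simp
    qed
  qed
  then show ?thesis using assms(2) by (simp add: square_integrable_def)
qed

lemma square_integrable_mult: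
  assumes "square_integrable M f" "square_integrable M g"
  shows "integrable M (\<lambda>x. f x * g x)"
proof (rule Bochner_Integration.integrable_bound)
  show "integrable M (\<lambda>x. (f x)\<^sup>2 + (g x)\<^sup>2)"
    using assms by (simp add: square_integrable_def)
  show "(\<lambda>x. f x * g x) \<in> borel_measurable M"
    using assms by (auto simp: square_integrable_def)
  show "AE x in M. norm (f x * g x) \<le> norm ((f x)\<^sup>2 + (g x)\<^sup>2)"
  proof (rule AE_I2)
    fix x
    have "0 \<le> (\<bar>f x\<bar> - \<bar>g x\<bar>)\<^sup>2" by simp
    then have "2 * (\<bar>f x\<bar> * \<bar>g x\<bar>) \<le> (f x)\<^sup>2 + (g x)\<^sup>2"
      by (simp add: power2_diff)
    moreover have "0 \<le> \<bar>f x\<bar> * \<bar>g x\<bar>" by simp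
    ultimately have "\<bar>f x\<bar> * \<bar>g x\<bar> \<le> (f x)\<^sup>2 + (g x)\<^sup>2" by linarith
    then show "norm (f x * g x) \<le> norm ((f x)\<^sup>2 + (g x)\<^sup>2)"
      by (simp add: abs_mult)
  qed
qed

lemma square_integrable_lin:
  assumes "square_integrable M f" "square_integrable M g"
  shows "square_integrable M (\<lambda>x. r * f x + s * g x)"
proof -
  have "integrable M (\<lambda>x. r\<^sup>2 * (f x)\<^sup>2 + s\<^sup>2 * (g x)\<^sup>2 + 2 * r * s * (f x * g x))"
    using assms square_integrable_mult[OF assms] by (simp add: square_integrable_def)
  moreover have "r\<^sup>2 * (f x)\<^sup>2 + s\<^sup>2 * (g x)\<^sup>2 + 2 * r * s * (f x * g x) = (r * f x + s * g x)\<^sup>2" for x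
    by (simp add: power2_eq_square algebra_simps)
  ultimately show ?thesis
    using assms by (auto simp: square_integrable_def)
qed

lemma square_integrable_diff:
  "square_integrable M f \<Longrightarrow> square_integrable M g \<Longrightarrow> square_integrable M (\<lambda>x. f x - g x)"
  using square_integrable_lin[of M f g 1 "-1"] by simp

lemma square_integrable_add:
  "square_integrable M f \<Longrightarrow> square_integrable M g \<Longrightarrow> square_integrable M (\<lambda>x. f x + g x)"
  using square_integrable_lin[of M f g 1 1] by simp

lemma square_integrable_midpoint:
  "square_integrable M f \<Longrightarrow> square_integrable M g \<Longrightarrow> square_integrable M (\<lambda>x. (f x + g x) / 2)"
  using square_integrable_lin[of M f g "1/2" "1/2"] by (simp add: add_divide_distrib)

lemma parallelogram_law_integral:
  assumes "square_integrable M f" "square_integrable M g"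
  shows "(LINT x|M. (f x - g x)\<^sup>2) =
    2 * (LINT x|M. (f x)\<^sup>2) + 2 * (LINT x|M. (g x)\<^sup>2) - 4 * (LINT x|M. ((f x + g x) / 2)\<^sup>2)"
proof -
  have "(LINT x|M. (f x - g x)\<^sup>2) = (LINT x|M. 2 * (f x)\<^sup>2 + 2 * (g x)\<^sup>2 - 4 * ((f x + g x) / 2)\<^sup>2)"
    by (rule Bochner_Integration.integral_cong) (simp_all add: power2_eq_square field_simps)
  then show ?thesis
    using assms square_integrable_midpoint[OF assms] by (simp add: square_integrable_def)
qed

text \<open>
  The function \<open>\<Sum>n. 4\<^sup>n (g n)\<^sup>2\<close> is integrable, and the root of it dominates every \<open>2\<^sup>n |g n|\<close>. So rapid
  decay of the norms gives almost everywhere convergence together with a square-integrable majorant.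
\<close>

lemma fast_L2_decay_dominated:
  fixes g :: "nat \<Rightarrow> 'a \<Rightarrow> real"
  assumes g: "\<And>n. square_integrable M (g n)" "\<And>n. (LINT x|M. (g n x)\<^sup>2) \<le> (1/8) ^ n"
  obtains r where "square_integrable M r" "\<And>x. 0 \<le> r x" "AE x in M. \<forall>n. \<bar>g n x\<bar> \<le> (1/2) ^ n * r x"
proof -
  define S where "S x = (\<Sum>n. ennreal (4 ^ n * (g n x)\<^sup>2))" for x
  have m: "(\<lambda>x. 4 ^ n * (g n x)\<^sup>2) \<in> borel_measurable M" for n
    using g(1)[of n] by (auto simp: square_integrable_def)
  have mS: "S \<in> borel_measurable M"
    unfolding S_def[abs_def] using m by measurable
  have "(\<integral>\<^sup>+x. S x \<partial>M) = (\<Sum>n. \<integral>\<^sup>+x. ennreal (4 ^ n * (g n x)\<^sup>2) \<partial>M)"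
    unfolding S_def using m by (intro nn_integral_suminf) auto
  also have "\<dots> \<le> (\<Sum>n. ennreal ((1/2) ^ n))"
  proof (intro suminf_le)
    fix n
    have "(\<integral>\<^sup>+x. ennreal (4 ^ n * (g n x)\<^sup>2) \<partial>M) = ennreal (LINT x|M. 4 ^ n * (g n x)\<^sup>2)"
      using g(1)[of n] by (intro nn_integral_eq_integral) (auto simp: square_integrable_def)
    also have "(LINT x|M. 4 ^ n * (g n x)\<^sup>2) \<le> 4 ^ n * (1/8) ^ n"
      using g(2)[of n] by simp
    also have "(4::real) ^ n * (1/8) ^ n = (1/2) ^ n"
      by (simp add: power_mult_distrib[symmetric])
    finally show "(\<integral>\<^sup>+x. ennreal (4 ^ n * (g n x)\<^sup>2) \<partial>M) \<le> ennreal ((1/2) ^ n)"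
      by (simp add: ennreal_leI)
  qed auto
  also have "\<dots> = ennreal (\<Sum>n. (1/2) ^ n)"
    by (intro suminf_ennreal2) (auto intro: summable_geometric)
  finally have fin: "(\<integral>\<^sup>+x. S x \<partial>M) < \<infinity>"
    by (simp add: le_less_trans)
  then have AES: "AE x in M. S x \<noteq> \<infinity>"
    using mS by (intro nn_integral_PInf_AE) auto
  define H where "H x = enn2real (S x)" for x
  have mH: "H \<in> borel_measurable M" unfolding H_def[abs_def] using mS by measurable
  have iH: "integrable M H"
  proof (rule integrableI_nonneg[OF mH])
    show "AE x in M. 0 \<le> H x" by (simp add: H_def)
    have "(\<integral>\<^sup>+x. ennreal (H x) \<partial>M) \<le> (\<integral>\<^sup>+x. S x \<partial>M)"
      unfolding H_def by (intro nn_integral_mono) (simp add: ennreal_enn2real_if)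
    then show "(\<integral>\<^sup>+x. ennreal (H x) \<partial>M) < \<infinity>" using fin by (rule le_less_trans)
  qed
  show ?thesis
  proof (rule that[of "\<lambda>x. sqrt (H x)"])
    show "square_integrable M (\<lambda>x. sqrt (H x))"
      using mH iH by (simp add: square_integrable_def H_def[abs_def])
    show "0 \<le> sqrt (H x)" for x by (simp add: H_def)
    show "AE x in M. \<forall>n. \<bar>g n x\<bar> \<le> (1/2) ^ n * sqrt (H x)"
      using AES
    proof (rule eventually_mono, intro allI)
      fix x n assume fin: "S x \<noteq> \<infinity>"
      have "(\<Sum>k\<in>{n}. ennreal (4 ^ k * (g k x)\<^sup>2)) \<le> S x"
        unfolding S_def by (rule sum_le_suminf) simp_all
      then have "ennreal (4 ^ n * (g n x)\<^sup>2) \<le> S x" by simp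
      also have "S x = ennreal (H x)"
        using fin by (simp add: H_def top.not_eq_extremum)
      finally have "4 ^ n * (g n x)\<^sup>2 \<le> H x"
        by (simp add: H_def)
      then have "sqrt (4 ^ n * (g n x)\<^sup>2) \<le> sqrt (H x)" by simp
      moreover have "sqrt (4 ^ n * (g n x)\<^sup>2) = 2 ^ n * \<bar>g n x\<bar>"
      proof -
        have "(4::real) ^ n = (2 ^ n)\<^sup>2" by (simp add: power2_eq_square power_mult_distrib[symmetric])
        then show ?thesis by (simp add: real_sqrt_mult)
      qed
      ultimately show "\<bar>g n x\<bar> \<le> (1/2) ^ n * sqrt (H x)"
        by (simp add: field_simps)
    qed
  qed
qed

text \<open>
  A family of closed convex sets of \<open>L\<^sup>2\<close> functions, any finitely many of which meet a fixed ball,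
  has a common element: balls are weakly compact. The proof rests on the parallelogram law. The
  least norm on a finite intersection grows with the number of sets and is bounded, so along a
  suitable increasing sequence \<open>F n\<close> it comes within \<open>\<rho> n\<close> of its supremum \<open>S\<close>. Any two
  near-minimisers over supersets of \<open>F n\<close> are then close, so near-minimisers converge, and adding one
  further set \<open>C\<close> to each \<open>F n\<close> does not change the limit; hence the limit lies in \<open>C\<close>. Closedness is
  required under dominated almost everywhere convergence, which is what this argument provides
  and what dominated convergence can verify.
\<close>

theorem square_integrable_finite_intersection:
  fixes D :: real
  assumes L2: "\<And>C f. C \<in> \<C> \<Longrightarrow> f \<in> C \<Longrightarrow> square_integrable M f"
    and mid: "\<And>C f g. C \<in> \<C> \<Longrightarrow> f \<in> C \<Longrightarrow> g \<in> C \<Longrightarrow> (\<lambda>x. (f x + g x) / 2) \<in> C"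
    and cl: "\<And>C f s G. C \<in> \<C> \<Longrightarrow> (\<And>n. s n \<in> C) \<Longrightarrow> square_integrable M f \<Longrightarrow> square_integrable M G \<Longrightarrow>
        AE x in M. \<forall>n. \<bar>s n x\<bar> \<le> G x \<Longrightarrow> AE x in M. (\<lambda>n. s n x) \<longlonglongrightarrow> f x \<Longrightarrow> f \<in> C"
    and fip: "\<And>F. finite F \<Longrightarrow> F \<subseteq> \<C> \<Longrightarrow>
        \<exists>f. square_integrable M f \<and> (\<forall>C\<in>F. f \<in> C) \<and> (LINT x|M. (f x)\<^sup>2) \<le> D"
  shows "\<exists>f. square_integrable M f \<and> (\<forall>C\<in>\<C>. f \<in> C)"
proof -
  define feas where "feas F = {f. square_integrable M f \<and> (\<forall>C\<in>F. f \<in> C)}" for F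
  define N where "N f = (LINT x|M. (f x)\<^sup>2)" for f :: "'a \<Rightarrow> real"
  define d where "d F = Inf (N ` feas F)" for F
  define Fin where "Fin = {F. finite F \<and> F \<subseteq> \<C>}"
  have N0: "0 \<le> N f" for f unfolding N_def by (rule integral_nonneg_AE) simp
  have bdd: "bdd_below (N ` feas F)" for F using N0 by (auto intro!: bdd_belowI)
  have ne: "\<exists>f\<in>feas F. N f \<le> D" if "F \<in> Fin" for F
    using fip[of F] that by (auto simp: Fin_def feas_def N_def)
  have d_le: "d F \<le> N f" if "f \<in> feas F" for F f
    unfolding d_def using that by (intro cInf_lower bdd) auto
  have dD: "d F \<le> D" if "F \<in> Fin" for F
    using ne[OF that] d_le order_trans by blast
  \<comment> \<open>the least squared norm \<open>d\<close> increases along the directed family of finite subfamilies\<close>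
  define S where "S = Sup (d ` Fin)"
  have bddS: "bdd_above (d ` Fin)" using dD by (auto intro!: bdd_aboveI)
  have dS: "d F \<le> S" if "F \<in> Fin" for F
    unfolding S_def using that by (intro cSup_upper bddS) auto
  define \<rho> where "\<rho> n = (1/8::real) ^ n / 8" for n :: nat
  have \<rho>0: "0 < \<rho> n" for n by (simp add: \<rho>_def)
  have "{} \<in> Fin" by (simp add: Fin_def)
  then have neFin: "d ` Fin \<noteq> {}" by auto
  have "\<exists>F\<in>Fin. S - \<rho> n < d F" for n
  proof -
    have "S - \<rho> n < Sup (d ` Fin)" using \<rho>0[of n] by (simp add: S_def)
    then show ?thesis using less_cSupD[OF neFin] by auto
  qed
  then obtain F0 where F0: "\<And>n. F0 n \<in> Fin" "\<And>n. S - \<rho> n < d (F0 n)" by metis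
  define F where "F n = (\<Union>k\<le>n. F0 k)" for n
  have F: "F n \<in> Fin" for n using F0(1) by (auto simp: F_def Fin_def)
  have Fmono: "F n \<subseteq> F (Suc n)" for n unfolding F_def by (intro UN_mono) auto
  have Fsup: "F0 n \<subseteq> F n" for n by (auto simp: F_def)
  have near: "\<exists>f\<in>feas A. N f < S + \<rho> n" if "A \<in> Fin" for A n
  proof -
    have "N ` feas A \<noteq> {}" using ne[OF that] by auto
    moreover have "Inf (N ` feas A) < S + \<rho> n" using dS[OF that] \<rho>0[of n] by (simp add: d_def)
    ultimately have "\<exists>v\<in>N ` feas A. v < S + \<rho> n" by (rule cInf_lessD)
    then show ?thesis by blast
  qed
  have close: "N (\<lambda>x. f x - g x) \<le> (1/8) ^ n"
    if "f \<in> feas (F n)" "g \<in> feas (F n)" "N f < S + \<rho> n" "N g < S + \<rho> n" for f g n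
  proof -
    have "square_integrable M (\<lambda>x. (f x + g x) / 2)"
      using that(1,2) by (intro square_integrable_midpoint) (auto simp: feas_def)
    moreover have "(\<lambda>x. (f x + g x) / 2) \<in> C" if "C \<in> F0 n" for C
    proof (rule mid)
      show "C \<in> \<C>" using that F0(1)[of n] by (auto simp: Fin_def)
      show "f \<in> C" "g \<in> C"
        using that Fsup[of n] \<open>f \<in> feas (F n)\<close> \<open>g \<in> feas (F n)\<close> by (auto simp: feas_def)
    qed
    ultimately have "(\<lambda>x. (f x + g x) / 2) \<in> feas (F0 n)" by (simp add: feas_def)
    from d_le[OF this] F0(2)[of n] have "S - \<rho> n < N (\<lambda>x. (f x + g x) / 2)" by linarith
    moreover have "N (\<lambda>x. f x - g x) = 2 * N f + 2 * N g - 4 * N (\<lambda>x. (f x + g x) / 2)"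
      unfolding N_def using that(1,2) by (intro parallelogram_law_integral) (auto simp: feas_def)
    ultimately show ?thesis using that(3,4) by (simp add: \<rho>_def)
  qed
  have "\<forall>n. \<exists>f. f \<in> feas (F n) \<and> N f < S + \<rho> n" using near[OF F] by blast
  then obtain f where f: "\<And>n. f n \<in> feas (F n)" "\<And>n. N (f n) < S + \<rho> n"
    unfolding choice_iff by blast
  have fL2: "square_integrable M (f n)" for n using f(1)[of n] by (simp add: feas_def)
  have "N (\<lambda>x. f (Suc n) x - f n x) \<le> (1/8) ^ n" for n
  proof (rule close)
    show "f (Suc n) \<in> feas (F n)" using f(1)[of "Suc n"] Fmono[of n] by (auto simp: feas_def)
    have "\<rho> (Suc n) \<le> \<rho> n" by (simp add: \<rho>_def)
    then show "N (f (Suc n)) < S + \<rho> n" using f(2)[of "Suc n"] by linarith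
  qed (use f in auto)
  then obtain r where r: "square_integrable M r" "\<And>x. 0 \<le> r x"
      "AE x in M. \<forall>n. \<bar>f (Suc n) x - f n x\<bar> \<le> (1/2) ^ n * r x"
    using fast_L2_decay_dominated[of M "\<lambda>n x. f (Suc n) x - f n x"]
      square_integrable_diff[OF fL2 fL2] unfolding N_def by blast
  define g where "g x = lim (\<lambda>n. f n x)" for x
  have conv: "AE x in M. (\<lambda>n. f n x) \<longlonglongrightarrow> g x \<and> (\<forall>n. \<bar>f n x\<bar> \<le> \<bar>f 0 x\<bar> + 2 * r x)"
    using r(3)
  proof eventually_elim
    case (elim x)
    have tele: "f n x = f 0 x + (\<Sum>k<n. f (Suc k) x - f k x)" for n
      using sum_lessThan_telescope[of "\<lambda>k. f k x" n] by simp
    have geo: "summable (\<lambda>n. (1/2) ^ n * r x)"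
      by (intro summable_mult2 summable_geometric) simp
    have sm: "summable (\<lambda>n. f (Suc n) x - f n x)"
      by (rule summable_comparison_test'[OF geo]) (use elim in auto)
    then have "(\<lambda>n. f 0 x + (\<Sum>k<n. f (Suc k) x - f k x)) \<longlonglongrightarrow> f 0 x + (\<Sum>n. f (Suc n) x - f n x)"
      by (intro tendsto_intros summable_LIMSEQ)
    then have "convergent (\<lambda>n. f n x)"
      by (auto simp: convergent_def tele[symmetric])
    moreover have "\<bar>f n x\<bar> \<le> \<bar>f 0 x\<bar> + 2 * r x" for n
    proof -
      have "\<bar>\<Sum>k<n. f (Suc k) x - f k x\<bar> \<le> (\<Sum>k<n. (1/2) ^ k * r x)"
        using elim by (intro order_trans[OF sum_abs] sum_mono) auto
      also have "\<dots> \<le> (\<Sum>k. (1/2) ^ k * r x)"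
        using r(2) by (intro sum_le_suminf geo) auto
      also have "\<dots> = 2 * r x"
        using suminf_mult2[of "\<lambda>k. (1/2::real) ^ k" "r x"] suminf_geometric[of "1/2::real"]
        by (simp add: summable_geometric)
      finally show ?thesis using tele[of n] by linarith
    qed
    ultimately show ?case by (simp add: g_def convergent_LIMSEQ_iff)
  qed
  have mg: "g \<in> borel_measurable M"
    unfolding g_def[abs_def] using fL2 by (intro borel_measurable_lim_metric) (simp add: square_integrable_def)
  have abs_L2: "square_integrable M (\<lambda>x. \<bar>u x\<bar>)" if "square_integrable M u" for u
    using that by (auto simp: square_integrable_def)
  have G: "square_integrable M (\<lambda>x. \<bar>f 0 x\<bar> + 2 * r x)"
    using square_integrable_lin[OF abs_L2[OF fL2] r(1), of 1 0 2] by simp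
  have gL2: "square_integrable M g"
  proof (rule square_integrable_bound[OF G mg])
    show "AE x in M. \<bar>g x\<bar> \<le> \<bar>f 0 x\<bar> + 2 * r x"
      using conv
    proof eventually_elim
      case (elim x)
      then have "(\<lambda>n. \<bar>f n x\<bar>) \<longlonglongrightarrow> \<bar>g x\<bar>" by (intro tendsto_rabs) auto
      then show ?case by (rule LIMSEQ_le_const2) (use elim in auto)
    qed
  qed
  have "g \<in> C" if C: "C \<in> \<C>" for C
  proof -
    have "insert C (F n) \<in> Fin" for n using C F[of n] by (auto simp: Fin_def)
    then have "\<forall>n. \<exists>h. h \<in> feas (insert C (F n)) \<and> N h < S + \<rho> n" using near by blast
    then obtain h where h: "\<And>n. h n \<in> feas (insert C (F n))" "\<And>n. N (h n) < S + \<rho> n"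
      unfolding choice_iff by blast
    have hL2: "square_integrable M (h n)" for n using h(1)[of n] by (simp add: feas_def)
    have "N (\<lambda>x. h n x - f n x) \<le> (1/8) ^ n" for n
      using h(1)[of n] h(2)[of n] f(1)[of n] f(2)[of n] by (intro close) (auto simp: feas_def)
    then obtain r' where r': "square_integrable M r'" "\<And>x. 0 \<le> r' x"
        "AE x in M. \<forall>n. \<bar>h n x - f n x\<bar> \<le> (1/2) ^ n * r' x"
      using fast_L2_decay_dominated[of M "\<lambda>n x. h n x - f n x"]
        square_integrable_diff[OF hL2 fL2] unfolding N_def by blast
    show "g \<in> C"
    proof (rule cl[OF C _ gL2])
      show "h n \<in> C" for n using h(1)[of n] by (simp add: feas_def)
      show "square_integrable M (\<lambda>x. (\<bar>f 0 x\<bar> + 2 * r x) + r' x)"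
        by (rule square_integrable_add[OF G r'(1)])
      show "AE x in M. \<forall>n. \<bar>h n x\<bar> \<le> (\<bar>f 0 x\<bar> + 2 * r x) + r' x"
        using eventually_conj[OF conv r'(3)]
      proof (rule eventually_mono, intro allI)
        fix x n
        assume 12: "((\<lambda>n. f n x) \<longlonglongrightarrow> g x \<and> (\<forall>n. \<bar>f n x\<bar> \<le> \<bar>f 0 x\<bar> + 2 * r x))
          \<and> (\<forall>n. \<bar>h n x - f n x\<bar> \<le> (1/2) ^ n * r' x)"
        have "(1/2) ^ n * r' x \<le> 1 * r' x"
          using r'(2) by (intro mult_right_mono) (auto simp: power_le_one)
        moreover have "\<bar>h n x - f n x\<bar> \<le> (1/2) ^ n * r' x" using 12 by blast
        moreover have "\<bar>f n x\<bar> \<le> \<bar>f 0 x\<bar> + 2 * r x" using 12 by blast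
        ultimately show "\<bar>h n x\<bar> \<le> (\<bar>f 0 x\<bar> + 2 * r x) + r' x" by linarith
      qed
      show "AE x in M. (\<lambda>n. h n x) \<longlonglongrightarrow> g x"
        using conv r'(3)
      proof eventually_elim
        case (elim x)
        have "(\<lambda>n. (1/2) ^ n * r' x) \<longlonglongrightarrow> 0 * r' x"
          by (intro tendsto_intros LIMSEQ_power_zero) simp
        then have "(\<lambda>n. h n x - f n x) \<longlonglongrightarrow> 0"
          by (intro Lim_null_comparison[of "\<lambda>n. h n x - f n x" "\<lambda>n. (1/2) ^ n * r' x"])
             (use elim in \<open>auto intro!: always_eventually\<close>)
        from tendsto_add[OF this conjunct1[OF elim(1)]] show ?case by simp
      qed
    qed
  qed
  with gL2 show ?thesis by (intro exI[of _ g] conjI ballI)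
qed

section \<open>Approximate solutions of finitely many inequalities\<close>

lemma finite_test_fun_bounded:
  fixes F :: "(real \<Rightarrow> real) set"
  assumes "finite F" "F \<subseteq> test_functions I"
  shows "\<exists>B>0. \<forall>\<phi>\<in>F. \<forall>x. \<bar>\<phi> x\<bar> \<le> B \<and> \<bar>vderiv \<phi> x\<bar> \<le> B"
  using assms
proof (induction F)
  case empty
  then show ?case by (auto intro: exI[of _ 1])
next
  case (insert \<phi> F)
  obtain B where B: "0 < B" "\<forall>\<phi>\<in>F. \<forall>x. \<bar>\<phi> x\<bar> \<le> B \<and> \<bar>vderiv \<phi> x\<bar> \<le> B"
    using insert by auto
  obtain B1 where B1: "\<And>x. norm (\<phi> x) \<le> B1"
    using test_fun_bounded insert.prems by (metis insert_subset)
  obtain B2 where B2: "\<And>x. norm (vderiv \<phi> x) \<le> B2"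
    using test_fun_bounded test_fun_vderiv insert.prems by (metis insert_subset)
  have 1: "\<bar>\<phi> x\<bar> \<le> max B (max B1 B2) \<and> \<bar>vderiv \<phi> x\<bar> \<le> max B (max B1 B2)" for x
    using B1[of x] B2[of x] by (simp add: le_max_iff_disj)
  have 2: "\<bar>\<psi> x\<bar> \<le> max B (max B1 B2) \<and> \<bar>vderiv \<psi> x\<bar> \<le> max B (max B1 B2)" if "\<psi> \<in> F" for \<psi> x
    using B(2) that by (simp add: le_max_iff_disj)
  show ?case
    using B(1) 1 2 by (intro exI[of _ "max B (max B1 B2)"]) (simp add: less_max_iff_disj)
qed

lemma half_quotient_power2: "(v / (2 * y))\<^sup>2 * y = v\<^sup>2 / (4 * y)" if "y \<noteq> 0" for v y :: real
  using that by (simp add: power_divide power_mult_distrib) (simp add: power2_eq_square)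

lemma double_half_quotient: "2 * (v / (2 * y)) * y = v" if "y \<noteq> 0" for v y :: real
  using that by simp

context divergence_form
begin

text \<open>
  The left-hand side \<open>Re c - (Re b)' / 2 + q\<^sup>2 / (4 p)\<close> of the Riccati inequality, which is also the whole
  potential of the reduced form.
\<close>

definition \<tau> :: "(real \<Rightarrow> real) \<Rightarrow> real" where
  "\<tau> \<phi> = \<sigma> \<phi> + (LINT x|lebesgue. (q x)\<^sup>2 / (4 * p x) * \<phi> x)"

lemma tau_add:
  assumes "sq_quotient_L1_loc I q p" "\<phi> \<in> test_functions I" "\<psi> \<in> test_functions I"
  shows "\<tau> (\<lambda>x. \<phi> x + \<psi> x) = \<tau> \<phi> + \<tau> \<psi>"
  using integrable_potential(2)[OF assms(1,2)] integrable_potential(2)[OF assms(1,3)]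
  by (simp add: \<tau>_def sigma_add assms distrib_left)

lemma tau_cmult:
  assumes "\<phi> \<in> test_functions I"
  shows "\<tau> (\<lambda>x. r * \<phi> x) = r * \<tau> \<phi>"
proof -
  have "(LINT x|lebesgue. (q x)\<^sup>2 / (4 * p x) * (r * \<phi> x)) = (LINT x|lebesgue. r * ((q x)\<^sup>2 / (4 * p x) * \<phi> x))"
    by (rule Bochner_Integration.integral_cong) auto
  also have "\<dots> = r * (LINT x|lebesgue. (q x)\<^sup>2 / (4 * p x) * \<phi> x)"
    by (rule integral_mult_right_zero)
  finally show ?thesis
    by (simp add: \<tau>_def sigma_cmult[OF assms] distrib_left)
qed

lemma reduced_form_eq: "reduced_form h = (LINT x|lebesgue. p x * (vderiv h x)\<^sup>2) - \<tau> (\<lambda>x. (h x)\<^sup>2)"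
  by (simp add: reduced_form_def \<tau>_def)

lemma test_fun_divide_shifted:
  fixes \<phi> \<psi> :: "real \<Rightarrow> real"
  assumes phi: "\<phi> \<in> test_functions I" and psi: "\<psi> \<in> test_functions I" "\<And>x. 0 \<le> \<psi> x"
    and \<delta>: "0 < \<delta>" and r: "0 < r"
  shows "(\<lambda>x. \<phi> x / (r * (\<psi> x + \<delta>))) \<in> test_functions I"
proof -
  have "smooth_on UNIV (\<lambda>x. 1 / (r * (\<psi> x + \<delta>)))"
  proof (rule smooth_on_divide[OF open_UNIV smooth_on_const])
    show "smooth_on UNIV (\<lambda>x. r * (\<psi> x + \<delta>))"
      by (intro smooth_on_mult smooth_on_add smooth_on_const open_UNIV test_fun_smooth[OF psi(1)])
    show "r * (\<psi> x + \<delta>) \<noteq> 0" for x using psi(2)[of x] \<delta> r by simp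
  qed
  from test_fun_mult(2)[OF this phi] show ?thesis by simp
qed

text \<open>
  The reduced form at \<open>h = sqrt (\<psi> + \<delta> \<kappa>\<^sup>2)\<close>. The gain is that the potential now acts linearly on an
  arbitrary nonnegative \<open>\<psi>\<close>, while the energy density \<open>h'\<^sup>2\<close> splits into \<open>\<psi>'\<^sup>2 / (4 (\<psi> + \<delta>))\<close>, a convex
  function of the pair \<open>(\<psi>, \<psi>')\<close>, and a contribution of the cutoff that is of order \<open>\<delta>\<close>.
\<close>

lemma shifted_energy_bound:
  assumes qp: "sq_quotient_L1_loc I q p"
    and red: "\<And>h. h \<in> test_functions I \<Longrightarrow> 0 \<le> reduced_form h"
    and K: "closed K" and k: "\<kappa> \<in> test_functions I" "\<And>x. 0 \<le> \<kappa> x" "\<And>x. x \<in> K \<Longrightarrow> \<kappa> x = 1" "\<And>x. x \<in> K \<Longrightarrow> vderiv \<kappa> x = 0"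
    and psi: "\<psi> \<in> test_functions I" "\<And>x. 0 \<le> \<psi> x" "\<And>x. x \<notin> K \<Longrightarrow> \<psi> x = 0"
    and \<delta>: "0 < \<delta>"
  shows "- (\<delta> * reduced_form \<kappa>) \<le> (LINT x|lebesgue. p x * ((vderiv \<psi> x)\<^sup>2 / (4 * (\<psi> x + \<delta>)))) - \<tau> \<psi>"
proof -
  define h where "h x = sqrt (\<psi> x + \<delta> * (\<kappa> x)\<^sup>2)" for x
  have k2: "(\<lambda>x. (\<kappa> x)\<^sup>2) \<in> test_functions I" by (rule test_fun_power2[OF k(1)])
  have dk2: "(\<lambda>x. \<delta> * (\<kappa> x)\<^sup>2) \<in> test_functions I" by (rule test_fun_cmult[OF k2])
  have t: "(\<lambda>x. \<psi> x + \<delta> * (\<kappa> x)\<^sup>2) \<in> test_functions I" by (rule test_fun_add[OF psi(1) dk2])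
  have off: "h x = sqrt \<delta> * \<kappa> x" if "x \<notin> K" for x
    using psi(3)[OF that] k(2)[of x] by (simp add: h_def real_sqrt_mult)
  have "smooth_on UNIV h"
    unfolding h_def[abs_def]
  proof (rule smooth_on_sqrt_glue[OF test_fun_smooth[OF t] test_fun_smooth[OF test_fun_cmult[OF k(1)]] K])
    show "0 < \<psi> x + \<delta> * (\<kappa> x)\<^sup>2" if "x \<in> K" for x
      using psi(2)[of x] k(3)[OF that] \<delta> by simp
    show "sqrt (\<psi> x + \<delta> * (\<kappa> x)\<^sup>2) = sqrt \<delta> * \<kappa> x" if "x \<notin> K" for x
      using off[OF that] by (simp add: h_def)
  qed
  moreover obtain L where "compact L" "L \<subseteq> I" "\<And>x. x \<notin> L \<Longrightarrow> \<psi> x + \<delta> * (\<kappa> x)\<^sup>2 = 0"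
    using test_fun_support[OF t] by metis
  ultimately have h: "h \<in> test_functions I"
    by (intro test_functionsI[of _ L]) (auto simp: h_def)
  have h2: "(h x)\<^sup>2 = \<psi> x + \<delta> * (\<kappa> x)\<^sup>2" for x
    using psi(2)[of x] \<delta> by (simp add: h_def)
  have dh2: "(vderiv h x)\<^sup>2 = (vderiv \<psi> x)\<^sup>2 / (4 * (\<psi> x + \<delta>)) + \<delta> * (vderiv \<kappa> x)\<^sup>2" for x
  proof (cases "x \<in> K")
    case True
    have "(\<lambda>x. (h x)\<^sup>2) = (\<lambda>x. \<psi> x + \<delta> * (\<kappa> x)\<^sup>2)" using h2 by auto
    then have "2 * h x * vderiv h x = vderiv \<psi> x + \<delta> * (2 * \<kappa> x * vderiv \<kappa> x)"
      using vderiv_power2[OF h, of x] vderiv_power2[OF k(1), of x]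
      by (simp add: vderiv_add[OF psi(1) dk2] vderiv_cmult[OF k2])
    then have "(2 * h x * vderiv h x)\<^sup>2 = (vderiv \<psi> x)\<^sup>2" using k(4)[OF True] by simp
    then have eq: "4 * (\<psi> x + \<delta>) * (vderiv h x)\<^sup>2 = (vderiv \<psi> x)\<^sup>2"
      using h2[of x] k(3)[OF True] by (simp add: power_mult_distrib)
    have pos: "0 < \<psi> x + \<delta>" using psi(2)[of x] \<delta> by simp
    have "(vderiv \<psi> x)\<^sup>2 / (4 * (\<psi> x + \<delta>)) = (vderiv h x)\<^sup>2"
      unfolding eq[symmetric] using pos by simp
    then show ?thesis using k(4)[OF True] by simp
  next
    case False
    have "vderiv h x = sqrt \<delta> * vderiv \<kappa> x"
    proof (rule vderiv_eqI)
      have "((\<lambda>x. sqrt \<delta> * \<kappa> x) has_vector_derivative sqrt \<delta> * vderiv \<kappa> x) (at x)"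
        by (rule has_vector_derivative_mult_right[OF test_fun_deriv[OF k(1)]])
      then show "(h has_vector_derivative sqrt \<delta> * vderiv \<kappa> x) (at x)"
        by (rule has_vector_derivative_transform_within_open[where S = "- K"]) (use K False off in auto)
    qed
    then show ?thesis
      using vderiv_eq_0_off_support[OF K psi(3) False] \<delta> by (simp add: power_mult_distrib)
  qed
  have gs: "(\<lambda>x. (vderiv \<psi> x)\<^sup>2 / (4 * (\<psi> x + \<delta>))) \<in> test_functions I"
    by (intro test_fun_divide_shifted test_fun_power2 test_fun_vderiv psi \<delta>) simp
  have i1: "integrable lebesgue (\<lambda>x. p x * ((vderiv \<psi> x)\<^sup>2 / (4 * (\<psi> x + \<delta>))))"
    by (rule L1_loc_integrable_test[OF p gs])
  have i2: "integrable lebesgue (\<lambda>x. p x * (vderiv \<kappa> x)\<^sup>2)"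
    by (rule L1_loc_integrable_test[OF p test_fun_power2[OF test_fun_vderiv[OF k(1)]]])
  have "(LINT x|lebesgue. p x * (vderiv h x)\<^sup>2)
      = (LINT x|lebesgue. p x * ((vderiv \<psi> x)\<^sup>2 / (4 * (\<psi> x + \<delta>))) + \<delta> * (p x * (vderiv \<kappa> x)\<^sup>2))"
    unfolding dh2 by (simp add: distrib_left mult.left_commute)
  also have "\<dots> = (LINT x|lebesgue. p x * ((vderiv \<psi> x)\<^sup>2 / (4 * (\<psi> x + \<delta>)))) + \<delta> * (LINT x|lebesgue. p x * (vderiv \<kappa> x)\<^sup>2)"
    using i1 i2 by simp
  finally have "reduced_form h = (LINT x|lebesgue. p x * ((vderiv \<psi> x)\<^sup>2 / (4 * (\<psi> x + \<delta>)))) - \<tau> \<psi> + \<delta> * reduced_form \<kappa>"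
    by (simp add: reduced_form_eq h2 tau_add[OF qp psi(1) dk2] tau_cmult[OF k2] right_diff_distrib)
  then show ?thesis using red[OF h] by simp
qed

text \<open>
  The convex functional \<open>\<Phi> \<psi> = \<integral> p \<psi>'\<^sup>2 / (4 (\<psi> + \<delta>)) - \<tau> \<psi>\<close> is almost nonnegative. At a minimiser
  \<open>\<psi>\<close> over a convex set, the derivative of \<open>\<Phi>\<close> towards any other element \<open>\<zeta>\<close> is nonnegative. Written out with
  \<open>g = \<psi>' / (2 (\<psi> + \<delta>))\<close>, the logarithmic derivative of \<open>h = sqrt (\<psi> + \<delta>)\<close>, the part of this derivative that depends on
  \<open>\<zeta>\<close> is \<open>W \<zeta> - \<tau> \<zeta>\<close>, where \<open>W \<zeta> = \<integral> p (g \<zeta>' - g\<^sup>2 \<zeta>)\<close>, and the rest is the negative of \<open>W \<psi> - \<tau> \<psi>\<close>,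
  which is at least \<open>\<Phi> \<psi>\<close>. So one function \<open>g\<close> serves all \<open>\<zeta>\<close> simultaneously.

  A near-minimiser is enough. If \<open>\<Phi> \<psi>\<close> is within \<open>\<epsilon>\<^sup>2\<close> of the infimum, a step of length \<open>\<epsilon>\<close> towards \<open>\<zeta>\<close>
  shows that the derivative exceeds \<open>- \<epsilon> (1 + R)\<close>, where \<open>\<epsilon>\<^sup>2 R\<close> bounds the second-order remainder
  uniformly over the convex set \<open>V\<close>.
\<close>

lemma approximate_supersolution:
  assumes pos: "AE x\<in>I in lebesgue. 0 \<le> p x" and qp: "sq_quotient_L1_loc I q p"
    and red: "\<And>h. h \<in> test_functions I \<Longrightarrow> 0 \<le> reduced_form h"
    and K: "compact K" "K \<subseteq> I"
    and F: "finite F" "F \<subseteq> test_functions I" "\<And>\<phi> x. \<phi> \<in> F \<Longrightarrow> 0 \<le> \<phi> x" "\<And>\<phi> x. \<phi> \<in> F \<Longrightarrow> x \<notin> K \<Longrightarrow> \<phi> x = 0"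
    and e: "0 < e"
  shows "\<exists>g\<in>test_functions I. \<forall>\<phi>\<in>F. \<tau> \<phi> - e \<le> (LINT x|lebesgue. p x * (g x * vderiv \<phi> x - (g x)\<^sup>2 * \<phi> x))"
proof -
  obtain \<kappa> :: "real \<Rightarrow> real" where k: "\<kappa> \<in> test_functions I" "\<And>x. 0 \<le> \<kappa> x" "\<And>x. x \<in> K \<Longrightarrow> \<kappa> x = 1" "\<And>x. x \<in> K \<Longrightarrow> vderiv \<kappa> x = 0"
    using cutoff_function[OF open_I interval_I K] by metis
  obtain B where B: "0 < B" "\<And>\<phi> x. \<phi> \<in> F \<Longrightarrow> \<bar>\<phi> x\<bar> \<le> B" "\<And>\<phi> x. \<phi> \<in> F \<Longrightarrow> \<bar>vderiv \<phi> x\<bar> \<le> B"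
    using finite_test_fun_bounded[OF F(1,2)] by metis
  define E where "E = reduced_form \<kappa>"
  have E: "0 \<le> E" using red[OF k(1)] by (simp add: E_def)
  \<comment> \<open>half of the tolerance \<open>e\<close> pays for the shift, the other half for the error of the minimisation\<close>
  define \<delta> where "\<delta> = e / (2 * (E + 1))"
  have \<delta>: "0 < \<delta>" using e E by (simp add: \<delta>_def)
  have \<delta>E: "\<delta> * E \<le> e / 2"
  proof -
    have "\<delta> * E \<le> \<delta> * (E + 1)" using \<delta> by simp
    also have "\<dots> = e / 2"
    proof -
      have "E + 1 \<noteq> 0" using E by linarith
      then show ?thesis unfolding \<delta>_def by (simp del: distrib_left_numeral)
    qed
    finally show ?thesis .
  qed
  \<comment> \<open>\<open>C\<close> bounds the second-order remainder of the energy density on \<open>K\<close>, given the bounds that define \<open>V\<close>\<close>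
  define C where "C = (2 * B + B\<^sup>2 / \<delta>)\<^sup>2 / (4 * \<delta>)"
  have C: "0 \<le> C" using \<delta> by (simp add: C_def)
  define R where "R = C * (LINT x|lebesgue. p x * indicator K x)"
  have iK: "integrable lebesgue (\<lambda>x. p x * indicator K x)"
    by (rule L1_loc_integrable_mult[OF p K
          borel_measurable_indicator[OF fmeasurableD[OF lmeasurable_compact[OF K(1)]]], of 1])
      (auto simp: indicator_def)
  have R: "0 \<le> R"
  proof -
    have "0 \<le> (LINT x|lebesgue. p x * indicator K x)"
      using pos by (intro integral_nonneg_AE) (auto elim!: eventually_mono simp: indicator_def subsetD[OF K(2)])
    then show ?thesis using C by (simp add: R_def)
  qed
  define \<epsilon> where "\<epsilon> = min 1 (e / (2 * (1 + R)))"
  have \<epsilon>: "0 < \<epsilon>" "\<epsilon> \<le> 1" using e R by (auto simp: \<epsilon>_def)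
  have \<epsilon>R: "\<epsilon> * (1 + R) \<le> e / 2"
  proof -
    have "\<epsilon> * (1 + R) \<le> e / (2 * (1 + R)) * (1 + R)"
      using R by (intro mult_right_mono) (auto simp: \<epsilon>_def)
    also have "\<dots> = e / 2"
    proof -
      have "1 + R \<noteq> 0" using R by linarith
      then show ?thesis by (simp del: distrib_left_numeral)
    qed
    finally show ?thesis .
  qed
  define V where "V = {\<psi> \<in> test_functions I. (\<forall>x. 0 \<le> \<psi> x \<and> \<psi> x \<le> B \<and> \<bar>vderiv \<psi> x\<bar> \<le> B) \<and> (\<forall>x. x \<notin> K \<longrightarrow> \<psi> x = 0)}"
  define en where "en \<psi> x = (vderiv \<psi> x)\<^sup>2 / (4 * (\<psi> x + \<delta>))" for \<psi> :: "real \<Rightarrow> real" and x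
  define \<Phi> where "\<Phi> \<psi> = (LINT x|lebesgue. p x * en \<psi> x) - \<tau> \<psi>"
    for \<psi> :: "real \<Rightarrow> real"
  have Vt: "\<psi> \<in> test_functions I" "0 \<le> \<psi> x" "\<psi> x \<le> B" "\<bar>vderiv \<psi> x\<bar> \<le> B" "x \<notin> K \<Longrightarrow> \<psi> x = 0"
    if "\<psi> \<in> V" for \<psi> x using that by (auto simp: V_def)
  have \<Phi>: "- (\<delta> * E) \<le> \<Phi> \<psi>" if "\<psi> \<in> V" for \<psi>
    unfolding \<Phi>_def E_def en_def
    by (rule shifted_energy_bound[OF qp red compact_imp_closed[OF K(1)] k]) (use Vt[OF that] \<delta> in auto)
  have vd0: "vderiv (\<lambda>x. 0::real) = (\<lambda>x. 0)" by (intro ext vderiv_eqI) simp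
  have "(\<lambda>x. 0) \<in> V" using B(1) by (simp add: V_def test_fun_zero vd0)
  then have ne: "\<Phi> ` V \<noteq> {}" by blast
  have bdd: "bdd_below (\<Phi> ` V)" using \<Phi> by (auto intro!: bdd_belowI)
  have "Inf (\<Phi> ` V) < Inf (\<Phi> ` V) + \<epsilon>\<^sup>2" using \<epsilon> by simp
  from cInf_lessD[OF ne this] obtain \<psi> where \<psi>: "\<psi> \<in> V" "\<Phi> \<psi> < Inf (\<Phi> ` V) + \<epsilon>\<^sup>2" by blast
  define g where "g x = vderiv \<psi> x / (2 * (\<psi> x + \<delta>))" for x
  have g: "g \<in> test_functions I"
    unfolding g_def[abs_def]
    by (intro test_fun_divide_shifted test_fun_vderiv Vt[OF \<psi>(1)] \<delta>) simp
  define W where "W \<zeta> = (LINT x|lebesgue. p x * (g x * vderiv \<zeta> x - (g x)\<^sup>2 * \<zeta> x))" for \<zeta> :: "real \<Rightarrow> real"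
  let ?w = "\<lambda>\<zeta> x. p x * (g x * vderiv \<zeta> x - (g x)\<^sup>2 * \<zeta> x)"
  have iW: "integrable lebesgue (\<lambda>x. ?w \<zeta> x)" if "\<zeta> \<in> test_functions I" for \<zeta>
    by (intro L1_loc_integrable_test[OF p] test_fun_diff test_fun_mult' test_fun_power2 g
        test_fun_vderiv that)
  have iE: "integrable lebesgue (\<lambda>x. p x * en \<zeta> x)" if "\<zeta> \<in> V" for \<zeta>
    unfolding en_def
    by (intro L1_loc_integrable_test[OF p] test_fun_divide_shifted test_fun_power2
        test_fun_vderiv Vt[OF that] \<delta>) simp
  have posy: "0 < \<psi> x + \<delta>" for x using Vt(2)[OF \<psi>(1), of x] \<delta> by simp
  have en\<psi>: "en \<psi> x = (g x)\<^sup>2 * (\<psi> x + \<delta>)" for x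
    unfolding en_def g_def using posy[of x] by (intro half_quotient_power2[symmetric]) simp
  have W\<psi>: "- (e / 2) \<le> W \<psi> - \<tau> \<psi>"
  proof -
    have "(LINT x|lebesgue. p x * en \<psi> x) \<le> W \<psi>"
      unfolding W_def
    proof (rule integral_mono_AE[OF iE[OF \<psi>(1)] iW[OF Vt(1)[OF \<psi>(1)]]])
      show "AE x in lebesgue. p x * en \<psi> x
          \<le> ?w \<psi> x"
        using pos
      proof eventually_elim
        case (elim x)
        show ?case
        proof (cases "x \<in> I")
          case True
          have v: "vderiv \<psi> x = 2 * g x * (\<psi> x + \<delta>)"
            unfolding g_def using posy[of x] by (intro double_half_quotient[symmetric]) simp
          have "en \<psi> x \<le> g x * vderiv \<psi> x - (g x)\<^sup>2 * \<psi> x"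
            unfolding en\<psi> v using \<delta> by (simp add: power2_eq_square algebra_simps)
          then show ?thesis
            using elim True by (intro mult_left_mono) auto
        next
          case False
          then show ?thesis
            using test_fun_zero_off[OF Vt(1)[OF \<psi>(1)]]
              test_fun_zero_off[OF test_fun_vderiv[OF Vt(1)[OF \<psi>(1)]]] by (simp add: en_def)
        qed
      qed
    qed
    then show ?thesis using \<Phi>[OF \<psi>(1)] \<delta>E by (simp add: \<Phi>_def)
  qed
  have main: "\<tau> \<zeta> - e \<le> W \<zeta>" if \<zeta>: "\<zeta> \<in> V" for \<zeta>
  proof -
    define \<nu> where "\<nu> x = (1 - \<epsilon>) * \<psi> x + \<epsilon> * \<zeta> x" for x
    have t: "(\<lambda>x. (1 - \<epsilon>) * \<psi> x) \<in> test_functions I" "(\<lambda>x. \<epsilon> * \<zeta> x) \<in> test_functions I"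
      by (intro test_fun_cmult Vt[OF \<psi>(1)] Vt[OF \<zeta>])+
    have vd: "vderiv \<nu> x = (1 - \<epsilon>) * vderiv \<psi> x + \<epsilon> * vderiv \<zeta> x" for x
      unfolding \<nu>_def[abs_def] vderiv_add[OF t] vderiv_cmult[OF Vt(1)[OF \<psi>(1)]] vderiv_cmult[OF Vt(1)[OF \<zeta>]] ..
    have conv: "(1 - \<epsilon>) * s + \<epsilon> * r \<le> B" if "s \<le> B" "r \<le> B" for s r
    proof -
      have "(1 - \<epsilon>) * s + \<epsilon> * r \<le> (1 - \<epsilon>) * B + \<epsilon> * B"
        using that \<epsilon> by (intro add_mono mult_left_mono) auto
      then show ?thesis by (simp add: algebra_simps)
    qed
    have \<nu>: "\<nu> \<in> V"
      unfolding V_def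
    proof (intro CollectI conjI allI impI)
      show "\<nu> \<in> test_functions I" unfolding \<nu>_def[abs_def] by (rule test_fun_add[OF t])
      fix x
      show "0 \<le> \<nu> x" using Vt(2)[OF \<psi>(1), of x] Vt(2)[OF \<zeta>, of x] \<epsilon> by (simp add: \<nu>_def)
      show "\<nu> x \<le> B" unfolding \<nu>_def using Vt(3)[OF \<psi>(1), of x] Vt(3)[OF \<zeta>, of x] by (rule conv)
      show "\<nu> x = 0" if "x \<notin> K" using that Vt(5)[OF \<psi>(1), of x] Vt(5)[OF \<zeta>, of x] by (simp add: \<nu>_def)
      have "\<bar>vderiv \<nu> x\<bar> \<le> (1 - \<epsilon>) * \<bar>vderiv \<psi> x\<bar> + \<epsilon> * \<bar>vderiv \<zeta> x\<bar>"
        unfolding vd using \<epsilon> by (intro order_trans[OF abs_triangle_ineq]) (simp add: abs_mult)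
      also have "\<dots> \<le> B" using Vt(4)[OF \<psi>(1), of x] Vt(4)[OF \<zeta>, of x] by (rule conv)
      finally show "\<bar>vderiv \<nu> x\<bar> \<le> B" .
    qed
    have "\<Phi> \<psi> - \<epsilon>\<^sup>2 < \<Phi> \<nu>"
      using \<psi>(2) cInf_lower[OF imageI[OF \<nu>] bdd] by linarith
    moreover have "(LINT x|lebesgue. p x * en \<nu> x) \<le>
      (LINT x|lebesgue. p x * en \<psi> x) + \<epsilon> * (W \<zeta> - W \<psi>) + \<epsilon>\<^sup>2 * R"
    proof -
      have point: "en \<nu> x \<le> en \<psi> x +
          \<epsilon> * ((g x * vderiv \<zeta> x - (g x)\<^sup>2 * \<zeta> x) - (g x * vderiv \<psi> x - (g x)\<^sup>2 * \<psi> x)) + \<epsilon>\<^sup>2 * (C * indicator K x)" for x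
      proof -
        define y where "y = \<psi> x + \<delta>"
        define \<eta> where "\<eta> = \<zeta> x - \<psi> x"
        define \<omega> where "\<omega> = vderiv \<zeta> x - vderiv \<psi> x"
        have y: "0 < y" using posy by (simp add: y_def)
        have "2 * g x * y = vderiv \<psi> x"
          unfolding g_def y_def using posy[of x] by (intro double_half_quotient) simp
        then have v: "vderiv \<psi> x = 2 * y * g x" by (simp add: mult_ac)
        have y': "\<nu> x + \<delta> = y + \<epsilon> * \<eta>" by (simp add: \<nu>_def y_def \<eta>_def algebra_simps)
        have dy: "\<delta> \<le> y + \<epsilon> * \<eta>" using Vt(2)[OF \<nu>, of x] y' by linarith
        then have y'0: "0 < y + \<epsilon> * \<eta>" using \<delta> by linarith
        have v': "vderiv \<nu> x = 2 * y * g x + \<epsilon> * \<omega>"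
          unfolding vd \<omega>_def v by (simp add: algebra_simps)
        have "en \<nu> x = (2 * y * g x + \<epsilon> * \<omega>)\<^sup>2 / (4 * (y + \<epsilon> * \<eta>))"
          unfolding en_def v' y' ..
        \<comment> \<open>the exact second-order Taylor expansion of \<open>v\<^sup>2 / (4 y)\<close>\<close>
        also have "(2 * y * g x + \<epsilon> * \<omega>)\<^sup>2 =
            ((g x)\<^sup>2 * y + \<epsilon> * (g x * \<omega> - (g x)\<^sup>2 * \<eta>)) * (4 * (y + \<epsilon> * \<eta>)) + \<epsilon>\<^sup>2 * (\<omega> - 2 * g x * \<eta>)\<^sup>2"
          by (simp add: power2_eq_square algebra_simps)
        also have "\<dots> / (4 * (y + \<epsilon> * \<eta>)) =
            (g x)\<^sup>2 * y + \<epsilon> * (g x * \<omega> - (g x)\<^sup>2 * \<eta>) + \<epsilon>\<^sup>2 * ((\<omega> - 2 * g x * \<eta>)\<^sup>2 / (4 * (y + \<epsilon> * \<eta>)))"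
          using y'0 by (simp add: add_divide_distrib)
        also have "(\<omega> - 2 * g x * \<eta>)\<^sup>2 / (4 * (y + \<epsilon> * \<eta>)) \<le> C * indicator K x"
        proof (cases "x \<in> K")
          case True
          have "\<bar>\<omega>\<bar> \<le> 2 * B" using Vt(4)[OF \<psi>(1), of x] Vt(4)[OF \<zeta>, of x] unfolding \<omega>_def by linarith
          moreover have "\<bar>\<eta>\<bar> \<le> B"
            using Vt(2,3)[OF \<psi>(1), of x] Vt(2,3)[OF \<zeta>, of x] unfolding \<eta>_def by linarith
          moreover have "\<bar>g x\<bar> \<le> B / (2 * \<delta>)"
            using Vt(4)[OF \<psi>(1), of x] Vt(2)[OF \<psi>(1), of x] \<delta> posy[of x] unfolding g_def
            by (simp add: abs_divide) (intro frac_le; simp)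
          ultimately have "\<bar>\<omega>\<bar> + 2 * (\<bar>g x\<bar> * \<bar>\<eta>\<bar>) \<le> 2 * B + 2 * (B / (2 * \<delta>) * B)"
            using B(1) \<delta> by (intro add_mono mult_left_mono mult_mono) auto
          then have "\<bar>\<omega> - 2 * g x * \<eta>\<bar> \<le> 2 * B + B\<^sup>2 / \<delta>"
            using abs_triangle_ineq4[of \<omega> "2 * g x * \<eta>"] by (simp add: abs_mult power2_eq_square)
          then have "(\<omega> - 2 * g x * \<eta>)\<^sup>2 \<le> (2 * B + B\<^sup>2 / \<delta>)\<^sup>2"
            by (metis abs_ge_zero power2_abs power_mono)
          then have "(\<omega> - 2 * g x * \<eta>)\<^sup>2 / (4 * (y + \<epsilon> * \<eta>)) \<le> C"
            unfolding C_def using dy \<delta> by (intro frac_le) auto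
          then show ?thesis using True by simp
        next
          case False
          have "\<omega> = 0"
            using vderiv_eq_0_off_support[OF compact_imp_closed[OF K(1)] Vt(5)[OF \<psi>(1)] False]
              vderiv_eq_0_off_support[OF compact_imp_closed[OF K(1)] Vt(5)[OF \<zeta>] False] by (simp add: \<omega>_def)
          moreover have "\<eta> = 0" using Vt(5)[OF \<psi>(1) False] Vt(5)[OF \<zeta> False] by (simp add: \<eta>_def)
          ultimately show ?thesis using False by simp
        qed
        finally have "en \<nu> x \<le>
            (g x)\<^sup>2 * y + \<epsilon> * (g x * \<omega> - (g x)\<^sup>2 * \<eta>) + \<epsilon>\<^sup>2 * (C * indicator K x)"
          by (simp add: mult_left_mono)
        moreover have "g x * \<omega> - (g x)\<^sup>2 * \<eta> = (g x * vderiv \<zeta> x - (g x)\<^sup>2 * \<zeta> x) - (g x * vderiv \<psi> x - (g x)\<^sup>2 * \<psi> x)"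
          by (simp add: \<omega>_def \<eta>_def algebra_simps)
        ultimately show ?thesis by (simp add: en\<psi> y_def)
      qed
      have eq: "p x * (en \<psi> x +
          \<epsilon> * ((g x * vderiv \<zeta> x - (g x)\<^sup>2 * \<zeta> x) - (g x * vderiv \<psi> x - (g x)\<^sup>2 * \<psi> x)) + \<epsilon>\<^sup>2 * (C * indicator K x))
        = p x * en \<psi> x +
          \<epsilon> * (?w \<zeta> x - ?w \<psi> x)
          + \<epsilon>\<^sup>2 * (C * (p x * indicator K x))" for x
        by (simp only: distrib_left right_diff_distrib mult.left_commute[of "p x"])
      have "(LINT x|lebesgue. p x * en \<nu> x) \<le>
        (LINT x|lebesgue. p x * en \<psi> x +
          \<epsilon> * (?w \<zeta> x - ?w \<psi> x)
          + \<epsilon>\<^sup>2 * (C * (p x * indicator K x)))"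
      proof (rule integral_mono_AE[OF iE[OF \<nu>]])
        show "integrable lebesgue (\<lambda>x. p x * en \<psi> x +
          \<epsilon> * (?w \<zeta> x - ?w \<psi> x)
          + \<epsilon>\<^sup>2 * (C * (p x * indicator K x)))"
          by (intro Bochner_Integration.integrable_add Bochner_Integration.integrable_diff integrable_mult_right
              iE[OF \<psi>(1)] iW[OF Vt(1)[OF \<psi>(1)]] iW[OF Vt(1)[OF \<zeta>]] iK)
        show "AE x in lebesgue. p x * en \<nu> x \<le>
            p x * en \<psi> x +
          \<epsilon> * (?w \<zeta> x - ?w \<psi> x)
          + \<epsilon>\<^sup>2 * (C * (p x * indicator K x))"
          using pos
        proof eventually_elim
          case (elim x)
          show ?case
          proof (cases "x \<in> I")
            case True
            then show ?thesis unfolding eq[symmetric] using elim by (intro mult_left_mono point) auto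
          next
            case False
            note z = test_fun_zero_off[OF Vt(1) False] test_fun_zero_off[OF test_fun_vderiv[OF Vt(1)] False]
            show ?thesis
              using False K(2) z[OF \<nu>] z[OF \<psi>(1)] z[OF \<zeta>] by (auto simp: en_def indicator_def)
          qed
        qed
      qed
      also have "\<dots> = (LINT x|lebesgue. p x * en \<psi> x) + \<epsilon> * (W \<zeta> - W \<psi>) + \<epsilon>\<^sup>2 * R"
        unfolding W_def R_def using iE[OF \<psi>(1)] iW[OF Vt(1)[OF \<psi>(1)]] iW[OF Vt(1)[OF \<zeta>]] iK by simp
      finally show ?thesis .
    qed
    moreover have "\<tau> \<nu> = \<tau> \<psi> + \<epsilon> * (\<tau> \<zeta> - \<tau> \<psi>)"
      unfolding \<nu>_def[abs_def] tau_add[OF qp t] tau_cmult[OF Vt(1)[OF \<psi>(1)]] tau_cmult[OF Vt(1)[OF \<zeta>]]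
      by (simp add: algebra_simps)
    ultimately have "0 < \<epsilon>\<^sup>2 + \<epsilon> * (W \<zeta> - W \<psi>) + \<epsilon>\<^sup>2 * R - \<epsilon> * (\<tau> \<zeta> - \<tau> \<psi>)"
      unfolding \<Phi>_def by linarith
    also have "\<dots> = \<epsilon> * (\<epsilon> * (1 + R) + (W \<zeta> - W \<psi>) - (\<tau> \<zeta> - \<tau> \<psi>))"
      by (simp add: power2_eq_square algebra_simps)
    finally have "0 < \<epsilon> * (1 + R) + (W \<zeta> - W \<psi>) - (\<tau> \<zeta> - \<tau> \<psi>)"
      using \<epsilon>(1) by (simp add: zero_less_mult_iff)
    then show ?thesis using \<epsilon>R W\<psi> by linarith
  qed
  have "\<phi> \<in> V" if "\<phi> \<in> F" for \<phi>
    unfolding V_def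
  proof (intro CollectI conjI allI impI)
    show "\<phi> \<in> test_functions I" using F(2) that by blast
    show "0 \<le> \<phi> x" for x by (rule F(3)[OF that])
    show "\<phi> x \<le> B" for x using B(2)[OF that, of x] by simp
    show "\<bar>vderiv \<phi> x\<bar> \<le> B" for x by (rule B(3)[OF that])
    show "\<phi> x = 0" if "x \<notin> K" for x by (rule F(4)[OF \<open>\<phi> \<in> F\<close> that])
  qed
  then show ?thesis
    using g main unfolding W_def by (intro bexI[of _ g] ballI) auto
qed

end

section \<open>A global solution of the Riccati inequality\<close>

definition loc_square_integrable :: "real set \<Rightarrow> (real \<Rightarrow> real) \<Rightarrow> bool" where
  "loc_square_integrable I g \<longleftrightarrow> g \<in> borel_measurable lebesgue \<and>
    (\<forall>K. compact K \<and> K \<subseteq> I \<longrightarrow> integrable lebesgue (\<lambda>x. indicator K x * (g x)\<^sup>2))"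

lemma loc_square_integrable_test:
  fixes \<phi> :: "real \<Rightarrow> real"
  assumes "\<phi> \<in> test_functions I"
  shows "loc_square_integrable I \<phi>"
proof -
  have "integrable lebesgue (\<lambda>x. indicator K x * (\<phi> x)\<^sup>2)" if K: "compact K" for K
  proof -
    have "(\<lambda>x. 1::real) absolutely_integrable_on L" if "compact L" for L :: "real set"
      using that by (simp add: lmeasurable_iff_integrable[symmetric] set_integrable_def lmeasurable_compact)
    then have "(\<lambda>x. 1) \<in> L1_loc I" by (simp add: L1_loc_def)
    then have "integrable lebesgue (\<lambda>x. 1 * (\<phi> x)\<^sup>2)"
      by (rule L1_loc_integrable_test[OF _ test_fun_power2[OF assms]])
    from integrable_mult_indicator[OF fmeasurableD[OF lmeasurable_compact[OF K]] this] show ?thesis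
      by simp
  qed
  then show ?thesis
    using continuous_borel_lebesgue[OF test_fun_continuous[OF assms]]
    by (simp add: loc_square_integrable_def)
qed

text \<open>
  The bounds available on the members \<open>K n\<close> of an exhaustion grow with \<open>n\<close>. A weight that equals
  \<open>c n\<close> at the points that appear first in \<open>K n\<close> turns them into one bound of a weighted norm, and being bounded away from
  zero on each \<open>K n\<close> it controls local \<open>L\<^sup>2\<close> norms.
\<close>

lemma exhaustion_weight:
  fixes K :: "nat \<Rightarrow> real set"
  assumes K: "\<And>n. compact (K n)" "\<Union>(range K) = I" "\<And>n. K n \<subseteq> K (Suc n)" and c: "\<And>n. 0 < c n"
  obtains w :: "real \<Rightarrow> real" where "w \<in> borel_measurable lebesgue" "\<And>x. 0 \<le> w x"
    "\<And>n. \<exists>d>0. \<forall>x\<in>K n. d \<le> w x"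
    "\<And>n x. x \<in> K n \<Longrightarrow> w x \<le> (\<Sum>k\<le>n. c k * indicator (K k) x)"
proof -
  define rank where "rank x = (LEAST n. x \<in> K n)" for x
  define w where "w x = c (rank x)" for x
  have "Measurable.pred lebesgue (\<lambda>x. x \<in> K n)" for n
    using fmeasurableD[OF lmeasurable_compact[OF K(1)[of n]]] by (simp add: pred_def)
  then have "rank \<in> measurable lebesgue (count_space UNIV)"
    unfolding rank_def[abs_def] by (rule measurable_Least)
  then have "w \<in> borel_measurable lebesgue"
    unfolding w_def[abs_def] by (rule measurable_compose) simp
  moreover have "\<exists>d>0. \<forall>x\<in>K n. d \<le> w x" for n
  proof (intro exI[of _ "Min (c ` {..n})"] conjI ballI)
    show "0 < Min (c ` {..n})" using c by (subst Min_gr_iff) auto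
    fix x assume "x \<in> K n"
    then have "rank x \<le> n" unfolding rank_def by (rule Least_le)
    then show "Min (c ` {..n}) \<le> w x" unfolding w_def by (intro Min_le) auto
  qed
  moreover have "w x \<le> (\<Sum>k\<le>n. c k * indicator (K k) x)" if x: "x \<in> K n" for n x
  proof -
    have r: "rank x \<le> n" unfolding rank_def using x by (rule Least_le)
    have "x \<in> K (rank x)" unfolding rank_def using x by (rule LeastI)
    then have "w x = c (rank x) * indicator (K (rank x)) x" by (simp add: w_def)
    also have "\<dots> \<le> (\<Sum>k\<le>n. c k * indicator (K k) x)"
      using r c by (intro member_le_sum) (auto simp: indicator_def less_imp_le)
    finally show ?thesis .
  qed
  moreover have "0 \<le> w x" for x using c by (simp add: w_def less_imp_le)
  ultimately show ?thesis using that by blast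
qed

lemma sum_half_powers: "(\<Sum>k\<le>n. (1/2::real) ^ Suc k) \<le> 1"
proof -
  have "(\<Sum>k\<le>n. (1/2::real) ^ Suc k) = 1 - (1/2) ^ Suc n"
    by (induction n) (auto simp: field_simps)
  then show ?thesis by simp
qed

context divergence_form
begin

context
  fixes m M :: real
  assumes m: "0 < m" and pb: "AE x\<in>I in lebesgue. m \<le> p x \<and> p x \<le> M"
begin

lemma integrable_against_square_integrable:
  assumes g: "loc_square_integrable I g" and phi: "\<phi> \<in> test_functions I"
  shows "integrable lebesgue (\<lambda>x. p x * (g x * \<phi> x))" "integrable lebesgue (\<lambda>x. p x * ((g x)\<^sup>2 * \<phi> x))"
proof -
  obtain K where K: "compact K" "K \<subseteq> I" "\<And>x. x \<notin> K \<Longrightarrow> \<phi> x = 0"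
    using test_fun_support[OF phi] by metis
  obtain B where B: "0 < B" "\<And>x. norm (\<phi> x) \<le> B" using test_fun_bounded[OF phi] by metis
  have mg: "g \<in> borel_measurable lebesgue" using g by (simp add: loc_square_integrable_def)
  have iK: "integrable lebesgue (\<lambda>x. indicator K x * (1 + (g x)\<^sup>2))"
  proof -
    have "integrable lebesgue (\<lambda>x. indicator K x * (g x)\<^sup>2)"
      using g K by (simp add: loc_square_integrable_def)
    moreover have "integrable lebesgue (indicator K :: real \<Rightarrow> real)"
      using lmeasurable_compact[OF K(1)] by (simp add: lmeasurable_iff_integrable)
    ultimately show ?thesis by (simp add: distrib_left)
  qed
  have mp: "(\<lambda>x. indicator I x * p x) \<in> borel_measurable lebesgue"
    by (rule L1_loc_measurable[OF open_I p])
  have mphi: "\<phi> \<in> borel_measurable lebesgue"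
    by (rule continuous_borel_lebesgue[OF test_fun_continuous[OF phi]])
  have phiI: "indicator I x * \<phi> x = \<phi> x" for x
    using test_fun_zero_off[OF phi, of x] by (auto simp: indicator_def)
  have bound: "integrable lebesgue (\<lambda>x. p x * (u x * \<phi> x))"
    if u: "u \<in> borel_measurable lebesgue" "\<And>x. \<bar>u x\<bar> \<le> 1 + (g x)\<^sup>2" for u
  proof (rule Bochner_Integration.integrable_bound)
    show "integrable lebesgue (\<lambda>x. (M * B) * (indicator K x * (1 + (g x)\<^sup>2)))"
      using iK by simp
    have "(\<lambda>x. (indicator I x * p x) * (u x * \<phi> x)) \<in> borel_measurable lebesgue"
      by (intro borel_measurable_times mp u mphi)
    moreover have "(indicator I x * p x) * (u x * \<phi> x) = p x * (u x * \<phi> x)" for x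
      using phiI[of x] by (auto simp: indicator_def)
    ultimately show "(\<lambda>x. p x * (u x * \<phi> x)) \<in> borel_measurable lebesgue" by simp
    show "AE x in lebesgue. norm (p x * (u x * \<phi> x)) \<le> norm ((M * B) * (indicator K x * (1 + (g x)\<^sup>2)))"
      using pb
    proof eventually_elim
      case (elim x)
      show ?case
      proof (cases "x \<in> K")
        case True
        then have p: "0 \<le> p x" "p x \<le> M" using elim K(2) m by auto
        have "\<bar>p x * (u x * \<phi> x)\<bar> = p x * (\<bar>u x\<bar> * \<bar>\<phi> x\<bar>)" using p by (simp add: abs_mult)
        also have "\<dots> \<le> M * ((1 + (g x)\<^sup>2) * B)"
          using p B(2)[of x] u(2)[of x] by (intro mult_mono) auto
        also have "\<dots> = \<bar>(M * B) * (indicator K x * (1 + (g x)\<^sup>2))\<bar>"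
          using True p B(1) by (simp add: abs_mult mult_ac)
        finally show ?thesis by simp
      qed (simp add: K(3))
    qed
  qed
  show "integrable lebesgue (\<lambda>x. p x * (g x * \<phi> x))"
  proof (rule bound[OF mg])
    fix x
    have "0 \<le> (\<bar>g x\<bar> - 1)\<^sup>2" by simp
    then have "2 * \<bar>g x\<bar> \<le> 1 + (g x)\<^sup>2" by (simp add: power2_diff)
    then show "\<bar>g x\<bar> \<le> 1 + (g x)\<^sup>2" using abs_ge_zero[of "g x"] by linarith
  qed
  show "integrable lebesgue (\<lambda>x. p x * ((g x)\<^sup>2 * \<phi> x))"
    by (rule bound) (use mg in auto)
qed

text \<open>
  With \<open>f = - p g\<close> this is \<open>f' - f\<^sup>2 / p\<close> applied to \<open>\<phi>\<close>. It is a concave function of \<open>g\<close> if \<open>\<phi> \<ge> 0\<close>, so the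
  inequality \<open>\<tau> \<phi> \<le> dual_form g \<phi>\<close> describes a convex set of functions \<open>g\<close>.
\<close>

definition dual_form :: "(real \<Rightarrow> real) \<Rightarrow> (real \<Rightarrow> real) \<Rightarrow> real" where
  "dual_form g \<phi> = (LINT x|lebesgue. p x * (g x * vderiv \<phi> x - (g x)\<^sup>2 * \<phi> x))"

lemma integrable_dual_form:
  assumes g: "loc_square_integrable I g" and phi: "\<phi> \<in> test_functions I"
  shows "integrable lebesgue (\<lambda>x. p x * (g x * vderiv \<phi> x - (g x)\<^sup>2 * \<phi> x))"
  using integrable_against_square_integrable(1)[OF g test_fun_vderiv[OF phi]]
    integrable_against_square_integrable(2)[OF g phi]
  by (simp add: right_diff_distrib)

lemma dual_form_midpoint:
  assumes g: "loc_square_integrable I g" and h: "loc_square_integrable I h"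
    and gh: "loc_square_integrable I (\<lambda>x. (g x + h x) / 2)"
    and phi: "\<phi> \<in> test_functions I" "\<And>x. 0 \<le> \<phi> x"
  shows "(dual_form g \<phi> + dual_form h \<phi>) / 2 \<le> dual_form (\<lambda>x. (g x + h x) / 2) \<phi>"
proof -
  let ?d = "\<lambda>g x. p x * (g x * vderiv \<phi> x - (g x)\<^sup>2 * \<phi> x)"
  have "(LINT x|lebesgue. (1/2) * ?d g x + (1/2) * ?d h x)
      \<le> dual_form (\<lambda>x. (g x + h x) / 2) \<phi>"
    unfolding dual_form_def
  proof (rule integral_mono_AE)
    show "integrable lebesgue (\<lambda>x. (1/2) * ?d g x + (1/2) * ?d h x)"
      using integrable_dual_form[OF g phi(1)] integrable_dual_form[OF h phi(1)] by (intro Bochner_Integration.integrable_add integrable_mult_right)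
    show "integrable lebesgue (\<lambda>x. p x * ((g x + h x) / 2 * vderiv \<phi> x - ((g x + h x) / 2)\<^sup>2 * \<phi> x))"
      by (rule integrable_dual_form[OF gh phi(1)])
    show "AE x in lebesgue. (1/2) * ?d g x + (1/2) * ?d h x
       \<le> p x * ((g x + h x) / 2 * vderiv \<phi> x - ((g x + h x) / 2)\<^sup>2 * \<phi> x)"
      using pb
    proof eventually_elim
      case (elim x)
      show ?case
      proof (cases "x \<in> I")
        case True
        then have "0 \<le> p x" using elim m by auto
        then have "0 \<le> p x * \<phi> x * ((g x - h x) / 2)\<^sup>2" using phi(2)[of x] by simp
        also have "\<dots> = p x * ((g x + h x) / 2 * vderiv \<phi> x - ((g x + h x) / 2)\<^sup>2 * \<phi> x)
          - ((1/2) * ?d g x + (1/2) * ?d h x)"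
          by (simp add: power2_eq_square field_simps)
        finally show ?thesis by simp
      next
        case False
        then show ?thesis
          using test_fun_zero_off[OF phi(1)] test_fun_zero_off[OF test_fun_vderiv[OF phi(1)]] by simp
      qed
    qed
  qed
  then show ?thesis
    using integrable_dual_form[OF g phi(1)] integrable_dual_form[OF h phi(1)]
    by (simp add: dual_form_def)
qed

lemma dual_form_continuous:
  assumes s: "\<And>n. loc_square_integrable I (s n)" and g: "loc_square_integrable I g" and H: "loc_square_integrable I H"
    and dom: "AE x\<in>I in lebesgue. \<forall>n. \<bar>s n x\<bar> \<le> H x" and lim: "AE x\<in>I in lebesgue. (\<lambda>n. s n x) \<longlonglongrightarrow> g x"
    and phi: "\<phi> \<in> test_functions I"
  shows "(\<lambda>n. dual_form (s n) \<phi>) \<longlonglongrightarrow> dual_form g \<phi>"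
  unfolding dual_form_def
proof (rule integral_dominated_convergence)
  let ?d = "\<lambda>g x. p x * (g x * vderiv \<phi> x - (g x)\<^sup>2 * \<phi> x)"
  note z = test_fun_zero_off[OF phi] test_fun_zero_off[OF test_fun_vderiv[OF phi]]
  show "(\<lambda>x. ?d g x) \<in> borel_measurable lebesgue"
    by (rule borel_measurable_integrable[OF integrable_dual_form[OF g phi]])
  show "(\<lambda>x. ?d (s n) x) \<in> borel_measurable lebesgue" for n
    by (rule borel_measurable_integrable[OF integrable_dual_form[OF s phi]])
  show "integrable lebesgue (\<lambda>x. \<bar>p x * (H x * vderiv \<phi> x)\<bar> + \<bar>p x * ((H x)\<^sup>2 * \<phi> x)\<bar>)"
    by (intro Bochner_Integration.integrable_add integrable_abs
        integrable_against_square_integrable[OF H] phi test_fun_vderiv)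
  show "AE x in lebesgue. (\<lambda>n. ?d (s n) x)
      \<longlonglongrightarrow> ?d g x"
    using lim
  proof eventually_elim
    case (elim x)
    then show ?case by (cases "x \<in> I") (auto simp: z intro!: tendsto_intros)
  qed
  show "AE x in lebesgue. norm (?d (s n) x)
      \<le> \<bar>p x * (H x * vderiv \<phi> x)\<bar> + \<bar>p x * ((H x)\<^sup>2 * \<phi> x)\<bar>" for n
    using dom
  proof eventually_elim
    case (elim x)
    show ?case
    proof (cases "x \<in> I")
      case True
      then have le: "\<bar>s n x\<bar> \<le> H x" using elim by blast
      then have "\<bar>s n x\<bar> \<le> \<bar>H x\<bar>" by linarith
      moreover have "\<bar>s n x\<bar>\<^sup>2 \<le> (H x)\<^sup>2" using le by (intro power_mono) auto
      ultimately have "\<bar>p x\<bar> * (\<bar>s n x\<bar> * \<bar>vderiv \<phi> x\<bar>) \<le> \<bar>p x\<bar> * (\<bar>H x\<bar> * \<bar>vderiv \<phi> x\<bar>)"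
        "\<bar>p x\<bar> * ((s n x)\<^sup>2 * \<bar>\<phi> x\<bar>) \<le> \<bar>p x\<bar> * ((H x)\<^sup>2 * \<bar>\<phi> x\<bar>)"
        by (auto intro!: mult_left_mono mult_right_mono)
      then show ?thesis
        using abs_triangle_ineq4[of "p x * (s n x * vderiv \<phi> x)" "p x * ((s n x)\<^sup>2 * \<phi> x)"]
        by (simp add: abs_mult right_diff_distrib)
    next
      case False
      then show ?thesis by (simp add: z)
    qed
  qed
qed

text \<open>
  Completing the square in \<open>\<integral> p (2 g \<kappa> \<kappa>' - g\<^sup>2 \<kappa>\<^sup>2)\<close>: a lower bound on the dual form at \<open>\<kappa>\<^sup>2\<close> forces \<open>g\<close> to be
  bounded in \<open>L\<^sup>2\<close> where \<open>\<kappa> = 1\<close>. This a priori bound makes the compactness argument possible.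
\<close>

lemma dual_form_local_bound:
  assumes g: "loc_square_integrable I g" and k: "\<kappa> \<in> test_functions I"
    and K: "compact K" "K \<subseteq> I" "\<And>x. x \<in> K \<Longrightarrow> \<kappa> x = 1"
    and le: "t \<le> dual_form g (\<lambda>x. (\<kappa> x)\<^sup>2)"
  shows "(LINT x|lebesgue. indicator K x * (g x)\<^sup>2) \<le> 2 * (2 * (LINT x|lebesgue. p x * (vderiv \<kappa> x)\<^sup>2) - t) / m"
proof -
  have k2: "(\<lambda>x. (\<kappa> x)\<^sup>2) \<in> test_functions I" by (rule test_fun_power2[OF k])
  have iK: "integrable lebesgue (\<lambda>x. indicator K x * (g x)\<^sup>2)"
    using g K by (simp add: loc_square_integrable_def)
  have ip: "integrable lebesgue (\<lambda>x. p x * (vderiv \<kappa> x)\<^sup>2)"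
    by (rule L1_loc_integrable_test[OF p test_fun_power2[OF test_fun_vderiv[OF k]]])
  have "(LINT x|lebesgue. p x * (g x * vderiv (\<lambda>x. (\<kappa> x)\<^sup>2) x - (g x)\<^sup>2 * (\<kappa> x)\<^sup>2))
     \<le> (LINT x|lebesgue. 2 * (p x * (vderiv \<kappa> x)\<^sup>2) - (m / 2) * (indicator K x * (g x)\<^sup>2))"
  proof (rule integral_mono_AE[OF integrable_dual_form[OF g k2]])
    show "integrable lebesgue (\<lambda>x. 2 * (p x * (vderiv \<kappa> x)\<^sup>2) - (m / 2) * (indicator K x * (g x)\<^sup>2))"
      by (intro Bochner_Integration.integrable_diff integrable_mult_right ip iK)
    show "AE x in lebesgue. p x * (g x * vderiv (\<lambda>x. (\<kappa> x)\<^sup>2) x - (g x)\<^sup>2 * (\<kappa> x)\<^sup>2)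
        \<le> 2 * (p x * (vderiv \<kappa> x)\<^sup>2) - (m / 2) * (indicator K x * (g x)\<^sup>2)"
      using pb
    proof eventually_elim
      case (elim x)
      show ?case
      proof (cases "x \<in> I")
        case True
        then have px: "m \<le> p x" "0 \<le> p x" using elim m by auto
        have "0 \<le> p x / 2 * (g x * \<kappa> x - 2 * vderiv \<kappa> x)\<^sup>2" using px by simp
        also have "\<dots> = 2 * (p x * (vderiv \<kappa> x)\<^sup>2) - p x / 2 * ((g x)\<^sup>2 * (\<kappa> x)\<^sup>2)
            - p x * (g x * (2 * \<kappa> x * vderiv \<kappa> x) - (g x)\<^sup>2 * (\<kappa> x)\<^sup>2)"
          by (simp add: power2_eq_square field_simps)
        finally have 1: "p x * (g x * (2 * \<kappa> x * vderiv \<kappa> x) - (g x)\<^sup>2 * (\<kappa> x)\<^sup>2)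
            \<le> 2 * (p x * (vderiv \<kappa> x)\<^sup>2) - p x / 2 * ((g x)\<^sup>2 * (\<kappa> x)\<^sup>2)" by simp
        have "(m / 2) * (indicator K x * (g x)\<^sup>2) \<le> p x / 2 * ((g x)\<^sup>2 * (\<kappa> x)\<^sup>2)"
        proof (cases "x \<in> K")
          case True
          then show ?thesis using px K(3)[OF True] by (simp add: mult_right_mono)
        next
          case False
          then show ?thesis using px by simp
        qed
        then show ?thesis using 1 by (simp add: vderiv_power2[OF k])
      next
        case False
        then show ?thesis
          using test_fun_zero_off[OF k2] test_fun_zero_off[OF test_fun_vderiv[OF k2]]
            test_fun_zero_off[OF test_fun_vderiv[OF k]] K(2) by (auto simp: indicator_def)
      qed
    qed
  qed
  then have "t \<le> 2 * (LINT x|lebesgue. p x * (vderiv \<kappa> x)\<^sup>2) - (m / 2) * (LINT x|lebesgue. indicator K x * (g x)\<^sup>2)"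
    using le ip iK by (simp add: dual_form_def)
  then show ?thesis using m by (simp add: field_simps)
qed

text \<open>
  Each pair of a nonnegative test function \<open>\<phi>\<close> and a tolerance \<open>e > 0\<close> gives the closed convex set of
  functions \<open>g\<close> with \<open>\<tau> \<phi> - e \<le> dual_form g \<phi>\<close>. Finitely many of these sets meet by
  \<open>approximate_supersolution\<close>. If the squares of the cutoffs \<open>\<kappa> 0, \<dots>, \<kappa> n\<close> are added to the finite family,
  the element found obeys the local bounds on \<open>K 0, \<dots>, K n\<close>; set to zero outside \<open>K n\<close>, which contains the
  supports of the given test functions, it lies in the unit ball of the weighted \<open>L\<^sup>2\<close> space.
\<close>

theorem supersolution_exists:
  assumes qp: "sq_quotient_L1_loc I q p"
    and red: "\<And>h. h \<in> test_functions I \<Longrightarrow> 0 \<le> reduced_form h"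
  obtains g where "loc_square_integrable I g"
    "\<And>\<phi>. \<phi> \<in> test_functions I \<Longrightarrow> (\<And>x. 0 \<le> \<phi> x) \<Longrightarrow> \<tau> \<phi> \<le> dual_form g \<phi>"
proof -
  have pos: "AE x\<in>I in lebesgue. 0 \<le> p x" using pb by (rule eventually_mono) (use m in auto)
  obtain K :: "nat \<Rightarrow> real set" where K: "\<And>n. compact (K n)" "\<And>n. K n \<subseteq> I" "\<And>n. K n \<subseteq> interior (K (Suc n))"
      "\<Union>(range K) = I" "\<And>L. compact L \<Longrightarrow> L \<subseteq> I \<Longrightarrow> \<exists>N. \<forall>n\<ge>N. L \<subseteq> K n"
    using open_Union_compact_subsets[OF open_I] by metis
  have Ksuc: "K n \<subseteq> K (Suc n)" for n using K(3) interior_subset by blast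
  have Km: "K n \<in> sets lebesgue" for n by (rule fmeasurableD[OF lmeasurable_compact[OF K(1)]])
  have "\<exists>k :: real \<Rightarrow> real. k \<in> test_functions I \<and> (\<forall>x\<in>K n. k x = 1)" for n
    using cutoff_function[OF open_I interval_I K(1,2)] by metis
  then obtain \<kappa> :: "nat \<Rightarrow> real \<Rightarrow> real" where k: "\<And>n. \<kappa> n \<in> test_functions I" "\<And>n x. x \<in> K n \<Longrightarrow> \<kappa> n x = 1"
    by metis
  have k2: "(\<lambda>x. (\<kappa> n x)\<^sup>2) \<in> test_functions I" for n by (rule test_fun_power2[OF k(1)])
  \<comment> \<open>the bound of \<open>dual_form_local_bound\<close> for tolerances of at most \<open>1\<close>\<close>
  define B where "B n = 2 * (2 * (LINT x|lebesgue. p x * (vderiv (\<kappa> n) x)\<^sup>2) - (\<tau> (\<lambda>x. (\<kappa> n x)\<^sup>2) - 1)) / m" for n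
  define c where "c n = (1/2) ^ Suc n / (1 + \<bar>B n\<bar>)" for n
  have c: "0 < c n" for n by (simp add: c_def add_pos_nonneg)
  have cB: "c n * B n \<le> (1/2) ^ Suc n" for n
  proof -
    have "c n * B n \<le> c n * (1 + \<bar>B n\<bar>)" using c[of n] by (intro mult_left_mono) auto
    also have "\<dots> = (1/2) ^ Suc n"
    proof -
      have "1 + \<bar>B n\<bar> \<noteq> 0" by linarith
      then show ?thesis unfolding c_def times_divide_eq_left by (rule nonzero_mult_div_cancel_right)
    qed
    finally show ?thesis .
  qed
  obtain w where w: "w \<in> borel_measurable lebesgue" "\<And>x. 0 \<le> w x" "\<And>n. \<exists>d>0. \<forall>x\<in>K n. d \<le> w x"
      "\<And>n x. x \<in> K n \<Longrightarrow> w x \<le> (\<Sum>k\<le>n. c k * indicator (K k) x)"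
    by (rule exhaustion_weight[OF K(1,4) Ksuc c]) (rule that)
  define \<mu> where "\<mu> = density lebesgue (\<lambda>x. ennreal (w x))"
  have meas: "(f \<in> borel_measurable \<mu>) = (f \<in> borel_measurable lebesgue)" for f :: "real \<Rightarrow> real"
    unfolding \<mu>_def by simp
  have int\<mu>: "integrable \<mu> f = integrable lebesgue (\<lambda>x. w x * f x)" if "f \<in> borel_measurable lebesgue" for f :: "real \<Rightarrow> real"
    unfolding \<mu>_def using integrable_density[OF that w(1)] w(2) by simp
  have wI: "0 < w x" if xI: "x \<in> I" for x
  proof -
    obtain n where "x \<in> K n" using xI K(4) by blast
    then show ?thesis using w(3)[of n] by force
  qed
  have loc: "loc_square_integrable I f" if f: "square_integrable \<mu> f" for f
    unfolding loc_square_integrable_def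
  proof (intro conjI allI impI)
    show mf: "f \<in> borel_measurable lebesgue" using f by (simp add: square_integrable_def meas)
    fix L assume L: "compact L \<and> L \<subseteq> I"
    then obtain n where n: "L \<subseteq> K n" using K(5)[of L] by blast
    obtain d where d: "0 < d" "\<And>x. x \<in> K n \<Longrightarrow> d \<le> w x" using w(3)[of n] by blast
    have i: "integrable lebesgue (\<lambda>x. w x * (f x)\<^sup>2)"
      using f int\<mu>[of "\<lambda>x. (f x)\<^sup>2"] mf by (simp add: square_integrable_def)
    show "integrable lebesgue (\<lambda>x. indicator L x * (f x)\<^sup>2)"
    proof (rule Bochner_Integration.integrable_bound)
      show "integrable lebesgue (\<lambda>x. (1 / d) * (w x * (f x)\<^sup>2))" by (rule integrable_mult_right[OF i])
      show "(\<lambda>x. indicator L x * (f x)\<^sup>2) \<in> borel_measurable lebesgue"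
        using mf L by (intro borel_measurable_times borel_measurable_power borel_measurable_indicator
            fmeasurableD lmeasurable_compact) auto
      show "AE x in lebesgue. norm (indicator L x * (f x)\<^sup>2) \<le> norm ((1 / d) * (w x * (f x)\<^sup>2))"
      proof (rule AE_I2)
        fix x
        show "norm (indicator L x * (f x)\<^sup>2) \<le> norm ((1 / d) * (w x * (f x)\<^sup>2))"
        proof (cases "x \<in> L")
          case True
          then have "1 * (f x)\<^sup>2 \<le> (w x / d) * (f x)\<^sup>2"
            using d(1) d(2)[of x] n by (intro mult_right_mono) (auto simp: field_simps)
          then show ?thesis using True d(1) w(2)[of x] by (simp add: abs_mult)
        qed simp
      qed
    qed
  qed
  define C where "C \<phi> e = {f. square_integrable \<mu> f \<and> \<tau> \<phi> - e \<le> dual_form f \<phi>}" for \<phi> e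
  define T where "T = {\<phi> :: real \<Rightarrow> real. \<phi> \<in> test_functions I \<and> (\<forall>x. 0 \<le> \<phi> x)}"
  define \<C> where "\<C> = (\<lambda>(\<phi>, e). C \<phi> e) ` (T \<times> {0<..})"
  have CE: "\<exists>\<phi> e. X = C \<phi> e \<and> \<phi> \<in> test_functions I \<and> (\<forall>x. 0 \<le> \<phi> x) \<and> 0 < e" if "X \<in> \<C>" for X
    using that unfolding \<C>_def T_def by auto
  have "\<exists>g. square_integrable \<mu> g \<and> (\<forall>X\<in>\<C>. g \<in> X)"
  proof (rule square_integrable_finite_intersection[where D = 1])
    show "square_integrable \<mu> f" if "X \<in> \<C>" "f \<in> X" for X f
      using CE[OF that(1)] that(2) by (auto simp: C_def)
  next
    fix X f g assume X: "X \<in> \<C>" "f \<in> X" "g \<in> X"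
    obtain \<phi> e where Xe: "X = C \<phi> e" "\<phi> \<in> test_functions I" "\<And>x. 0 \<le> \<phi> x" using CE[OF X(1)] by blast
    have f: "square_integrable \<mu> f" "\<tau> \<phi> - e \<le> dual_form f \<phi>" and g: "square_integrable \<mu> g" "\<tau> \<phi> - e \<le> dual_form g \<phi>"
      using X by (auto simp: Xe C_def)
    have fg: "square_integrable \<mu> (\<lambda>x. (f x + g x) / 2)" by (rule square_integrable_midpoint[OF f(1) g(1)])
    show "(\<lambda>x. (f x + g x) / 2) \<in> X"
      using dual_form_midpoint[OF loc[OF f(1)] loc[OF g(1)] loc[OF fg] Xe(2,3)] fg f(2) g(2)
      by (simp add: Xe C_def)
  next
    fix X f s G
    assume X: "X \<in> \<C>" "\<And>n. s n \<in> X" and f: "square_integrable \<mu> f" and G: "square_integrable \<mu> G"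
      and dom: "AE x in \<mu>. \<forall>n. \<bar>s n x\<bar> \<le> G x" and lim: "AE x in \<mu>. (\<lambda>n. s n x) \<longlonglongrightarrow> f x"
    obtain \<phi> e where Xe: "X = C \<phi> e" "\<phi> \<in> test_functions I" using CE[OF X(1)] by blast
    have AE\<mu>: "AE x\<in>I in lebesgue. P x" if "AE x in \<mu>. P x" for P
    proof -
      have "AE x in lebesgue. 0 < ennreal (w x) \<longrightarrow> P x"
        using that w(1) unfolding \<mu>_def by (subst (asm) AE_density) auto
      then show ?thesis by (rule eventually_mono) (use wI in auto)
    qed
    have s: "square_integrable \<mu> (s n)" "\<tau> \<phi> - e \<le> dual_form (s n) \<phi>" for n
      using X(2)[of n] by (auto simp: Xe C_def)
    have "(\<lambda>n. dual_form (s n) \<phi>) \<longlonglongrightarrow> dual_form f \<phi>"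
      by (rule dual_form_continuous[OF loc[OF s(1)] loc[OF f] loc[OF G] AE\<mu>[OF dom] AE\<mu>[OF lim] Xe(2)])
    then have "\<tau> \<phi> - e \<le> dual_form f \<phi>" using s(2) by (meson LIMSEQ_le_const)
    then show "f \<in> X" using f by (simp add: Xe C_def)
  next
    fix F assume F: "finite F" "F \<subseteq> \<C>"
    obtain A where A: "finite A" "A \<subseteq> T \<times> {0<..}" "F = (\<lambda>(\<phi>, e). C \<phi> e) ` A"
      using finite_subset_image[OF F[unfolded \<C>_def]] by metis
    \<comment> \<open>a single tolerance that serves all members of \<open>F\<close> and the cutoffs\<close>
    define e where "e = Min (insert 1 (snd ` A))"
    have e: "0 < e" "e \<le> 1" "\<And>\<phi> e'. (\<phi>, e') \<in> A \<Longrightarrow> e \<le> e'"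
    proof -
      show "0 < e" unfolding e_def using A(1,2) by (subst Min_gr_iff) auto
      show "e \<le> 1" unfolding e_def using A(1) by (intro Min_le) auto
      show "e \<le> e'" if "(\<phi>, e') \<in> A" for \<phi> e' unfolding e_def using A(1) that by (intro Min_le) force+
    qed
    have supp: "\<exists>n. \<forall>\<phi>\<in>S. \<forall>x. x \<notin> K n \<longrightarrow> \<phi> x = 0" if "finite S" "S \<subseteq> test_functions I" for S :: "(real \<Rightarrow> real) set"
      using that
    proof (induction S)
      case empty
      then show ?case by simp
    next
      case (insert \<phi> S)
      obtain n1 where n1: "\<forall>\<phi>\<in>S. \<forall>x. x \<notin> K n1 \<longrightarrow> \<phi> x = 0" using insert by auto
      have "\<phi> \<in> test_functions I" using insert.prems by simp
      then obtain L where L: "compact L" "L \<subseteq> I" "\<And>x. x \<notin> L \<Longrightarrow> \<phi> x = 0"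
        by (rule test_fun_support) (rule that)
      obtain n2 where n2: "L \<subseteq> K n2" using K(5)[OF L(1,2)] by blast
      have "K i \<subseteq> K j" if "i \<le> j" for i j using lift_Suc_mono_le[of K, OF Ksuc that] .
      then have "K n1 \<subseteq> K (max n1 n2)" "K n2 \<subseteq> K (max n1 n2)" by auto
      then show ?case using n1 L(3) n2 by (intro exI[of _ "max n1 n2"]) blast
    qed
    have fA: "fst ` A \<subseteq> test_functions I" "\<And>\<phi> x. \<phi> \<in> fst ` A \<Longrightarrow> 0 \<le> \<phi> x" using A(2) by (auto simp: T_def)
    obtain n where n: "\<And>\<phi> x. \<phi> \<in> fst ` A \<Longrightarrow> x \<notin> K n \<Longrightarrow> \<phi> x = 0"
      using supp[OF finite_imageI[OF A(1)] fA(1)] by blast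
    define S where "S = fst ` A \<union> (\<lambda>k x. (\<kappa> k x)\<^sup>2) ` {..n}"
    have S: "finite S" "S \<subseteq> test_functions I" "\<And>\<phi> x. \<phi> \<in> S \<Longrightarrow> 0 \<le> \<phi> x"
      using A(1) fA k2 by (auto simp: S_def)
    obtain n' where n': "\<And>\<phi> x. \<phi> \<in> S \<Longrightarrow> x \<notin> K n' \<Longrightarrow> \<phi> x = 0" using supp[OF S(1,2)] by blast
    have "\<exists>g\<in>test_functions I. \<forall>\<phi>\<in>S. \<tau> \<phi> - e \<le> dual_form g \<phi>"
      unfolding dual_form_def
      by (rule approximate_supersolution[where K = "K n'"]) (fact pos qp red K S n' e)+
    then obtain g where g: "g \<in> test_functions I" "\<And>\<phi>. \<phi> \<in> S \<Longrightarrow> \<tau> \<phi> - e \<le> dual_form g \<phi>"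
      by blast
    have lg: "loc_square_integrable I g" by (rule loc_square_integrable_test[OF g(1)])
    define G where "G x = indicator (K n) x * g x" for x
    have mG: "G \<in> borel_measurable lebesgue"
      unfolding G_def[abs_def] using Km[of n] lg
      by (intro borel_measurable_times borel_measurable_indicator) (auto simp: loc_square_integrable_def)
    have ik: "integrable lebesgue (\<lambda>x. indicator (K j) x * (g x)\<^sup>2)" for j
      using lg K(1,2) by (simp add: loc_square_integrable_def)
    have bnd: "(LINT x|lebesgue. indicator (K j) x * (g x)\<^sup>2) \<le> B j" if "j \<le> n" for j
    proof -
      have "(\<lambda>x. (\<kappa> j x)\<^sup>2) \<in> S" using that by (auto simp: S_def)
      from g(2)[OF this] e(2) have "\<tau> (\<lambda>x. (\<kappa> j x)\<^sup>2) - 1 \<le> dual_form g (\<lambda>x. (\<kappa> j x)\<^sup>2)" by linarith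
      from dual_form_local_bound[OF lg k(1) K(1,2) k(2) this] show ?thesis by (simp add: B_def)
    qed
    have wG: "w x * (G x)\<^sup>2 \<le> (\<Sum>j\<le>n. c j * (indicator (K j) x * (g x)\<^sup>2))" for x
    proof (cases "x \<in> K n")
      case True
      then have "w x * (G x)\<^sup>2 \<le> (\<Sum>j\<le>n. c j * indicator (K j) x) * (g x)\<^sup>2"
        unfolding G_def using w(4)[OF True] by (simp add: mult_right_mono)
      then show ?thesis unfolding sum_distrib_right mult.assoc .
    next
      case False
      then have "w x * (G x)\<^sup>2 = 0" by (simp add: G_def)
      also have "0 \<le> (\<Sum>j\<le>n. c j * (indicator (K j) x * (g x)\<^sup>2))"
        using c by (intro sum_nonneg mult_nonneg_nonneg) (auto simp: less_imp_le)
      finally show ?thesis .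
    qed
    have isum: "integrable lebesgue (\<lambda>x. \<Sum>j\<le>n. c j * (indicator (K j) x * (g x)\<^sup>2))"
      by (intro Bochner_Integration.integrable_sum integrable_mult_right ik)
    have iwG: "integrable lebesgue (\<lambda>x. w x * (G x)\<^sup>2)"
    proof (rule Bochner_Integration.integrable_bound[OF isum])
      show "(\<lambda>x. w x * (G x)\<^sup>2) \<in> borel_measurable lebesgue"
        by (intro borel_measurable_times borel_measurable_power w mG)
      show "AE x in lebesgue. norm (w x * (G x)\<^sup>2) \<le> norm (\<Sum>j\<le>n. c j * (indicator (K j) x * (g x)\<^sup>2))"
      proof (rule AE_I2)
        fix x
        have "0 \<le> w x * (G x)\<^sup>2" using w(2)[of x] by simp
        then show "norm (w x * (G x)\<^sup>2) \<le> norm (\<Sum>j\<le>n. c j * (indicator (K j) x * (g x)\<^sup>2))"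
          using wG[of x] unfolding real_norm_def by linarith
      qed
    qed
    have GL2: "square_integrable \<mu> G"
      using mG iwG int\<mu>[of "\<lambda>x. (G x)\<^sup>2"] by (simp add: square_integrable_def meas)
    have "(LINT x|\<mu>. (G x)\<^sup>2) = (LINT x|lebesgue. w x * (G x)\<^sup>2)"
      unfolding \<mu>_def using integral_density[of "\<lambda>x. (G x)\<^sup>2" lebesgue w] mG w(1,2) by simp
    also have "\<dots> \<le> (LINT x|lebesgue. (\<Sum>j\<le>n. c j * (indicator (K j) x * (g x)\<^sup>2)))"
      by (rule integral_mono[OF iwG isum wG])
    also have "\<dots> = (\<Sum>j\<le>n. c j * (LINT x|lebesgue. indicator (K j) x * (g x)\<^sup>2))"
      using ik by (subst Bochner_Integration.integral_sum) auto
    also have "\<dots> \<le> (\<Sum>j\<le>n. (1/2) ^ Suc j)"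
    proof (rule sum_mono)
      fix j assume "j \<in> {..n}"
      then have "c j * (LINT x|lebesgue. indicator (K j) x * (g x)\<^sup>2) \<le> c j * B j"
        using c[of j] bnd[of j] by (intro mult_left_mono) auto
      then show "c j * (LINT x|lebesgue. indicator (K j) x * (g x)\<^sup>2) \<le> (1/2) ^ Suc j"
        using cB[of j] by linarith
    qed
    also have "\<dots> \<le> 1" by (rule sum_half_powers)
    finally have "(LINT x|\<mu>. (G x)\<^sup>2) \<le> 1" .
    moreover have "G \<in> X" if XF: "X \<in> F" for X
    proof -
      obtain \<phi> e' where X: "X = C \<phi> e'" "(\<phi>, e') \<in> A" using XF A(3) by auto
      have phi: "\<phi> \<in> fst ` A" using X(2) by force
      have "G x * vderiv \<phi> x - (G x)\<^sup>2 * \<phi> x = g x * vderiv \<phi> x - (g x)\<^sup>2 * \<phi> x" for x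
        using n[OF phi] vderiv_eq_0_off_support[OF compact_imp_closed[OF K(1)] n[OF phi]]
        by (cases "x \<in> K n") (auto simp: G_def)
      then have "dual_form G \<phi> = dual_form g \<phi>" unfolding dual_form_def by simp
      moreover have "\<tau> \<phi> - e' \<le> dual_form g \<phi>"
        using g(2)[of \<phi>] phi e(3)[OF X(2)] by (auto simp: S_def)
      ultimately show ?thesis using GL2 by (simp add: X(1) C_def)
    qed
    ultimately show "\<exists>f. square_integrable \<mu> f \<and> (\<forall>X\<in>F. f \<in> X) \<and> (LINT x|\<mu>. (f x)\<^sup>2) \<le> 1"
      using GL2 by (intro exI[of _ G] conjI ballI)
  qed
  then obtain g where g: "square_integrable \<mu> g" "\<And>X. X \<in> \<C> \<Longrightarrow> g \<in> X" by blast
  have "\<tau> \<phi> \<le> dual_form g \<phi>" if "\<phi> \<in> test_functions I" "\<And>x. 0 \<le> \<phi> x" for \<phi>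
  proof (rule field_le_epsilon)
    fix e :: real assume "0 < e"
    then have "C \<phi> e \<in> \<C>" using that by (auto simp: \<C>_def T_def)
    from g(2)[OF this] show "\<tau> \<phi> \<le> dual_form g \<phi> + e" by (simp add: C_def)
  qed
  then show ?thesis by (rule that[OF loc[OF g(1)]])
qed

theorem riccati_if_accretive:
  assumes qp: "sq_quotient_L1_loc I q p" and acc: "neg_L_accretive I a b c"
  shows "\<exists>f. f \<in> L2_loc I \<and> riccati_ineq I b c p q f"
proof -
  obtain g where g: "loc_square_integrable I g"
      "\<And>\<phi>. \<phi> \<in> test_functions I \<Longrightarrow> (\<And>x. 0 \<le> \<phi> x) \<Longrightarrow> \<tau> \<phi> \<le> dual_form g \<phi>"
    using supersolution_exists[OF qp accretive_imp_potential_bound(3)[OF acc]] by blast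
  define f where "f x = - ((indicator I x * p x) * g x)" for x
  have mg: "g \<in> borel_measurable lebesgue" using g(1) by (simp add: loc_square_integrable_def)
  have mf: "f \<in> borel_measurable lebesgue"
    unfolding f_def[abs_def] by (intro borel_measurable_uminus borel_measurable_times L1_loc_measurable[OF open_I p] mg)
  have "f \<in> L2_loc I"
    unfolding L2_loc_def
  proof (intro CollectI allI impI conjI)
    fix K assume K: "compact K \<and> K \<subseteq> I"
    then have Km: "K \<in> sets lebesgue" by (simp add: fmeasurableD lmeasurable_compact)
    show "f \<in> borel_measurable (lebesgue_on K)"
      by (rule measurable_restrict_space1[OF mf])
    show "(\<lambda>x. (f x)\<^sup>2) absolutely_integrable_on K"
      unfolding set_integrable_def
    proof (rule Bochner_Integration.integrable_bound)
      show "integrable lebesgue (\<lambda>x. M\<^sup>2 * (indicator K x * (g x)\<^sup>2))"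
        using g(1) K by (simp add: loc_square_integrable_def)
      show "(\<lambda>x. indicator K x *\<^sub>R (f x)\<^sup>2) \<in> borel_measurable lebesgue"
        by (intro borel_measurable_scaleR borel_measurable_indicator Km borel_measurable_power mf)
      show "AE x in lebesgue. norm (indicator K x *\<^sub>R (f x)\<^sup>2) \<le> norm (M\<^sup>2 * (indicator K x * (g x)\<^sup>2))"
        using pb
      proof eventually_elim
        case (elim x)
        show ?case
        proof (cases "x \<in> K")
          case True
          then have xI: "x \<in> I" using K by blast
          then have "(p x)\<^sup>2 \<le> M\<^sup>2" using elim m by (intro power_mono) auto
          then have "(p x)\<^sup>2 * (g x)\<^sup>2 \<le> M\<^sup>2 * (g x)\<^sup>2" by (intro mult_right_mono) auto
          then show ?thesis using True xI by (simp add: f_def power_mult_distrib)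
        qed simp
      qed
    qed
  qed
  moreover have "riccati_ineq I b c p q f"
    unfolding riccati_ineq_def dist_le_def
  proof (intro ballI impI)
    fix \<phi> :: "real \<Rightarrow> real" assume phi: "\<phi> \<in> test_functions I" "\<forall>x. 0 \<le> \<phi> x"
    have dphi: "vderiv \<phi> \<in> test_functions I" by (rule test_fun_vderiv[OF phi(1)])
    have "dist_deriv (dist_of_fun I f) \<phi> - dist_of_fun I (\<lambda>x. (f x)\<^sup>2 / p x) \<phi>
       = (LINT x|lebesgue. p x * (g x * vderiv \<phi> x)) - (LINT x|lebesgue. p x * ((g x)\<^sup>2 * \<phi> x))"
    proof -
      have "f x * vderiv \<phi> x = - (p x * (g x * vderiv \<phi> x))" for x
        using test_fun_zero_off[OF dphi, of x] by (cases "x \<in> I") (auto simp: f_def)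
      moreover have "(f x)\<^sup>2 / p x * \<phi> x = p x * ((g x)\<^sup>2 * \<phi> x)" for x
        using test_fun_zero_off[OF phi(1), of x] by (cases "x \<in> I") (auto simp: f_def power2_eq_square)
      ultimately show ?thesis
        by (simp add: dist_deriv_def dist_of_fun_eq[OF phi(1)] dist_of_fun_eq[OF dphi])
    qed
    also have "\<dots> = dual_form g \<phi>"
      using integrable_against_square_integrable(1)[OF g(1) dphi] integrable_against_square_integrable(2)[OF g(1) phi(1)]
      by (simp add: dual_form_def right_diff_distrib)
    finally show "0 \<le> dist_deriv (dist_of_fun I f) \<phi> - dist_of_fun I (\<lambda>x. (f x)\<^sup>2 / p x) \<phi>
        - (dist_Re c \<phi> - 1/2 * dist_deriv (dist_Re b) \<phi> + dist_of_fun I (\<lambda>x. (q x)\<^sup>2 / (4 * p x)) \<phi>)"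
      using g(2)[OF phi(1)] phi(2) by (simp add: \<tau>_def zeroth_order_def dist_of_fun_eq[OF phi(1)])
  qed
  ultimately show ?thesis by blast
qed

end

lemma reduced_form_set_integral:
  assumes h: "h \<in> test_functions I"
  shows "reduced_form h = (LINT x:I|lebesgue. p x * (vderiv h x)\<^sup>2)
          - (dist_Re c (\<lambda>x. (h x)\<^sup>2) - 1/2 * dist_deriv (dist_Re b) (\<lambda>x. (h x)\<^sup>2))
          - (LINT x:I|lebesgue. (q x)\<^sup>2 / (4 * p x) * (h x)\<^sup>2)"
proof -
  have "(LINT x:I|lebesgue. p x * (vderiv h x)\<^sup>2) = (LINT x|lebesgue. p x * (vderiv h x)\<^sup>2)"
    by (rule set_integral_eq_integral) (simp add: test_fun_zero_off[OF test_fun_vderiv[OF h]])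
  moreover have "(LINT x:I|lebesgue. (q x)\<^sup>2 / (4 * p x) * (h x)\<^sup>2) = (LINT x|lebesgue. (q x)\<^sup>2 / (4 * p x) * (h x)\<^sup>2)"
    by (rule set_integral_eq_integral) (simp add: test_fun_zero_off[OF h])
  ultimately show ?thesis by (simp add: reduced_form_def zeroth_order_def)
qed

theorem accretive_iff_reduced_form:
  "neg_L_accretive I a b c \<longleftrightarrow> (AE x\<in>I in lebesgue. 0 \<le> p x) \<and> sq_quotient_L1_loc I q p \<and>
    (\<forall>h. h \<in> test_functions I \<longrightarrow> 0 \<le> reduced_form h)"
  using accretive_if_reduced_form accretive_imp_p_nonneg accretive_imp_sq_quotient accretive_imp_potential_bound(3)
  by (intro iffI) blast+

end

theorem theorem2p3:
  fixes I :: "real set"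
    and a b c :: "(real \<Rightarrow> complex) \<Rightarrow> complex"
    and p q :: "real \<Rightarrow> real"
  assumes "open I" and "is_interval I"
    and "a \<in> distributions I" and "b \<in> distributions I" and "c \<in> distributions I"
    and "p \<in> L1_loc I" and "dist_eq I (dist_Re a) (dist_of_fun I p)"
    and "q \<in> L1_loc I" and "dist_eq I (dist_Im b) (dist_of_fun I q)"
  shows
    "(neg_L_accretive I a b c \<longleftrightarrow>
        (AE x\<in>I in lebesgue. 0 \<le> p x) \<and>
        sq_quotient_L1_loc I q p \<and>
        (\<forall>h::real \<Rightarrow> real. h \<in> test_functions I \<longrightarrow>
          (LINT x:I|lebesgue. p x * (vderiv h x)\<^sup>2)
          - (dist_Re c (\<lambda>x. (h x)\<^sup>2) - 1/2 * dist_deriv (dist_Re b) (\<lambda>x. (h x)\<^sup>2))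
          - (LINT x:I|lebesgue. (q x)\<^sup>2 / (4 * p x) * (h x)\<^sup>2) \<ge> 0))
     \<and>
     ((AE x\<in>I in lebesgue. 0 \<le> p x) \<and> sq_quotient_L1_loc I q p \<longrightarrow>
        ((\<exists>f. f \<in> L1_loc I \<and> sq_quotient_L1_loc I f p \<and> riccati_ineq I b c p q f)
           \<longrightarrow> neg_L_accretive I a b c)
        \<and>
        (neg_L_accretive I a b c \<and>
           (\<exists>m M. 0 < m \<and> 0 < M \<and> (AE x\<in>I in lebesgue. m \<le> p x \<and> p x \<le> M))
           \<longrightarrow> (\<exists>f. f \<in> L2_loc I \<and> riccati_ineq I b c p q f)))"
proof -
  interpret divergence_form I a b c p q
    using assms by unfold_locales
  show ?thesis
  proof (intro conjI impI, goal_cases)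
    case 1
    show ?case
      using accretive_iff_reduced_form by (simp only: reduced_form_set_integral cong: imp_cong)
  next
    case 2
    then show ?case using accretive_if_riccati by blast
  next
    case 3
    then show ?case using riccati_if_accretive by blast
  qed
qed

end
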